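(* Let $\Omega$, $X=(X_1,\dots,X_m)$, $1<p<\infty$ be as in the context, and let $\lambda_1=\inf_{v\in \mathcal{W}^{1,p}_{X,0}(\Omega)\setminus\{0\}}\frac{\int_\Omega |Xv|^p\,dx}{\int_\Omega |v|^p\,dx}$ be the first eigenvalue. Then the Poincaré–Friedrichs inequality $$\int_\Omega |u|^p\,dx\le \lambda_1^{-1}\int_\Omega |Xu|^p\,dx$$ holds for all $u\in \mathcal{W}^{1,p}_{X,0}(\Omega)$, and the constant $\lambda_1^{-1}$ is sharp, i.e. the inequality does not hold for all $u\in \mathcal{W}^{1,p}_{X,0}(\Omega)$ with $\lambda_1^{-1}$ replaced by any smaller constant.
   Context: Setting. Let $1<p<\infty$, $m,n\in\mathbb{N}$ with $n\ge 2$ and $m\le n$. Let $U\subset\mathbb{R}^n$ be a bounded domain and let $X_i=\sum_{k=1}^n b_{ik}(x)\partial_{x_k}$, $i=1,\dots,m$, be smooth vector fields on $U$ satisfying the Hörmander condition at step $s$: $s\in\mathbb{N}$ is the smallest integer such that the iterated commutators $X_J=[X_{j_1},\dots[X_{j_{k-1}},X_{j_k}]\dots]$, $J=(j_1,\dots,j_k)\in\{1,\dots,m\}^k$, of length $|J|=k\le s$ span $\mathbb{R}^n$ at each $x\in U$. Let $\Omega\Subset U$ be open and connected (i.e. $\bar\Omega$ is compact and contained in $U$). Sobolev spaces. The formal adjoint of $X_i$ is $X_i^*\varphi=-\sum_k\partial_{x_k}(b_{ik}\varphi)$. For $f\in L^1_{loc}(\Omega)$, $X_if=g\in L^1_{loc}(\Omega)$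 means $\int_\Omega g\varphi\,dx=\int_\Omega f X_i^*\varphi\,dx$ for all $\varphi\in C_0^\infty(\Omega)$. $Xf=(X_1f,\dots,X_mf)$, $|Xf|=(\sum_i (X_if)^2)^{1/2}$. $\mathcal{W}^{1,p}_X(\Omega)=\{f\in L^p(\Omega): X_if\in L^p(\Omega),\ i=1,\dots,m\}$ with norm $(\int_\Omega(|u|^p+|Xu|^p)dx)^{1/p}$, and $\mathcal{W}^{1,p}_{X,0}(\Omega)$ is the closure of $C_0^\infty(\Omega)$ in $\mathcal{W}^{1,p}_X(\Omega)$. All functions are real-valued. *)

theory Defs
  imports "HOL-Analysis.Analysis"
begin

section \<open>Smooth functions and vector fields\<close>

definition partial_deriv :: "'n::finite \<Rightarrow> (real^'n \<Rightarrow> real) \<Rightarrow> real^'n \<Rightarrow> real" where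
  "partial_deriv k f x = frechet_derivative f (at x) (axis k 1)"

text \<open>Intended for open \<open>U\<close> only.\<close>

primrec Ck_on :: "nat \<Rightarrow> (real^'n::finite) set \<Rightarrow> (real^'n \<Rightarrow> real) \<Rightarrow> bool" where
  "Ck_on 0 U f \<longleftrightarrow> continuous_on U f"
| "Ck_on (Suc r) U f \<longleftrightarrow>
     (\<forall>x\<in>U. f differentiable (at x)) \<and> (\<forall>k. Ck_on r U (partial_deriv k f))"

definition smooth_fun_on :: "(real^'n::finite) set \<Rightarrow> (real^'n \<Rightarrow> real) \<Rightarrow> bool" where
  "smooth_fun_on U f \<longleftrightarrow> (\<forall>r. Ck_on r U f)"

text \<open>A vector field \<open>\<Sum>k. b\<^sub>k \<partial>\<^sub>k\<close> is represented by its coefficient map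
  \<open>x \<mapsto> (b\<^sub>k x)\<^sub>k\<close>; a system of fields \<open>X\<close> by the family of the \<open>X i\<close>, so that
  \<open>b\<^sub>i\<^sub>k x = X i x $ k\<close>.\<close>

definition smooth_vector_field_on ::
    "(real^'n::finite) set \<Rightarrow> (real^'n \<Rightarrow> real^'n) \<Rightarrow> bool" where
  "smooth_vector_field_on U V \<longleftrightarrow> (\<forall>k. smooth_fun_on U (\<lambda>x. V x $ k))"

section \<open>The Hoermander condition\<close>

text \<open>The \<open>k\<close>-th coefficient of \<open>VW - WV\<close>.\<close>

definition lie_bracket ::
    "(real^'n::finite \<Rightarrow> real^'n) \<Rightarrow> (real^'n \<Rightarrow> real^'n) \<Rightarrow> real^'n \<Rightarrow> real^'n" where
  "lie_bracket V W x = (\<chi> k. \<Sum>l\<in>UNIV.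
     V x $ l * partial_deriv l (\<lambda>y. W y $ k) x - W x $ l * partial_deriv l (\<lambda>y. V y $ k) x)"

text \<open>\<open>X\<^sub>J = [X\<^sub>j\<^sub>1, \<dots> [X\<^sub>j\<^sub>k\<^sub>-\<^sub>1, X\<^sub>j\<^sub>k] \<dots>]\<close>; the value at the empty list is
  irrelevant.\<close>

fun iterated_commutator ::
    "('m \<Rightarrow> real^'n::finite \<Rightarrow> real^'n) \<Rightarrow> 'm list \<Rightarrow> real^'n \<Rightarrow> real^'n" where
  "iterated_commutator X [] = (\<lambda>x. 0)"
| "iterated_commutator X [j] = X j"
| "iterated_commutator X (j # l # J) = lie_bracket (X j) (iterated_commutator X (l # J))"

definition commutators_span ::
    "('m \<Rightarrow> real^'n::finite \<Rightarrow> real^'n) \<Rightarrow> (real^'n) set \<Rightarrow> nat \<Rightarrow> bool" where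
  "commutators_span X U s \<longleftrightarrow>
     (\<forall>x\<in>U. span {iterated_commutator X J x | J. 1 \<le> length J \<and> length J \<le> s} = UNIV)"

definition hormander_at_step ::
    "('m \<Rightarrow> real^'n::finite \<Rightarrow> real^'n) \<Rightarrow> (real^'n) set \<Rightarrow> nat \<Rightarrow> bool" where
  "hormander_at_step X U s \<longleftrightarrow>
     commutators_span X U s \<and> (\<forall>t<s. \<not> commutators_span X U t)"

definition compactly_inside :: "'a::topological_space set \<Rightarrow> 'a set \<Rightarrow> bool" where
  "compactly_inside \<Omega> U \<longleftrightarrow> compact (closure \<Omega>) \<and> closure \<Omega> \<subseteq> U"

section \<open>Weak derivatives along vector fields\<close>

definition L1_loc :: "(real^'n::finite) set \<Rightarrow> (real^'n \<Rightarrow> real) \<Rightarrow> bool" where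
  "L1_loc \<Omega> f \<longleftrightarrow> f \<in> borel_measurable (lebesgue_on \<Omega>) \<and>
     (\<forall>K. compact K \<and> K \<subseteq> \<Omega> \<longrightarrow> integrable (lebesgue_on K) f)"

text \<open>\<open>C\<^sub>0\<^sup>\<infinity>(\<Omega>)\<close>, its elements being extended by zero to the whole space.\<close>

definition test_functions :: "(real^'n::finite) set \<Rightarrow> (real^'n \<Rightarrow> real) set" where
  "test_functions \<Omega> = {\<phi>. smooth_fun_on UNIV \<phi> \<and> compactly_inside {x. \<phi> x \<noteq> 0} \<Omega>}"

definition formal_adjoint ::
    "(real^'n::finite \<Rightarrow> real^'n) \<Rightarrow> (real^'n \<Rightarrow> real) \<Rightarrow> real^'n \<Rightarrow> real" where
  "formal_adjoint V \<phi> x = - (\<Sum>k\<in>UNIV. partial_deriv k (\<lambda>y. V y $ k * \<phi> y) x)"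

definition has_weak_deriv_along ::
    "(real^'n::finite) set \<Rightarrow> (real^'n \<Rightarrow> real^'n) \<Rightarrow>
     (real^'n \<Rightarrow> real) \<Rightarrow> (real^'n \<Rightarrow> real) \<Rightarrow> bool" where
  "has_weak_deriv_along \<Omega> V f g \<longleftrightarrow> L1_loc \<Omega> f \<and> L1_loc \<Omega> g \<and>
     (\<forall>\<phi>\<in>test_functions \<Omega>.
        (LINT x|lebesgue_on \<Omega>. g x * \<phi> x) = (LINT x|lebesgue_on \<Omega>. f x * formal_adjoint V \<phi> x))"

text \<open>Weak derivatives are unique only up to null sets, so this picks a representative; it is
  meaningful only if a weak derivative exists.\<close>

definition weak_deriv_along ::
    "(real^'n::finite) set \<Rightarrow> (real^'n \<Rightarrow> real^'n) \<Rightarrow> (real^'n \<Rightarrow> real) \<Rightarrow> real^'n \<Rightarrow> real" where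
  "weak_deriv_along \<Omega> V f = (SOME g. has_weak_deriv_along \<Omega> V f g)"

text \<open>Since this is a vector in \<open>real^'m\<close>, its Euclidean norm is \<open>(\<Sum>i. (X\<^sub>i f)\<^sup>2)\<^sup>1\<^sup>/\<^sup>2\<close>.\<close>

definition X_grad ::
    "(real^'n::finite) set \<Rightarrow> ('m::finite \<Rightarrow> real^'n \<Rightarrow> real^'n) \<Rightarrow>
     (real^'n \<Rightarrow> real) \<Rightarrow> real^'n \<Rightarrow> real^'m" where
  "X_grad \<Omega> X f x = (\<chi> i. weak_deriv_along \<Omega> (X i) f x)"

section \<open>Sobolev spaces\<close>

text \<open>Elements of the function spaces are representatives, not classes modulo equality almost
  everywhere.\<close>

definition Lp_fun :: "real \<Rightarrow> (real^'n::finite) set \<Rightarrow> (real^'n \<Rightarrow> real) set" where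
  "Lp_fun p \<Omega> = {f. f \<in> borel_measurable (lebesgue_on \<Omega>) \<and>
     integrable (lebesgue_on \<Omega>) (\<lambda>x. \<bar>f x\<bar> powr p)}"

definition W1p ::
    "real \<Rightarrow> (real^'n::finite) set \<Rightarrow> ('m::finite \<Rightarrow> real^'n \<Rightarrow> real^'n) \<Rightarrow>
     (real^'n \<Rightarrow> real) set" where
  "W1p p \<Omega> X = {f \<in> Lp_fun p \<Omega>. \<forall>i. \<exists>g\<in>Lp_fun p \<Omega>. has_weak_deriv_along \<Omega> (X i) f g}"

definition W1p_norm ::
    "real \<Rightarrow> (real^'n::finite) set \<Rightarrow> ('m::finite \<Rightarrow> real^'n \<Rightarrow> real^'n) \<Rightarrow>
     (real^'n \<Rightarrow> real) \<Rightarrow> real" where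
  "W1p_norm p \<Omega> X u =
     (LINT x|lebesgue_on \<Omega>. \<bar>u x\<bar> powr p + norm (X_grad \<Omega> X u x) powr p) powr (1 / p)"

definition W1p_zero ::
    "real \<Rightarrow> (real^'n::finite) set \<Rightarrow> ('m::finite \<Rightarrow> real^'n \<Rightarrow> real^'n) \<Rightarrow>
     (real^'n \<Rightarrow> real) set" where
  "W1p_zero p \<Omega> X = {u \<in> W1p p \<Omega> X.
     \<forall>\<epsilon>>0. \<exists>\<phi>\<in>test_functions \<Omega>. W1p_norm p \<Omega> X (\<lambda>x. u x - \<phi> x) < \<epsilon>}"

text \<open>Here \<open>v \<noteq> 0\<close> means that \<open>v\<close> does not vanish almost everywhere.\<close>

definition first_eigenvalue ::
    "real \<Rightarrow> (real^'n::finite) set \<Rightarrow> ('m::finite \<Rightarrow> real^'n \<Rightarrow> real^'n) \<Rightarrow> real" where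
  "first_eigenvalue p \<Omega> X =
     Inf {(LINT x|lebesgue_on \<Omega>. norm (X_grad \<Omega> X v x) powr p) /
          (LINT x|lebesgue_on \<Omega>. \<bar>v x\<bar> powr p) | v.
          v \<in> W1p_zero p \<Omega> X \<and> \<not> (AE x in lebesgue_on \<Omega>. v x = 0)}"

end

theory Submission
  imports Defs
begin

text \<open>Both assertions reduce to \<open>\<lambda>\<^sub>1 > 0\<close>, that is, to a bound
  \<open>\<parallel>u\<parallel>\<^sub>p \<le> C \<parallel>Xu\<parallel>\<^sub>p\<close> for test functions, and this is obtained without compact embeddings
  and without flows. Call a point good if such a bound holds with \<open>u\<close> restricted to some ball around
  it. Points outside the closure of \<open>\<Omega>\<close> are good, so the set \<open>S\<close> of bad points is compact.
  Integrating the divergence of \<open>\<psi> \<bar>u\<bar>\<^sup>p X\<^sub>i\<close>, with \<open>\<psi>\<close> supported in a ball slightly larger than one that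
  touches \<open>S\<close> only at \<open>y\<close>, shows that \<open>y\<close> is good if \<open>X\<^sub>i\<close> is transversal to the sphere at \<open>y\<close>. Hence
  every \<open>X\<^sub>i\<close> is orthogonal to all proximal normals of \<open>S\<close>. By an argument due to Bony this property
  passes to commutators. If \<open>S\<close> were not empty, a nearest point of \<open>S\<close> to a point outside \<open>S\<close> would
  yield a nonzero vector orthogonal to all commutators, against the Hoermander condition.\<close>

section \<open>Tangency in the sense of Bony\<close>

text \<open>The obstacle is that the energy controls the derivatives along the \<open>X i\<close>
  only and says nothing about derivatives along their commutators, so a bracket cannot be fed into
  the integral identity. Brackets are used on the geometry of the bad set alone, where tangency is a
  statement about distances and the set may be an arbitrary closed one. All bounds originate off
  \<open>\<Omega>\<close>, where test functions vanish, and are carried inwards across spheres by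
  transversal fields. Coverings and the final contradiction leave the constant without an explicit
  value, but it only has to be finite: once \<open>\<lambda>\<^sub>1\<close> is known to be
  positive, the sharp constant is read off from its definition as an infimum.\<close>

definition proximally_tangent :: "'a::euclidean_space set \<Rightarrow> ('a \<Rightarrow> 'a) \<Rightarrow> bool" where
  "proximally_tangent S V \<longleftrightarrow>
     (\<forall>y\<in>S. \<forall>z. (\<forall>x\<in>S. dist z y \<le> dist z x) \<longrightarrow> V y \<bullet> (z - y) = 0)"

text \<open>Strict differentiability: increments are compared between two arbitrary points near
  \<open>y\<close>. One notion thus yields both a Lipschitz bound near \<open>y\<close>, for the
  distance estimate, and the first-order expansion at \<open>y\<close>, for the approximate
  flow.\<close>

definition has_strict_derivative_at ::
    "('a::euclidean_space \<Rightarrow> 'a) \<Rightarrow> ('a \<Rightarrow> 'a) \<Rightarrow> 'a \<Rightarrow> bool" where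
  "has_strict_derivative_at V A y \<longleftrightarrow> bounded_linear A \<and>
     (\<forall>\<eta>>0. \<exists>\<delta>>0. \<forall>a\<in>ball y \<delta>. \<forall>b\<in>ball y \<delta>. norm (V b - V a - A (b - a)) \<le> \<eta> * norm (b - a))"

lemma proximally_tangent_uminus:
  "proximally_tangent S V \<Longrightarrow> proximally_tangent S (\<lambda>x. - V x)"
  by (simp add: proximally_tangent_def)

lemma has_strict_derivative_at_uminus:
  assumes "has_strict_derivative_at V A y"
  shows "has_strict_derivative_at (\<lambda>x. - V x) (\<lambda>x. - A x) y"
proof -
  have "norm (- V b - - V a - - A (b - a)) = norm (V b - V a - A (b - a))" for a b
    by (metis (no_types, opaque_lifting) minus_diff_eq minus_diff_minus norm_minus_commute)
  then show ?thesis
    using assms by (simp add: has_strict_derivative_at_def bounded_linear_minus)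
qed

text \<open>An Euler scheme with \<open>Suc N\<close> equal steps: the quadratic errors add up to a
  term of order \<open>C * t * h\<close>, which vanishes as \<open>N\<close> grows. Increments
  rather than derivatives are assumed because the squared distance to a closed set need not be
  differentiable.\<close>

lemma discrete_gronwall:
  fixes f :: "real \<Rightarrow> real"
  assumes "0 \<le> t" "0 \<le> \<alpha>" "0 \<le> \<beta>" "0 \<le> C" "0 \<le> f 0"
    and step: "\<And>\<tau> h. 0 \<le> \<tau> \<Longrightarrow> 0 \<le> h \<Longrightarrow> \<tau> + h \<le> t \<Longrightarrow>
      f (\<tau> + h) \<le> (1 + \<alpha> * h) * f \<tau> + h * \<beta> + C * h\<^sup>2"
  shows "f t \<le> exp (\<alpha> * t) * (f 0 + t * \<beta>)"
proof -
  have bound: "f t \<le> exp (\<alpha> * t) * (f 0 + t * (\<beta> + C * (t * inverse (real (Suc N)))))" for N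
  proof -
    define h where "h = t * inverse (real (Suc N))"
    define e where "e = \<beta> + C * h"
    have h0: "0 \<le> h" using assms by (simp add: h_def)
    have e0: "0 \<le> e" using assms h0 by (simp add: e_def)
    have Nh: "real (Suc N) * h = t" by (simp add: h_def)
    have "f (real k * h) \<le> (1 + \<alpha> * h) ^ k * (f 0 + real k * h * e)" if "k \<le> Suc N" for k
      using that
    proof (induction k)
      case 0 then show ?case by simp
    next
      case (Suc k)
      have one: "1 \<le> (1 + \<alpha> * h) ^ Suc k" using assms h0 by (intro one_le_power) simp
      have le: "real k * h + h \<le> t"
      proof -
        have "real (Suc k) * h \<le> real (Suc N) * h" using Suc h0 by (intro mult_right_mono) auto
        then show ?thesis unfolding Nh by (simp add: algebra_simps)
      qed
      have "f (real (Suc k) * h) = f (real k * h + h)" by (simp add: algebra_simps)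
      also have "\<dots> \<le> (1 + \<alpha> * h) * f (real k * h) + h * \<beta> + C * h\<^sup>2"
        using step[of "real k * h" h] h0 le by simp
      also have "\<dots> = (1 + \<alpha> * h) * f (real k * h) + h * e"
        by (simp add: e_def power2_eq_square algebra_simps)
      also have "\<dots> \<le> (1 + \<alpha> * h) * ((1 + \<alpha> * h) ^ k * (f 0 + real k * h * e))
                       + (1 + \<alpha> * h) ^ Suc k * (h * e)"
        using Suc assms h0 e0 one
        by (intro add_mono mult_left_mono mult_le_cancel_right1[THEN iffD2]) (auto simp: mult_less_0_iff)
      also have "\<dots> = (1 + \<alpha> * h) ^ Suc k * (f 0 + real (Suc k) * h * e)"
        by (simp add: algebra_simps)
      finally show ?case .
    qed
    from this[of "Suc N"] have "f t \<le> (1 + \<alpha> * h) ^ Suc N * (f 0 + t * e)"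
      unfolding Nh by simp
    also have "\<dots> \<le> exp (\<alpha> * h) ^ Suc N * (f 0 + t * e)"
      using assms h0 e0 by (intro mult_right_mono power_mono exp_ge_add_one_self) auto
    also have "exp (\<alpha> * h) ^ Suc N = exp (\<alpha> * t)"
      unfolding exp_of_nat_mult[symmetric] Nh[symmetric] by (simp add: algebra_simps)
    finally show ?thesis by (simp add: e_def h_def)
  qed
  have "(\<lambda>N. exp (\<alpha> * t) * (f 0 + t * (\<beta> + C * (t * inverse (real (Suc N))))))
          \<longlonglongrightarrow> exp (\<alpha> * t) * (f 0 + t * (\<beta> + C * (t * 0)))"
    by (intro tendsto_intros LIMSEQ_inverse_real_of_nat)
  then have "f t \<le> exp (\<alpha> * t) * (f 0 + t * (\<beta> + C * (t * 0)))"
    by (rule LIMSEQ_le_const) (use bound in blast)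
  then show ?thesis by simp
qed

text \<open>Let \<open>\<pi>\<close> be a nearest point of \<open>S\<close> to
  \<open>\<gamma> \<tau>\<close>. Half the growth rate of the squared distance is at most the inner
  product of the velocity with \<open>\<gamma> \<tau> - \<pi>\<close>, and tangency makes
  \<open>V \<pi>\<close> orthogonal to that vector. Only the deviation of the velocity from
  \<open>V (\<gamma> \<tau>)\<close> and the variation of \<open>V\<close> between
  \<open>\<gamma> \<tau>\<close> and \<open>\<pi>\<close> contribute.\<close>

lemma infdist_along_quadratic_curve:
  fixes S :: "'a::euclidean_space set"
  assumes S: "closed S" "y \<in> S" and tan: "proximally_tangent S V"
    and lip: "\<And>a b. a \<in> ball y \<delta> \<Longrightarrow> b \<in> ball y \<delta> \<Longrightarrow> norm (V a - V b) \<le> L * norm (a - b)"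
    and pos: "0 < t" "0 \<le> L" "0 \<le> \<epsilon>"
    and \<gamma>: "\<And>\<tau>. \<gamma> \<tau> = p + \<tau> *\<^sub>R v + \<tau>\<^sup>2 *\<^sub>R w"
    and near: "\<And>\<tau>. 0 \<le> \<tau> \<Longrightarrow> \<tau> \<le> t \<Longrightarrow> dist (\<gamma> \<tau>) y < \<delta> / 2"
    and err: "\<And>\<tau>. 0 \<le> \<tau> \<Longrightarrow> \<tau> \<le> t \<Longrightarrow> norm (v + (2 * \<tau>) *\<^sub>R w - V (\<gamma> \<tau>)) \<le> \<epsilon>"
  shows "(infdist (\<gamma> t) S)\<^sup>2 \<le> exp (2 * L * t + 1) * ((infdist p S)\<^sup>2 + t\<^sup>2 * \<epsilon>\<^sup>2)"
proof -
  \<comment> \<open>\<open>G\<close> bounds the speed of \<open>\<gamma>\<close> up to time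
    \<open>t\<close>. \<open>C\<close> collects the coefficients of \<open>h\<^sup>2\<close> in the
    expansion of the squared distance; its second summand uses that this distance stays below
    \<open>\<delta> / 2\<close>.\<close>
  define G where "G = norm v + 2 * t * norm w"
  define C where "C = (G + t * norm w)\<^sup>2 + \<delta> * norm w"
  have \<delta>: "0 < \<delta>" using near[of 0] pos zero_le_dist[of "\<gamma> 0" y] by linarith
  have "(infdist (\<gamma> t) S)\<^sup>2 \<le> exp ((2 * L + 1 / t) * t) * ((infdist (\<gamma> 0) S)\<^sup>2 + t * (t * \<epsilon>\<^sup>2))"
  proof (rule discrete_gronwall[where C = C and f = "\<lambda>\<tau>. (infdist (\<gamma> \<tau>) S)\<^sup>2"])
    show "0 \<le> C" using \<delta> by (simp add: C_def)
    fix \<tau> h :: real assume \<tau>: "0 \<le> \<tau>" "0 \<le> h" "\<tau> + h \<le> t"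
    obtain \<pi> where \<pi>: "\<pi> \<in> S" "infdist (\<gamma> \<tau>) S = dist (\<gamma> \<tau>) \<pi>"
      using infdist_attains_inf[OF S(1)] S(2) by blast
    define d where "d = infdist (\<gamma> \<tau>) S"
    define q where "q = \<gamma> \<tau> - \<pi>"
    define g where "g = v + (2 * \<tau>) *\<^sub>R w"
    have dq: "d = norm q" by (simp add: d_def q_def \<pi> dist_norm)
    have d0: "0 \<le> d" by (simp add: dq)
    have dy: "d \<le> dist (\<gamma> \<tau>) y" using S(2) by (simp add: d_def infdist_le)
    have n: "dist (\<gamma> \<tau>) y < \<delta> / 2" using near \<tau> by simp
    have d\<delta>: "d \<le> \<delta> / 2" using dy n by simp
    have b1: "\<gamma> \<tau> \<in> ball y \<delta>" using n \<delta> by (simp add: dist_commute)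
    \<comment> \<open>Since \<open>y\<close> lies in \<open>S\<close>, the nearest point
      \<open>\<pi>\<close> is no farther from \<open>\<gamma> \<tau>\<close> than \<open>y\<close>
      is; this is why \<open>near\<close> asks for \<open>\<delta> / 2\<close>.\<close>
    have b2: "\<pi> \<in> ball y \<delta>"
      using n dy \<pi> dist_triangle[of y \<pi> "\<gamma> \<tau>"] by (simp add: d_def dist_commute)
    have "\<forall>x\<in>S. dist (\<gamma> \<tau>) \<pi> \<le> dist (\<gamma> \<tau>) x"
      using \<pi> infdist_le by metis
    then have V0: "V \<pi> \<bullet> q = 0" using tan \<pi> by (auto simp: proximally_tangent_def q_def)
    have "g \<bullet> q = (g - V (\<gamma> \<tau>)) \<bullet> q + (V (\<gamma> \<tau>) - V \<pi>) \<bullet> q"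
      using V0 by (simp add: inner_diff_left)
    also have "\<dots> \<le> norm (g - V (\<gamma> \<tau>)) * norm q + norm (V (\<gamma> \<tau>) - V \<pi>) * norm q"
      by (intro add_mono norm_cauchy_schwarz)
    also have "\<dots> \<le> \<epsilon> * norm q + (L * norm q) * norm q"
      using err[of \<tau>] lip[OF b1 b2] \<tau> by (intro add_mono mult_right_mono) (auto simp: g_def q_def)
    finally have gq: "g \<bullet> q \<le> \<epsilon> * d + L * d\<^sup>2" by (simp add: dq power2_eq_square)
    \<comment> \<open>the weight \<open>1 / t\<close> only costs a factor \<open>e\<close> in the Gronwall estimate, and gains \<open>t\<^sup>2 \<epsilon>\<^sup>2\<close> instead of \<open>t \<epsilon>\<^sup>2\<close>\<close>
    have young: "2 * \<epsilon> * d \<le> d\<^sup>2 / t + t * \<epsilon>\<^sup>2"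
    proof -
      have "0 \<le> (d - t * \<epsilon>)\<^sup>2" by simp
      then have "2 * \<epsilon> * d * t \<le> d\<^sup>2 + t * \<epsilon>\<^sup>2 * t"
        by (simp add: power2_eq_square algebra_simps)
      then show ?thesis using pos by (simp add: field_simps)
    qed
    have ng: "norm (g + h *\<^sub>R w) \<le> G + t * norm w"
    proof -
      have "norm g \<le> G" unfolding g_def G_def
        using \<tau> by (intro norm_triangle_mono) (auto intro!: mult_right_mono)
      moreover have "norm (h *\<^sub>R w) \<le> t * norm w" using \<tau> by (auto intro!: mult_right_mono)
      ultimately show ?thesis by (rule norm_triangle_mono)
    qed
    have e: "\<gamma> (\<tau> + h) - \<pi> = q + h *\<^sub>R (g + h *\<^sub>R w)"
    proof -
      have "(\<tau> + h)\<^sup>2 *\<^sub>R w = \<tau>\<^sup>2 *\<^sub>R w + (h * (2 * \<tau>)) *\<^sub>R w + h\<^sup>2 *\<^sub>R w"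
        by (simp add: power2_sum scaleR_left_distrib mult.commute)
      then show ?thesis
        unfolding q_def g_def \<gamma> by (simp add: scaleR_add_left scaleR_add_right power2_eq_square)
    qed
    \<comment> \<open>The old nearest point still bounds the new distance from above, and a
      one-sided estimate is all that the Gronwall argument asks for.\<close>
    have "infdist (\<gamma> (\<tau> + h)) S \<le> norm (q + h *\<^sub>R (g + h *\<^sub>R w))"
      using infdist_le[OF \<pi>(1), of "\<gamma> (\<tau> + h)"] by (simp add: dist_norm e)
    then have "(infdist (\<gamma> (\<tau> + h)) S)\<^sup>2 \<le> (norm (q + h *\<^sub>R (g + h *\<^sub>R w)))\<^sup>2"
      by (intro power_mono infdist_nonneg)
    also have "\<dots> = d\<^sup>2 + 2 * h * (g \<bullet> q) + h\<^sup>2 * (2 * (q \<bullet> w)) + h\<^sup>2 * (norm (g + h *\<^sub>R w))\<^sup>2"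
      unfolding dq power2_norm_eq_inner
      by (simp add: inner_add_left inner_add_right inner_commute power2_eq_square algebra_simps)
    also have "\<dots> \<le> d\<^sup>2 + 2 * h * (\<epsilon> * d + L * d\<^sup>2) + h\<^sup>2 * (\<delta> * norm w) + h\<^sup>2 * (G + t * norm w)\<^sup>2"
    proof (intro add_mono mult_left_mono order_refl)
      have "q \<bullet> w \<le> d * norm w" unfolding dq by (rule norm_cauchy_schwarz)
      also have "\<dots> \<le> \<delta> / 2 * norm w" using d\<delta> by (intro mult_right_mono) auto
      finally show "2 * (q \<bullet> w) \<le> \<delta> * norm w" by simp
    qed (use gq \<tau> ng in \<open>auto intro!: power_mono\<close>)
    also have "\<dots> = d\<^sup>2 + h * (2 * \<epsilon> * d) + 2 * h * L * d\<^sup>2 + C * h\<^sup>2"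
      by (simp add: C_def algebra_simps)
    also have "\<dots> \<le> d\<^sup>2 + h * (d\<^sup>2 / t + t * \<epsilon>\<^sup>2) + 2 * h * L * d\<^sup>2 + C * h\<^sup>2"
      using mult_left_mono[OF young \<tau>(2)] by linarith
    also have "\<dots> = (1 + (2 * L + 1 / t) * h) * d\<^sup>2 + h * (t * \<epsilon>\<^sup>2) + C * h\<^sup>2"
      by (simp add: algebra_simps)
    finally show "(infdist (\<gamma> (\<tau> + h)) S)\<^sup>2
        \<le> (1 + (2 * L + 1 / t) * h) * (infdist (\<gamma> \<tau>) S)\<^sup>2 + h * (t * \<epsilon>\<^sup>2) + C * h\<^sup>2"
      by (simp add: d_def)
  qed (use pos in auto)
  moreover have "(2 * L + 1 / t) * t = 2 * L * t + 1" using pos by (simp add: field_simps)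
  moreover have "\<gamma> 0 = p" by (simp add: \<gamma>)
  ultimately show ?thesis by (simp add: power2_eq_square algebra_simps)
qed

text \<open>A distance of order \<open>o(t\<^sup>2)\<close>: along \<open>V\<close>, \<open>W\<close>, \<open>-V\<close>, \<open>-W\<close> in turn the first-order terms
  cancel and the bracket is the remaining second-order term. Explicit quadratic curves, which solve
  the flow equations up to \<open>o(t)\<close>, take the place of the flows.\<close>

definition second_order_reachable :: "'a::euclidean_space set \<Rightarrow> 'a \<Rightarrow> 'a \<Rightarrow> 'a \<Rightarrow> bool" where
  "second_order_reachable S y a c \<longleftrightarrow>
     (\<forall>\<eta>>0. \<forall>\<^sub>F t in at_right 0. (infdist (y + t *\<^sub>R a + t\<^sup>2 *\<^sub>R c) S)\<^sup>2 \<le> \<eta> * t ^ 4)"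

text \<open>\<open>V\<close> is followed for a further time \<open>t\<close>. At time
  \<open>\<tau>\<close> the position is \<open>y + t a + \<tau> V y\<close> up to order
  \<open>t\<^sup>2\<close>, so the field there is \<open>V y + A (t a + \<tau> V y)\<close> up to
  \<open>o(t)\<close>. Integrating this velocity in \<open>\<tau>\<close> gives the quadratic curve,
  and its end point gives the new coefficients.\<close>

lemma second_order_reachable_step:
  fixes S :: "'a::euclidean_space set"
  assumes S: "closed S" "y \<in> S" and tan: "proximally_tangent S V"
    and str: "has_strict_derivative_at V A y"
    and reach: "second_order_reachable S y a c"
  shows "second_order_reachable S y (a + V y) (c + A a + (1/2) *\<^sub>R A (V y))"
  unfolding second_order_reachable_def
proof (intro allI impI)
  fix \<eta> :: real assume \<eta>: "0 < \<eta>"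
  interpret A: bounded_linear A using str by (simp add: has_strict_derivative_at_def)
  obtain KA where KA: "KA > 0" "\<And>x. norm (A x) \<le> norm x * KA" using A.pos_bounded by blast
  define v where "v = V y"
  define K where "K = norm c + norm (A a) + norm (A v)"
  define K' where "K' = norm a + norm v + K + 1"
  \<comment> \<open>The velocity error \<open>\<kappa> * t\<close> and the initial distance each
    contribute half of \<open>\<eta> * t ^ 4\<close>; \<open>exp 2\<close> bounds the Gronwall
    factor \<open>exp (2 * L * t + 1)\<close> once \<open>2 * L * t < 1\<close>.\<close>
  define \<kappa> where "\<kappa> = sqrt (\<eta> / (2 * exp 2))"
  have \<kappa>: "\<kappa> > 0" "\<kappa>\<^sup>2 = \<eta> / (2 * exp 2)" using \<eta> by (auto simp: \<kappa>_def)
  have K: "0 \<le> K" "0 < K'" by (auto simp: K_def K'_def intro!: add_nonneg_pos)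
  obtain \<delta>1 where \<delta>1: "\<delta>1 > 0"
    "\<And>p q. p \<in> ball y \<delta>1 \<Longrightarrow> q \<in> ball y \<delta>1 \<Longrightarrow> norm (V q - V p - A (q - p)) \<le> 1 * norm (q - p)"
    using str zero_less_one unfolding has_strict_derivative_at_def by meson
  have "\<kappa> / (2 * K') > 0" using \<kappa> K by simp
  then obtain \<delta>2 where \<delta>2: "\<delta>2 > 0"
    "\<And>p q. p \<in> ball y \<delta>2 \<Longrightarrow> q \<in> ball y \<delta>2 \<Longrightarrow>
        norm (V q - V p - A (q - p)) \<le> \<kappa> / (2 * K') * norm (q - p)"
    using str unfolding has_strict_derivative_at_def by meson
  define L where "L = KA + 1"
  have lip: "norm (V p - V q) \<le> L * norm (p - q)" if "p \<in> ball y \<delta>1" "q \<in> ball y \<delta>1" for p q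
  proof -
    have "norm (V p - V q) \<le> norm (V p - V q - A (p - q)) + norm (A (p - q))"
      using norm_triangle_ineq[of "V p - V q - A (p - q)" "A (p - q)"] by simp
    also have "\<dots> \<le> 1 * norm (p - q) + norm (p - q) * KA"
      using \<delta>1(2)[OF that(2,1)] KA by (intro add_mono) auto
    finally show ?thesis by (simp add: L_def algebra_simps)
  qed
  \<comment> \<open>In order: \<open>t\<^sup>2 \<le> t\<close>; the curve stays within
    \<open>\<delta>1 / 2\<close> of \<open>y\<close>, and within \<open>\<delta>2\<close>;
    \<open>2 * L * t < 1\<close>; the second-order part of the displacement costs at most
    \<open>\<kappa> * t / 2\<close>.\<close>
  define T where "T = min 1 (min (\<delta>1 / (2 * K')) (min (\<delta>2 / K') (min (1 / (2 * L)) (\<kappa> / (2 * KA * (K + 1))))))"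
  have T0: "0 < T" using \<delta>1 \<delta>2 K KA \<kappa> by (simp add: T_def L_def)
  have evT: "\<forall>\<^sub>F t in at_right 0. t \<in> {0<..<T}" using T0 by (rule eventually_at_right_real)
  have "0 < \<eta> / (2 * exp 2)" using \<eta> by simp
  then have "\<forall>\<^sub>F t in at_right 0. (infdist (y + t *\<^sub>R a + t\<^sup>2 *\<^sub>R c) S)\<^sup>2 \<le> \<eta> / (2 * exp 2) * t ^ 4"
    using reach unfolding second_order_reachable_def by blast
  with evT show "\<forall>\<^sub>F t in at_right 0.
      (infdist (y + t *\<^sub>R (a + V y) + t\<^sup>2 *\<^sub>R (c + A a + (1/2) *\<^sub>R A (V y))) S)\<^sup>2 \<le> \<eta> * t ^ 4"
  proof eventually_elim
    case (elim t)
    have "0 < t" "t < T" using elim(1) by auto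
    then have t: "0 < t" "t < 1" "t < \<delta>1 / (2 * K')" "t < \<delta>2 / K'" "t < 1 / (2 * L)"
        "t < \<kappa> / (2 * KA * (K + 1))" unfolding T_def min_less_iff_conj by blast+
    define p where "p = y + t *\<^sub>R a + t\<^sup>2 *\<^sub>R c"
    define \<gamma> where "\<gamma> \<tau> = p + \<tau> *\<^sub>R (v + t *\<^sub>R A a) + \<tau>\<^sup>2 *\<^sub>R ((1/2) *\<^sub>R A v)" for \<tau>
    \<comment> \<open>\<open>A (e1 \<tau>)\<close> reproduces the variable part of the velocity
      exactly; \<open>e2\<close> is of order \<open>t\<^sup>2\<close> and only adds an
      error.\<close>
    define e1 where "e1 \<tau> = t *\<^sub>R a + \<tau> *\<^sub>R v" for \<tau>
    define e2 where "e2 \<tau> = t\<^sup>2 *\<^sub>R c + (\<tau> * t) *\<^sub>R A a + (\<tau>\<^sup>2 / 2) *\<^sub>R A v" for \<tau>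
    have ge: "\<gamma> \<tau> - y = e1 \<tau> + e2 \<tau>" for \<tau>
      by (simp add: \<gamma>_def p_def e1_def e2_def algebra_simps)
    have e2: "norm (e2 \<tau>) \<le> K * t\<^sup>2" if "0 \<le> \<tau>" "\<tau> \<le> t" for \<tau>
    proof -
      have "\<tau>\<^sup>2 / 2 \<le> t\<^sup>2" using power_mono[OF that(2,1), of 2] zero_le_power2[of t] by linarith
      moreover have "\<tau> * t \<le> t\<^sup>2" using that t by (simp add: power2_eq_square)
      ultimately have "norm (e2 \<tau>) \<le> t\<^sup>2 * norm c + t\<^sup>2 * norm (A a) + t\<^sup>2 * norm (A v)"
        unfolding e2_def using that t mult_right_mono[OF \<open>\<tau>\<^sup>2 / 2 \<le> t\<^sup>2\<close> norm_ge_zero[of "A v"]]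
        by (intro norm_triangle_mono) (auto intro!: mult_right_mono)
      then show ?thesis by (simp add: K_def algebra_simps)
    qed
    have e12: "norm (\<gamma> \<tau> - y) \<le> K' * t" if "0 \<le> \<tau>" "\<tau> \<le> t" for \<tau>
    proof -
      have "norm (e1 \<tau>) \<le> t * norm a + t * norm v"
        unfolding e1_def using that t by (intro norm_triangle_mono) (auto intro!: mult_right_mono)
      moreover have "K * t\<^sup>2 \<le> K * t" using K t by (intro mult_left_mono) (auto simp: power2_eq_square)
      ultimately have "norm (\<gamma> \<tau> - y) \<le> t * norm a + t * norm v + K * t"
        unfolding ge using e2[OF that] norm_triangle_ineq[of "e1 \<tau>" "e2 \<tau>"] by linarith
      also have "\<dots> \<le> K' * t" using t by (simp add: K'_def algebra_simps)
      finally show ?thesis .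
    qed
    have near1: "dist (\<gamma> \<tau>) y < \<delta>1 / 2" and near2: "\<gamma> \<tau> \<in> ball y \<delta>2"
      if "0 \<le> \<tau>" "\<tau> \<le> t" for \<tau>
      using e12[OF that] t K by (auto simp: dist_norm norm_minus_commute[of y] field_simps)
    have err: "norm ((v + t *\<^sub>R A a) + (2 * \<tau>) *\<^sub>R ((1/2) *\<^sub>R A v) - V (\<gamma> \<tau>)) \<le> \<kappa> * t"
      if "0 \<le> \<tau>" "\<tau> \<le> t" for \<tau>
    proof -
      have "A (\<gamma> \<tau> - y) = A (e1 \<tau>) + A (e2 \<tau>)" unfolding ge by (rule A.add)
      moreover have "A (e1 \<tau>) = t *\<^sub>R A a + \<tau> *\<^sub>R A v" by (simp add: e1_def A.add A.scaleR)
      ultimately have eq: "(v + t *\<^sub>R A a) + (2 * \<tau>) *\<^sub>R ((1/2) *\<^sub>R A v) - V (\<gamma> \<tau>) =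
          - (V (\<gamma> \<tau>) - V y - A (\<gamma> \<tau> - y)) - A (e2 \<tau>)" by (simp add: v_def)
      have "norm (V (\<gamma> \<tau>) - V y - A (\<gamma> \<tau> - y)) \<le> \<kappa> / (2 * K') * norm (\<gamma> \<tau> - y)"
        using \<delta>2(2)[of y "\<gamma> \<tau>"] near2[OF that] \<delta>2(1) by simp
      also have "\<dots> \<le> \<kappa> / (2 * K') * (K' * t)" using e12[OF that] \<kappa> K by (intro mult_left_mono) auto
      also have "\<dots> = \<kappa> * t / 2" using K by simp
      finally have 1: "norm (V (\<gamma> \<tau>) - V y - A (\<gamma> \<tau> - y)) \<le> \<kappa> * t / 2" .
      have "norm (A (e2 \<tau>)) \<le> norm (e2 \<tau>) * KA" by (rule KA)
      also have "\<dots> \<le> ((K + 1) * t\<^sup>2) * KA"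
        using e2[OF that] KA by (intro mult_right_mono) (auto simp: algebra_simps intro: add_increasing)
      also have "\<dots> = (t * (2 * KA * (K + 1))) * (t / 2)" by (simp add: power2_eq_square)
      also have "\<dots> \<le> \<kappa> * (t / 2)"
      proof (intro mult_right_mono)
        have "0 < 2 * KA * (K + 1)" using K KA by simp
        then show "t * (2 * KA * (K + 1)) \<le> \<kappa>"
          using t(6) by (simp only: pos_less_divide_eq less_imp_le)
      qed (use t in simp)
      finally have 2: "norm (A (e2 \<tau>)) \<le> \<kappa> * t / 2" by simp
      show ?thesis unfolding eq using 1 2 norm_triangle_ineq4[of "- (V (\<gamma> \<tau>) - V y - A (\<gamma> \<tau> - y))" "A (e2 \<tau>)"]
        by (simp only: norm_minus_cancel)
    qed
    have "(infdist (\<gamma> t) S)\<^sup>2 \<le> exp (2 * L * t + 1) * ((infdist p S)\<^sup>2 + t\<^sup>2 * (\<kappa> * t)\<^sup>2)"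
      by (rule infdist_along_quadratic_curve[where y = y and \<gamma> = \<gamma> and \<delta> = \<delta>1 and V = V
            and v = "v + t *\<^sub>R A a" and w = "(1/2) *\<^sub>R A v", OF S tan lip])
        (use t \<kappa> KA near1 err in \<open>auto simp: L_def \<gamma>_def\<close>)
    also have "\<dots> \<le> exp 2 * (\<eta> / (2 * exp 2) * t ^ 4 + \<eta> / (2 * exp 2) * t ^ 4)"
    proof (rule mult_mono)
      have "2 * L * t < 1" using t KA by (simp add: L_def field_simps)
      then show "exp (2 * L * t + 1) \<le> exp 2" by simp
      have "t\<^sup>2 * (\<kappa> * t)\<^sup>2 = \<eta> / (2 * exp 2) * t ^ 4"
        by (simp add: power_mult_distrib \<kappa> power4_eq_xxxx power2_eq_square[of t] ac_simps)
      then show "(infdist p S)\<^sup>2 + t\<^sup>2 * (\<kappa> * t)\<^sup>2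
          \<le> \<eta> / (2 * exp 2) * t ^ 4 + \<eta> / (2 * exp 2) * t ^ 4"
        using elim(2) by (simp add: p_def)
    qed auto
    also have "\<dots> = \<eta> * t ^ 4" by simp
    finally have "(infdist (\<gamma> t) S)\<^sup>2 \<le> \<eta> * t ^ 4" .
    moreover have "\<gamma> t = y + t *\<^sub>R (a + V y) + t\<^sup>2 *\<^sub>R (c + A a + (1/2) *\<^sub>R A (V y))"
      by (simp add: \<gamma>_def p_def v_def algebra_simps power2_eq_square)
    ultimately show ?case by simp
  qed
qed

text \<open>If \<open>D\<close> had a positive component towards \<open>z\<close>, then
  \<open>y + t\<^sup>2 D\<close> would be closer to \<open>z\<close> than \<open>y\<close> by an
  amount of order \<open>t\<^sup>2\<close>. Since \<open>S\<close> has points within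
  \<open>o(t\<^sup>2)\<close> of it, one of them would be closer to \<open>z\<close> than the
  nearest point \<open>y\<close>.\<close>

lemma second_order_reachable_inner_le:
  fixes S :: "'a::euclidean_space set"
  assumes S: "closed S" "y \<in> S" and reach: "second_order_reachable S y 0 D"
    and near: "\<forall>x\<in>S. dist z y \<le> dist z x"
  shows "D \<bullet> (z - y) \<le> 0"
proof (rule field_le_epsilon)
  fix e :: real assume e: "0 < e"
  define \<nu> where "\<nu> = z - y"
  \<comment> \<open>Chosen so that \<open>2 * norm \<nu> * \<omega> \<le> e\<close>; the bound
    \<open>T\<close> makes the remaining term \<open>t\<^sup>2 * (norm D)\<^sup>2\<close> at most
    \<open>e\<close> as well.\<close>
  define \<omega> where "\<omega> = e / (2 * (norm \<nu> + 1))"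
  have \<omega>: "\<omega> > 0" using e by (simp add: \<omega>_def add_nonneg_pos)
  define T where "T = min 1 (e / ((norm D)\<^sup>2 + 1))"
  have "0 < (norm D)\<^sup>2 + 1" by (simp add: add_nonneg_pos)
  then have T0: "0 < T" using e by (simp add: T_def)
  have "\<forall>\<^sub>F t in at_right 0. t \<in> {0<..<T}" using T0 by (rule eventually_at_right_real)
  moreover have "\<forall>\<^sub>F t in at_right 0. (infdist (y + t *\<^sub>R 0 + t\<^sup>2 *\<^sub>R D) S)\<^sup>2 \<le> \<omega>\<^sup>2 * t ^ 4"
    using reach \<omega> by (simp add: second_order_reachable_def)
  ultimately have "\<forall>\<^sub>F t in at_right (0::real). D \<bullet> \<nu> \<le> 0 + e"
  proof eventually_elim
    case (elim t)
    have "0 < t" "t < T" using elim(1) by auto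
    then have t: "0 < t" "t < 1" "t < e / ((norm D)\<^sup>2 + 1)" unfolding T_def min_less_iff_conj by blast+
    define q where "q = y + t\<^sup>2 *\<^sub>R D"
    have "(infdist q S)\<^sup>2 \<le> (\<omega> * t\<^sup>2)\<^sup>2" using elim(2) by (simp add: q_def power_mult_distrib flip: power_mult)
    then have iq: "infdist q S \<le> \<omega> * t\<^sup>2" by (rule power2_le_imp_le) (simp add: \<omega> less_imp_le)
    obtain \<pi> where \<pi>: "\<pi> \<in> S" "infdist q S = dist q \<pi>"
      using infdist_attains_inf[OF S(1)] S(2) by blast
    have "norm \<nu> \<le> dist z \<pi>" using near \<pi> by (simp add: \<nu>_def dist_norm)
    also have "\<dots> \<le> dist z q + \<omega> * t\<^sup>2" using dist_triangle[of z \<pi> q] \<pi> iq by simp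
    also have "dist z q = norm (\<nu> - t\<^sup>2 *\<^sub>R D)" by (simp add: dist_norm q_def \<nu>_def algebra_simps)
    finally have R: "norm \<nu> - \<omega> * t\<^sup>2 \<le> norm (\<nu> - t\<^sup>2 *\<^sub>R D)" by simp
    \<comment> \<open>\<open>R\<close> may be squared only if its left side is nonnegative;
      otherwise the left side of the claim is at most 0.\<close>
    have key: "(norm \<nu>)\<^sup>2 - 2 * (norm \<nu> * (\<omega> * t\<^sup>2)) \<le> (norm (\<nu> - t\<^sup>2 *\<^sub>R D))\<^sup>2"
    proof (cases "0 \<le> norm \<nu> - \<omega> * t\<^sup>2")
      case True
      then have "(norm \<nu> - \<omega> * t\<^sup>2)\<^sup>2 \<le> (norm (\<nu> - t\<^sup>2 *\<^sub>R D))\<^sup>2" using R by (rule power_mono[rotated])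
      moreover have "(norm \<nu> - \<omega> * t\<^sup>2)\<^sup>2 = (norm \<nu>)\<^sup>2 - 2 * (norm \<nu> * (\<omega> * t\<^sup>2)) + (\<omega> * t\<^sup>2)\<^sup>2"
        by (simp add: power2_eq_square algebra_simps)
      ultimately show ?thesis using zero_le_power2[of "\<omega> * t\<^sup>2"] by linarith
    next
      case False
      then have "norm \<nu> * norm \<nu> \<le> norm \<nu> * (\<omega> * t\<^sup>2)" by (intro mult_left_mono) auto
      moreover have "0 \<le> norm \<nu> * (\<omega> * t\<^sup>2)" using \<omega> by simp
      moreover have "0 \<le> (norm (\<nu> - t\<^sup>2 *\<^sub>R D))\<^sup>2" by simp
      ultimately show ?thesis unfolding power2_eq_square[of "norm \<nu>"] by linarith
    qed
    have "(norm (\<nu> - t\<^sup>2 *\<^sub>R D))\<^sup>2 = (norm \<nu>)\<^sup>2 - 2 * t\<^sup>2 * (D \<bullet> \<nu>) + t\<^sup>2 * (t\<^sup>2 * (norm D)\<^sup>2)"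
      unfolding power2_norm_eq_inner
      by (simp add: inner_diff_left inner_diff_right inner_commute power2_eq_square algebra_simps)
    with key have "t\<^sup>2 * (2 * (D \<bullet> \<nu>)) \<le> t\<^sup>2 * (2 * norm \<nu> * \<omega> + t\<^sup>2 * (norm D)\<^sup>2)"
      by (simp add: algebra_simps)
    then have 1: "2 * (D \<bullet> \<nu>) \<le> 2 * norm \<nu> * \<omega> + t\<^sup>2 * (norm D)\<^sup>2"
      using t by (simp add: mult_le_cancel_left)
    have "2 * norm \<nu> * \<omega> \<le> e"
    proof -
      have "norm \<nu> * e \<le> e * (norm \<nu> + 1)" using e by (simp add: algebra_simps)
      moreover have "0 < norm \<nu> + 1" by (simp add: add_nonneg_pos)
      ultimately show ?thesis by (simp add: \<omega>_def pos_divide_le_eq algebra_simps)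
    qed
    moreover have "t\<^sup>2 * (norm D)\<^sup>2 \<le> e"
    proof -
      have "t * ((norm D)\<^sup>2 + 1) < e" using t \<open>0 < (norm D)\<^sup>2 + 1\<close> by (simp add: field_simps)
      moreover have "t\<^sup>2 * (norm D)\<^sup>2 \<le> t * ((norm D)\<^sup>2 + 1)"
        using t by (intro mult_mono) (auto simp: power2_eq_square)
      ultimately show ?thesis by linarith
    qed
    ultimately show ?case using 1 by linarith
  qed
  then have "\<exists>t::real. D \<bullet> \<nu> \<le> 0 + e"
    using eventually_happens trivial_limit_at_right_real by blast
  then show "D \<bullet> (z - y) \<le> 0 + e" by (simp add: \<nu>_def)
qed

lemma bracket_inner_le:
  fixes S :: "'a::euclidean_space set"
  assumes S: "closed S" "y \<in> S" and tan: "proximally_tangent S V" "proximally_tangent S W"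
    and A: "has_strict_derivative_at V A y" and B: "has_strict_derivative_at W B y"
    and near: "\<forall>x\<in>S. dist z y \<le> dist z x"
  shows "(B (V y) - A (W y)) \<bullet> (z - y) \<le> 0"
proof -
  interpret A: bounded_linear A using A by (simp add: has_strict_derivative_at_def)
  interpret B: bounded_linear B using B by (simp add: has_strict_derivative_at_def)
  have "second_order_reachable S y 0 0"
    unfolding second_order_reachable_def
  proof (intro allI impI always_eventually)
    fix \<eta> t :: real assume "0 < \<eta>"
    then have "0 \<le> \<eta> * t ^ 4" by simp
    then show "(infdist (y + t *\<^sub>R 0 + t\<^sup>2 *\<^sub>R 0) S)\<^sup>2 \<le> \<eta> * t ^ 4" using S by simp
  qed
  from second_order_reachable_step[OF S tan(1) A this]
  have "second_order_reachable S y (V y) ((1/2) *\<^sub>R A (V y))" by (simp add: A.zero)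
  note second_order_reachable_step[OF S tan(2) B this]
  note second_order_reachable_step[OF S proximally_tangent_uminus[OF tan(1)]
      has_strict_derivative_at_uminus[OF A] this]
  note second_order_reachable_step[OF S proximally_tangent_uminus[OF tan(2)]
      has_strict_derivative_at_uminus[OF B] this]
  moreover have "V y + W y + - V y + - W y = 0" by simp
  \<comment> \<open>The half terms of the two motions along each field add up to
    \<open>A (V y)\<close> and \<open>B (W y)\<close>, which are cancelled by part of
    \<open>A (V y + W y)\<close> and by the last \<open>B\<close> term of a displacement. What
    survives records the order of the motions: \<open>W\<close> is followed after a displacement by
    \<open>V y\<close>, and \<open>- V\<close> after one that includes \<open>W y\<close>.\<close>
  moreover have "(1 / 2) *\<^sub>R A (V y) + B (V y) + (1 / 2) *\<^sub>R B (W y) + - A (V y + W y) +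
       (1 / 2) *\<^sub>R - A (- V y) + - B (V y + W y + - V y) + (1 / 2) *\<^sub>R - B (- W y)
     = B (V y) - A (W y)"
  proof -
    have h: "(1/2) *\<^sub>R x + (1/2) *\<^sub>R x = x" for x :: 'a by (simp flip: scaleR_left_distrib)
    show ?thesis
      using h[of "A (V y)"] h[of "B (W y)"] by (simp add: A.add A.neg B.neg algebra_simps)
  qed
  ultimately have "second_order_reachable S y 0 (B (V y) - A (W y))" by metis
  from second_order_reachable_inner_le[OF S this near] show ?thesis .
qed

text \<open>Motion forward in time reaches the bracket with one sign only and yields an inequality;
  exchanging \<open>V\<close> and \<open>W\<close> reverses the bracket and gives the opposite
  inequality.\<close>

lemma proximally_tangent_bracket:
  fixes S :: "'a::euclidean_space set"
  assumes S: "closed S" and tan: "proximally_tangent S V" "proximally_tangent S W"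
    and "\<And>y. y \<in> S \<Longrightarrow> \<exists>A B. has_strict_derivative_at V A y \<and> has_strict_derivative_at W B y
           \<and> Z y = B (V y) - A (W y)"
  shows "proximally_tangent S Z"
  unfolding proximally_tangent_def
proof (intro ballI allI impI)
  fix y z assume y: "y \<in> S" and near: "\<forall>x\<in>S. dist z y \<le> dist z x"
  obtain A B where AB: "has_strict_derivative_at V A y" "has_strict_derivative_at W B y"
    "Z y = B (V y) - A (W y)" using assms(4)[OF y] by blast
  have "(B (V y) - A (W y)) \<bullet> (z - y) \<le> 0" "(A (W y) - B (V y)) \<bullet> (z - y) \<le> 0"
    using bracket_inner_le[OF S y tan AB(1,2) near]
      bracket_inner_le[OF S y tan(2,1) AB(2,1) near] by auto
  then show "Z y \<bullet> (z - y) = 0" by (simp add: AB(3) inner_diff_left)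
qed

section \<open>Calculus of partial derivatives\<close>

text \<open>\<open>frechet_derivative\<close> is a choice among all derivatives at the point.
  Locally equal functions have the same derivatives, hence the same choice, even where there is
  none.\<close>

lemma partial_deriv_cong:
  assumes "open U" "x \<in> U" "\<And>y. y \<in> U \<Longrightarrow> f y = g y"
  shows "partial_deriv k f x = partial_deriv k g x"
proof -
  have "(f has_derivative D) (at x) \<longleftrightarrow> (g has_derivative D) (at x)" for D
    using assms by (metis has_derivative_transform_within_open)
  then show ?thesis by (simp add: partial_deriv_def frechet_derivative_def)
qed

lemma partial_deriv_eqI: "(f has_derivative D) (at x) \<Longrightarrow> partial_deriv k f x = D (axis k 1)"
  by (simp add: partial_deriv_def frechet_derivative_at[symmetric])

lemma has_derivative_partial_deriv:
  fixes f :: "real^'n::finite \<Rightarrow> real"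
  assumes "f differentiable (at x)"
  shows "(f has_derivative (\<lambda>h. \<Sum>k\<in>UNIV. h $ k * partial_deriv k f x)) (at x)"
proof -
  let ?D = "frechet_derivative f (at x)"
  have D: "(f has_derivative ?D) (at x)" using assms frechet_derivative_works by blast
  interpret linear ?D using D by (rule has_derivative_linear)
  have "?D h = (\<Sum>k\<in>UNIV. h $ k * partial_deriv k f x)" for h
  proof -
    have "?D h = ?D (\<Sum>k\<in>UNIV. h $ k *\<^sub>R axis k 1)"
      by (simp add: basis_expansion flip: scalar_mult_eq_scaleR)
    then show ?thesis by (simp add: sum scaleR partial_deriv_def)
  qed
  then have "?D = (\<lambda>h. \<Sum>k\<in>UNIV. h $ k * partial_deriv k f x)" by blast
  with D show ?thesis by simp
qed

lemma partial_deriv_const: "partial_deriv k (\<lambda>x. c) x = 0"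
  by (subst partial_deriv_eqI[OF has_derivative_const]) simp

lemma partial_deriv_component:
  fixes j :: "'n::finite"
  shows "partial_deriv k (\<lambda>x::real^'n. x $ j) x = (if j = k then 1 else 0)"
  by (subst partial_deriv_eqI[OF bounded_linear.has_derivative[OF bounded_linear_vec_nth has_derivative_ident]])
    (simp add: axis_def)

lemma partial_deriv_add:
  assumes "f differentiable (at x)" "g differentiable (at x)"
  shows "partial_deriv k (\<lambda>x. f x + g x) x = partial_deriv k f x + partial_deriv k g x"
  using has_derivative_add[OF assms[unfolded frechet_derivative_works]]
  by (subst partial_deriv_eqI) (auto simp: partial_deriv_def)

lemma partial_deriv_mult:
  assumes "f differentiable (at x)" "g differentiable (at x)"
  shows "partial_deriv k (\<lambda>x. f x * g x) x = f x * partial_deriv k g x + partial_deriv k f x * g x"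
  using has_derivative_mult[OF assms[unfolded frechet_derivative_works]]
  by (subst partial_deriv_eqI) (auto simp: partial_deriv_def)

lemma has_derivative_real_compose:
  fixes h :: "real \<Rightarrow> real" and q :: "real^'n::finite \<Rightarrow> real"
  assumes "q differentiable (at x)" "(h has_real_derivative h') (at (q x))"
  shows "((\<lambda>x. h (q x)) has_derivative (\<lambda>v. h' * frechet_derivative q (at x) v)) (at x)"
  using has_derivative_compose[OF assms(1)[unfolded frechet_derivative_works], of h] assms(2)
  by (simp add: has_field_derivative_def)

lemma partial_deriv_compose:
  fixes h :: "real \<Rightarrow> real"
  assumes "q differentiable (at x)" "(h has_real_derivative h') (at (q x))"
  shows "partial_deriv k (\<lambda>x. h (q x)) x = h' * partial_deriv k q x"
  by (subst partial_deriv_eqI[OF has_derivative_real_compose[OF assms]]) (simp add: partial_deriv_def)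

section \<open>Functions of class C^k on open sets\<close>

lemma Ck_on_cong:
  assumes "open U" "\<And>y. y \<in> U \<Longrightarrow> f y = g y"
  shows "Ck_on r U f \<longleftrightarrow> Ck_on r U g"
  using assms(2)
proof (induction r arbitrary: f g)
  case 0 then show ?case by (simp cong: continuous_on_cong)
next
  case (Suc r)
  have "f differentiable (at x) \<longleftrightarrow> g differentiable (at x)" if "x \<in> U" for x
    unfolding differentiable_def using Suc.prems that assms(1)
    by (metis has_derivative_transform_within_open)
  moreover have "Ck_on r U (partial_deriv k f) \<longleftrightarrow> Ck_on r U (partial_deriv k g)" for k
    using Suc.prems assms(1) by (intro Suc.IH partial_deriv_cong)
  ultimately show ?case by simp
qed

lemma Ck_on_SucD: "Ck_on (Suc r) U f \<Longrightarrow> Ck_on r U f"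
proof (induction r arbitrary: f)
  case 0
  then show ?case
    by (auto intro!: continuous_at_imp_continuous_on differentiable_imp_continuous_within)
next
  case (Suc r)
  then show ?case by (metis Ck_on.simps(2))
qed

lemma Ck_on_subset: "Ck_on r U f \<Longrightarrow> W \<subseteq> U \<Longrightarrow> Ck_on r W f"
proof (induction r arbitrary: f)
  case (Suc r) then show ?case by (metis Ck_on.simps(2) subsetD)
qed (auto intro: continuous_on_subset)

lemma Ck_on_const [simp]:
  fixes U :: "(real^'n::finite) set"
  shows "Ck_on r U (\<lambda>x. c)"
proof (induction r arbitrary: c)
  case (Suc r)
  have "partial_deriv k (\<lambda>x. c) = (\<lambda>x. 0)" for k :: 'n by (simp add: fun_eq_iff partial_deriv_const)
  then show ?case using Suc by simp
qed simp

lemma Ck_on_component: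
  fixes U :: "(real^'n::finite) set"
  shows "Ck_on r U (\<lambda>x. x $ j)"
proof (cases r)
  case (Suc r)
  have "partial_deriv k (\<lambda>x. x $ j) = (\<lambda>x. if j = k then 1 else 0)" for k :: 'n
    by (simp add: fun_eq_iff partial_deriv_component)
  moreover have "(\<lambda>x. x $ j) differentiable (at x)" for x :: "real^'n"
    by (intro bounded_linear_imp_differentiable bounded_linear_vec_nth)
  ultimately show ?thesis using Suc by simp
qed (auto intro: continuous_intros)

lemma Ck_on_add:
  assumes "open U" "Ck_on r U f" "Ck_on r U g"
  shows "Ck_on r U (\<lambda>x. f x + g x)"
  using assms(2,3)
proof (induction r arbitrary: f g)
  case (Suc r)
  have "Ck_on r U (partial_deriv k (\<lambda>x. f x + g x))" for k
  proof -
    have "Ck_on r U (\<lambda>x. partial_deriv k f x + partial_deriv k g x)"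
      using Suc by simp
    then show ?thesis
      using Suc.prems by (subst Ck_on_cong[OF assms(1)]) (auto intro!: partial_deriv_add)
  qed
  then show ?case using Suc.prems by (auto intro: differentiable_add)
qed (auto intro: continuous_intros)

lemma Ck_on_mult:
  assumes "open U" "Ck_on r U f" "Ck_on r U g"
  shows "Ck_on r U (\<lambda>x. f x * g x)"
  using assms(2,3)
proof (induction r arbitrary: f g)
  case (Suc r)
  have "Ck_on r U (partial_deriv k (\<lambda>x. f x * g x))" for k
  proof -
    have "Ck_on r U (\<lambda>x. f x * partial_deriv k g x + partial_deriv k f x * g x)"
      using Suc.prems by (intro Ck_on_add[OF assms(1)] Suc.IH) (auto intro: Ck_on_SucD)
    then show ?thesis
      using Suc.prems by (subst Ck_on_cong[OF assms(1)]) (auto intro!: partial_deriv_mult)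
  qed
  then show ?case using Suc.prems by (auto intro: differentiable_mult)
qed (auto intro: continuous_intros)

lemma Ck_on_diff:
  assumes "open U" "Ck_on r U f" "Ck_on r U g"
  shows "Ck_on r U (\<lambda>x. f x - g x)"
  using Ck_on_add[OF assms(1,2) Ck_on_mult[OF assms(1) Ck_on_const[of r U "-1"] assms(3)]] by simp

lemma Ck_on_sum:
  assumes "open U" "\<And>i. i \<in> I \<Longrightarrow> Ck_on r U (f i)"
  shows "Ck_on r U (\<lambda>x. \<Sum>i\<in>I. f i x)"
  using assms(2)
  by (induction I rule: infinite_finite_induct) (auto intro: Ck_on_add[OF assms(1)])

lemma Ck_on_prod:
  assumes "open U" "\<And>i. i \<in> I \<Longrightarrow> Ck_on r U (f i)"
  shows "Ck_on r U (\<lambda>x. \<Prod>i\<in>I. f i x)"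
  using assms(2)
  by (induction I rule: infinite_finite_induct) (auto intro: Ck_on_mult[OF assms(1)])

text \<open>First order is the natural level here: the applications are
  \<open>\<bar>u\<bar> powr p\<close>, which for \<open>p < 2\<close> need not be twice
  differentiable where \<open>u\<close> vanishes, and a cut-off that is the square of a positive
  part.\<close>

lemma Ck_on_1_compose:
  fixes h :: "real \<Rightarrow> real"
  assumes "open U" "Ck_on (Suc 0) U q" "\<And>t. (h has_real_derivative h' t) (at t)" "continuous_on UNIV h'"
  shows "Ck_on (Suc 0) U (\<lambda>x. h (q x))"
proof -
  have "continuous_on U q" using Ck_on_SucD[OF assms(2)] by simp
  then have "continuous_on U (\<lambda>x. h' (q x) * partial_deriv k q x)" for k
    using assms(2) by (intro continuous_intros continuous_on_compose2[OF assms(4)]) auto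
  moreover have "partial_deriv k (\<lambda>x. h (q x)) x = h' (q x) * partial_deriv k q x" if "x \<in> U" for k x
    using assms that by (intro partial_deriv_compose) auto
  moreover have "(\<lambda>x. h (q x)) differentiable (at x)" if "x \<in> U" for x
    using has_derivative_real_compose[of q x h] assms that by (auto simp: differentiable_def)
  ultimately show ?thesis by (simp cong: continuous_on_cong)
qed

text \<open>At 0 the difference quotient is the same positive-part power with exponent
  \<open>p - 1\<close>, and it tends to 0 because \<open>p > 1\<close>.\<close>

lemma has_real_derivative_pos_part_powr:
  fixes p :: real
  assumes "1 < p"
  shows "((\<lambda>t. max 0 t powr p) has_real_derivative p * max 0 t powr (p - 1)) (at t)"
proof -
  consider "t > 0" | "t < 0" | "t = 0" by linarith
  then show ?thesis
  proof cases
    case 1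
    have "((\<lambda>t. t powr p) has_real_derivative p * t powr (p - 1)) (at t)"
      using 1 by (auto intro!: derivative_eq_intros)
    then have "((\<lambda>t. max 0 t powr p) has_real_derivative p * t powr (p - 1)) (at t)"
      by (rule has_field_derivative_transform_within_open[where S = "{0<..}"]) (use 1 in auto)
    then show ?thesis using 1 by simp
  next
    case 2
    have "((\<lambda>t. 0) has_real_derivative 0) (at t)" by simp
    then have "((\<lambda>t. max 0 t powr p) has_real_derivative 0) (at t)"
      by (rule has_field_derivative_transform_within_open[where S = "{..<0}"]) (use 2 in auto)
    then show ?thesis using 2 by simp
  next
    case 3
    have "((\<lambda>h::real. max 0 h powr (p - 1)) \<longlongrightarrow> max 0 0 powr (p - 1)) (at 0)"
      using assms by (intro tendsto_intros tendsto_powr2) auto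
    then have "((\<lambda>h::real. max 0 h powr (p - 1)) \<longlongrightarrow> 0) (at 0)" by simp
    then have "((\<lambda>h::real. (max 0 (0 + h) powr p - max 0 0 powr p) / h) \<longlongrightarrow> 0) (at 0)"
    proof (rule Lim_transform_eventually)
      have "max 0 h powr (p - 1) = (max 0 (0 + h) powr p - max 0 0 powr p) / h" if "h \<noteq> 0" for h :: real
        using that by (cases "h > 0") (auto simp: powr_diff max_def)
      then show "\<forall>\<^sub>F h in at 0. max 0 h powr (p - 1) = (max 0 (0 + h) powr p - max 0 0 powr p) / h"
        by (auto simp: eventually_at_filter)
    qed
    then show ?thesis using 3 by (simp add: DERIV_def)
  qed
qed

text \<open>Splitting into positive and negative parts gives a formula for the derivative that is
  visibly continuous across 0.\<close>

lemma has_real_derivative_abs_powr: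
  fixes p :: real
  assumes "1 < p"
  shows "((\<lambda>t. \<bar>t\<bar> powr p) has_real_derivative
           p * (max 0 t powr (p - 1) - max 0 (- t) powr (p - 1))) (at t)"
proof -
  have "((\<lambda>t. max 0 t powr p + max 0 (- t) powr p) has_real_derivative
           p * max 0 t powr (p - 1) + p * max 0 (- t) powr (p - 1) * (- 1)) (at t)"
    by (intro DERIV_add has_real_derivative_pos_part_powr assms
        DERIV_chain2[OF has_real_derivative_pos_part_powr]) (auto intro!: derivative_eq_intros)
  moreover have "(\<lambda>t. \<bar>t\<bar> powr p) = (\<lambda>t. max 0 t powr p + max 0 (- t) powr p)"
    using assms by (auto simp: fun_eq_iff max_def abs_if)
  ultimately show ?thesis by (simp add: algebra_simps)
qed

lemma continuous_on_max_powr: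
  fixes p :: real
  assumes "0 < p" "continuous_on S (f :: 'a::topological_space \<Rightarrow> real)"
  shows "continuous_on S (\<lambda>t. max 0 (f t) powr p)"
  using assms by (intro continuous_on_powr' continuous_intros) auto

lemma Ck_on_1_abs_powr:
  fixes p :: real
  assumes "1 < p" "open U" "Ck_on (Suc 0) U u"
  shows "Ck_on (Suc 0) U (\<lambda>x. \<bar>u x\<bar> powr p)"
  using assms(2,3) has_real_derivative_abs_powr[OF assms(1)]
  by (rule Ck_on_1_compose) (use assms in \<open>intro continuous_intros continuous_on_max_powr; simp\<close>)

text \<open>The factor \<open>1 / t ^ m\<close> makes the family closed under differentiation.\<close>

definition flat_exp :: "real \<Rightarrow> nat \<Rightarrow> real \<Rightarrow> real" where
  "flat_exp c m t = (if t > 0 then inverse t ^ m * exp (- (c / t)) else 0)"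

lemma flat_exp_tendsto_0:
  assumes "c > 0"
  shows "(flat_exp c m \<longlongrightarrow> 0) (at 0)"
proof -
  have "filterlim (\<lambda>t. c * inverse t) at_top (at_right 0)"
    by (rule filterlim_tendsto_pos_mult_at_top[OF tendsto_const assms filterlim_inverse_at_top_right])
  then have "((\<lambda>t. (c * inverse t) ^ m / exp (c * inverse t)) \<longlongrightarrow> 0) (at_right 0)"
    by (rule filterlim_compose[OF tendsto_power_div_exp_0])
  then have "((\<lambda>t. inverse c ^ m * ((c * inverse t) ^ m / exp (c * inverse t))) \<longlongrightarrow> 0) (at_right 0)"
    by (rule tendsto_mult_right_zero)
  then have "(flat_exp c m \<longlongrightarrow> 0) (at_right 0)"
  proof (rule Lim_transform_eventually)
    have "inverse c ^ m * ((c * inverse t) ^ m / exp (c * inverse t)) = flat_exp c m t" if "t > 0" for t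
      using that assms by (simp add: flat_exp_def power_mult_distrib exp_minus field_simps)
    then show "\<forall>\<^sub>F t in at_right 0. inverse c ^ m * ((c * inverse t) ^ m / exp (c * inverse t)) = flat_exp c m t"
      by (auto simp: eventually_at_filter)
  qed
  moreover have "(flat_exp c m \<longlongrightarrow> 0) (at_left 0)"
    by (rule tendsto_eventually) (auto simp: eventually_at_filter flat_exp_def)
  ultimately show ?thesis by (simp add: filterlim_split_at)
qed

text \<open>The delicate point is 0: there the difference quotient with index \<open>m\<close> is
  the function with index \<open>m + 1\<close>, which tends to 0 like every member of the
  family.\<close>

lemma has_real_derivative_flat_exp:
  assumes "c > 0"
  shows "(flat_exp c m has_real_derivative
           (c * flat_exp c (m + 2) t - real m * flat_exp c (m + 1) t)) (at t)"
proof -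
  consider "t > 0" | "t < 0" | "t = 0" by linarith
  then show ?thesis
  proof cases
    case 1
    have "((\<lambda>t. inverse t ^ m * exp (- (c / t))) has_real_derivative
        (c * flat_exp c (m + 2) t - real m * flat_exp c (m + 1) t)) (at t)"
    proof -
      define s where "s = inverse t"
      have "(inverse has_real_derivative - (s\<^sup>2)) (at t)"
        using DERIV_inverse[of t] 1 by (simp add: s_def power2_eq_square)
      then have "((\<lambda>t. inverse t ^ m * exp (- (c * inverse t))) has_real_derivative
          real m * s ^ (m - 1) * (- (s\<^sup>2)) * exp (- (c * s))
            + exp (- (c * s)) * (- (c * (- (s\<^sup>2)))) * s ^ m) (at t)"
        unfolding s_def using 1 by (auto intro!: derivative_eq_intros simp: power2_eq_square)
      moreover have "real m * s ^ (m - 1) * (- (s\<^sup>2)) * exp (- (c * s))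
            + exp (- (c * s)) * (- (c * (- (s\<^sup>2)))) * s ^ m
          = c * flat_exp c (m + 2) t - real m * flat_exp c (m + 1) t"
        using 1 by (cases m) (auto simp: flat_exp_def s_def divide_inverse power2_eq_square)
      ultimately show ?thesis by (simp add: divide_inverse)
    qed
    then show ?thesis
      by (rule has_field_derivative_transform_within_open[where S = "{0<..}"])
        (use 1 in \<open>auto simp: flat_exp_def\<close>)
  next
    case 2
    have "((\<lambda>t. 0) has_real_derivative 0) (at t)" by simp
    then have "(flat_exp c m has_real_derivative 0) (at t)"
      by (rule has_field_derivative_transform_within_open[where S = "{..<0}"])
        (use 2 in \<open>auto simp: flat_exp_def\<close>)
    then show ?thesis using 2 by (simp add: flat_exp_def)
  next
    case 3
    have "((\<lambda>h. (flat_exp c m (0 + h) - flat_exp c m 0) / h) \<longlongrightarrow> 0) (at 0)"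
    proof (rule Lim_transform_eventually[OF flat_exp_tendsto_0[OF assms, of "m + 1"]])
      have "flat_exp c (m + 1) h = (flat_exp c m (0 + h) - flat_exp c m 0) / h" for h
        by (simp add: flat_exp_def divide_inverse)
      then show "\<forall>\<^sub>F h in at 0. flat_exp c (m + 1) h = (flat_exp c m (0 + h) - flat_exp c m 0) / h"
        by simp
    qed
    then show ?thesis using 3 by (simp add: DERIV_def flat_exp_def)
  qed
qed

lemma Ck_on_flat_exp:
  assumes "c > 0" "open U" "Ck_on r U q"
  shows "Ck_on r U (\<lambda>x. flat_exp c m (q x))"
  using assms(3)
proof (induction r arbitrary: m)
  case 0
  have "continuous_on UNIV (flat_exp c m)"
    using has_real_derivative_flat_exp[OF assms(1)] DERIV_continuous
    by (intro continuous_at_imp_continuous_on) blast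
  then show ?case using 0 by (auto intro: continuous_on_compose2)
next
  case (Suc r)
  let ?q' = "\<lambda>x. c * flat_exp c (m + 2) (q x) - real m * flat_exp c (m + 1) (q x)"
  have "Ck_on r U (partial_deriv k (\<lambda>x. flat_exp c m (q x)))" for k
  proof -
    have "Ck_on r U (\<lambda>x. ?q' x * partial_deriv k q x)"
      using Suc.prems Suc.IH[OF Ck_on_SucD[OF Suc.prems]]
      by (intro Ck_on_mult Ck_on_diff assms Ck_on_const) auto
    then show ?thesis
      using Suc.prems has_real_derivative_flat_exp[OF assms(1)]
      by (subst Ck_on_cong[OF assms(2)]) (auto intro!: partial_deriv_compose)
  qed
  moreover have "(\<lambda>x. flat_exp c m (q x)) differentiable (at x)" if "x \<in> U" for x
  proof -
    have "q differentiable (at x)" using Suc.prems that by simp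
    from has_derivative_real_compose[OF this has_real_derivative_flat_exp[OF assms(1)]]
    show ?thesis by (rule differentiableI)
  qed
  ultimately show ?case by simp
qed

section \<open>Strict derivatives of C^1 fields and tangency of commutators\<close>

lemma has_strict_derivative_at_C1:
  fixes V :: "real^'n::finite \<Rightarrow> real^'n"
  assumes U: "open U" "y \<in> U" and C1: "\<And>k. Ck_on (Suc 0) U (\<lambda>x. V x $ k)"
  shows "has_strict_derivative_at V (\<lambda>h. \<chi> k. \<Sum>l\<in>UNIV. h $ l * partial_deriv l (\<lambda>x. V x $ k) y) y"
    (is "has_strict_derivative_at V ?A y")
  unfolding has_strict_derivative_at_def
proof (intro conjI allI impI)
  show "bounded_linear ?A"
    unfolding linear_conv_bounded_linear[symmetric]
    by (rule linearI)
      (simp_all add: vec_eq_iff sum.distrib distrib_right sum_distrib_left mult.assoc)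
  fix \<eta> :: real assume \<eta>: "0 < \<eta>"
  \<comment> \<open>The tolerance is divided by \<open>N\<close> twice: among the partial
    derivatives of one component, and among the components.\<close>
  define N where "N = real CARD('n)"
  have N: "N > 0" by (simp add: N_def)
  define D where "D k l x = partial_deriv l (\<lambda>x. V x $ k) x" for k l x
  have "\<forall>\<^sub>F x in nhds y. \<bar>D k l x - D k l y\<bar> < \<eta> / N\<^sup>2" for k l
  proof -
    have "continuous_on U (D k l)" using C1[of k] by (simp add: D_def[abs_def])
    then have "isCont (D k l) y" using U by (simp add: continuous_on_eq_continuous_at)
    then have "(D k l \<longlongrightarrow> D k l y) (nhds y)" by (simp add: continuous_at tendsto_at_iff_tendsto_nhds)
    then have "\<forall>\<^sub>F x in nhds y. dist (D k l x) (D k l y) < \<eta> / N\<^sup>2" using \<eta> N by (intro tendstoD) auto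
    then show ?thesis by (simp add: dist_real_def)
  qed
  then have "\<forall>\<^sub>F x in nhds y. \<forall>k l. \<bar>D k l x - D k l y\<bar> < \<eta> / N\<^sup>2"
    by (intro eventually_all_finite)
  moreover have "\<forall>\<^sub>F x in nhds y. x \<in> U" using U by (rule eventually_nhds_in_open)
  ultimately have "\<forall>\<^sub>F x in nhds y. x \<in> U \<and> (\<forall>k l. \<bar>D k l x - D k l y\<bar> < \<eta> / N\<^sup>2)"
    by eventually_elim blast
  then obtain \<delta> where \<delta>: "\<delta> > 0"
    "\<And>x. dist x y < \<delta> \<Longrightarrow> x \<in> U \<and> (\<forall>k l. \<bar>D k l x - D k l y\<bar> < \<eta> / N\<^sup>2)"
    unfolding eventually_nhds_metric by blast
  have \<delta>': "x \<in> U" "\<bar>D k l x - D k l y\<bar> < \<eta> / N\<^sup>2" if "x \<in> ball y \<delta>" for x k l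
    using \<delta>(2)[of x] that by (auto simp: dist_commute)
  have comp: "\<bar>V b $ k - V a $ k - (\<Sum>l\<in>UNIV. (b - a) $ l * D k l y)\<bar> \<le> \<eta> / N * norm (b - a)"
    if ab: "a \<in> ball y \<delta>" "b \<in> ball y \<delta>" for a b k
  proof -
    define g where "g x = V x $ k - (\<Sum>l\<in>UNIV. x $ l * D k l y)" for x
    define g' where "g' x h = (\<Sum>l\<in>UNIV. h $ l * (D k l x - D k l y))" for x h
    \<comment> \<open>The mean value inequality for a component minus its linear part at
      \<open>y\<close>, whose derivative is small throughout the ball; this is what makes the
      derivative strict.\<close>
    have "norm (g b - g a) \<le> \<eta> / N * norm (b - a)"
    proof (rule differentiable_bound[OF convex_ball])
      fix x assume x: "x \<in> ball y \<delta>"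
      have "((\<lambda>x. V x $ k) has_derivative (\<lambda>h. \<Sum>l\<in>UNIV. h $ l * D k l x)) (at x)"
        unfolding D_def using C1[of k] \<delta>'(1)[OF x] by (intro has_derivative_partial_deriv) simp
      moreover have "((\<lambda>x. \<Sum>l\<in>UNIV. x $ l * D k l y) has_derivative
           (\<lambda>h. \<Sum>l\<in>UNIV. h $ l * D k l y)) (at x)"
        by (intro has_derivative_sum bounded_linear.has_derivative[OF bounded_linear_mult_left]
            bounded_linear.has_derivative[OF bounded_linear_vec_nth] has_derivative_ident)
      ultimately have "(g has_derivative (\<lambda>h. (\<Sum>l\<in>UNIV. h $ l * D k l x)
                         - (\<Sum>l\<in>UNIV. h $ l * D k l y))) (at x)"
        unfolding g_def by (rule has_derivative_diff)
      then have "(g has_derivative g' x) (at x)"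
        by (simp add: g'_def[abs_def] right_diff_distrib sum_subtractf)
      then show "(g has_derivative g' x) (at x within ball y \<delta>)" by (rule has_derivative_at_withinI)
      show "onorm (g' x) \<le> \<eta> / N"
      proof (rule onorm_bound)
        fix h
        have "norm (g' x h) \<le> (\<Sum>l\<in>UNIV. \<bar>h $ l * (D k l x - D k l y)\<bar>)"
          unfolding g'_def by simp
        also have "\<dots> \<le> (\<Sum>l\<in>(UNIV :: 'n set). norm h * (\<eta> / N\<^sup>2))"
          unfolding abs_mult using \<delta>'(2)[OF x]
          by (intro sum_mono mult_mono component_le_norm_cart) (auto intro: less_imp_le)
        also have "\<dots> = \<eta> / N * norm h" using N by (simp add: N_def power2_eq_square)
        finally show "norm (g' x h) \<le> \<eta> / N * norm h" .
      qed (use \<eta> N in simp)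
    qed (use ab in auto)
    then show ?thesis by (simp add: g_def left_diff_distrib sum_subtractf algebra_simps)
  qed
  show "\<exists>\<delta>>0. \<forall>a\<in>ball y \<delta>. \<forall>b\<in>ball y \<delta>. norm (V b - V a - ?A (b - a)) \<le> \<eta> * norm (b - a)"
  proof (intro exI[of _ \<delta>] conjI ballI \<delta>(1))
    fix a b assume ab: "a \<in> ball y \<delta>" "b \<in> ball y \<delta>"
    have "norm (V b - V a - ?A (b - a)) \<le> (\<Sum>k\<in>UNIV. \<bar>(V b - V a - ?A (b - a)) $ k\<bar>)"
      by (rule norm_le_l1_cart)
    also have "\<dots> \<le> (\<Sum>k\<in>(UNIV :: 'n set). \<eta> / N * norm (b - a))"
      using comp[OF ab] by (intro sum_mono) (simp add: D_def)
    also have "\<dots> = \<eta> * norm (b - a)" using N by (simp add: N_def)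
    finally show "norm (V b - V a - ?A (b - a)) \<le> \<eta> * norm (b - a)" .
  qed
qed

lemma smooth_vector_field_on_lie_bracket:
  assumes U: "open U" and "smooth_vector_field_on U V" "smooth_vector_field_on U W"
  shows "smooth_vector_field_on U (lie_bracket V W)"
proof -
  have C: "Ck_on r U (\<lambda>x. V x $ k)" "Ck_on r U (\<lambda>x. W x $ k)" for r k
    using assms by (auto simp: smooth_vector_field_on_def smooth_fun_on_def)
  then have "Ck_on r U (partial_deriv l (\<lambda>x. V x $ k))" "Ck_on r U (partial_deriv l (\<lambda>x. W x $ k))"
    for r l k by (meson Ck_on.simps(2))+
  then show ?thesis
    unfolding smooth_vector_field_on_def smooth_fun_on_def lie_bracket_def
    by (auto intro!: Ck_on_sum Ck_on_diff Ck_on_mult U C)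
qed

text \<open>Smoothness is carried through the induction because the bracket step asks for a strict
  derivative of the inner commutator, and each bracket consumes one order of
  differentiability.\<close>

lemma iterated_commutator_tangent:
  assumes U: "open U" "S \<subseteq> U" "closed S"
    and X: "\<And>i. smooth_vector_field_on U (X i)" "\<And>i. proximally_tangent S (X i)"
    and "J \<noteq> []"
  shows "smooth_vector_field_on U (iterated_commutator X J)
       \<and> proximally_tangent S (iterated_commutator X J)"
  using \<open>J \<noteq> []\<close>
proof (induction J rule: induct_list012)
  case (3 j l J)
  let ?W = "iterated_commutator X (l # J)"
  have W: "smooth_vector_field_on U ?W" "proximally_tangent S ?W" using 3 by auto
  have "proximally_tangent S (lie_bracket (X j) ?W)"
  proof (rule proximally_tangent_bracket[OF U(3) X(2)[of j] W(2)])
    fix y assume "y \<in> S"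
    then have y: "y \<in> U" using U by auto
    have C: "Ck_on (Suc 0) U (\<lambda>x. X j x $ k)" "Ck_on (Suc 0) U (\<lambda>x. ?W x $ k)" for k
      using X(1)[of j] W(1) unfolding smooth_vector_field_on_def smooth_fun_on_def by blast+
    have A: "has_strict_derivative_at (X j)
        (\<lambda>h. \<chi> k. \<Sum>l\<in>UNIV. h $ l * partial_deriv l (\<lambda>x. X j x $ k) y) y"
      by (rule has_strict_derivative_at_C1[OF U(1) y C(1)])
    have B: "has_strict_derivative_at ?W
        (\<lambda>h. \<chi> k. \<Sum>l\<in>UNIV. h $ l * partial_deriv l (\<lambda>x. ?W x $ k) y) y"
      by (rule has_strict_derivative_at_C1[OF U(1) y C(2)])
    show "\<exists>A B. has_strict_derivative_at (X j) A y \<and> has_strict_derivative_at ?W B y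
        \<and> lie_bracket (X j) ?W y = B (X j y) - A (?W y)"
      by (intro exI conjI, rule A, rule B) (simp add: lie_bracket_def vec_eq_iff sum_subtractf)
  qed
  then show ?case using smooth_vector_field_on_lie_bracket[OF U(1) X(1) W(1)] by simp
qed (use X in auto)

lemma hormander_no_tangent_compact:
  fixes X :: "'m \<Rightarrow> real^'n::finite \<Rightarrow> real^'n"
  assumes U: "open U" "S \<subseteq> U" and S: "compact S"
    and X: "\<And>i. smooth_vector_field_on U (X i)" "\<And>i. proximally_tangent S (X i)"
    and span: "commutators_span X U s"
  shows "S = {}"
proof (rule ccontr)
  assume ne: "S \<noteq> {}"
  have "S \<noteq> UNIV" using S not_bounded_UNIV compact_imp_bounded by blast
  then obtain z where z: "z \<notin> S" by blast
  have cl: "closed S" using S by (rule compact_imp_closed)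
  obtain y where y: "y \<in> S" "\<And>x. x \<in> S \<Longrightarrow> dist z y \<le> dist z x"
    using distance_attains_inf[OF cl ne] by blast
  have "span {iterated_commutator X J y | J. 1 \<le> length J \<and> length J \<le> s} \<subseteq> {v. v \<bullet> (z - y) = 0}"
  proof (rule span_minimal)
    show "{iterated_commutator X J y | J. 1 \<le> length J \<and> length J \<le> s} \<subseteq> {v. v \<bullet> (z - y) = 0}"
    proof safe
      fix J :: "'m list" assume "1 \<le> length J"
      then have "J \<noteq> []" by (cases J) simp_all
      have "proximally_tangent S (iterated_commutator X J)"
        using iterated_commutator_tangent[OF U cl X \<open>J \<noteq> []\<close>] by (rule conjunct2)
      then show "iterated_commutator X J y \<bullet> (z - y) = 0"
        using y unfolding proximally_tangent_def by blast
    qed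
  qed (rule subspace_hyperplane2)
  moreover have "span {iterated_commutator X J y | J. 1 \<le> length J \<and> length J \<le> s} = UNIV"
    using span y(1) U(2) unfolding commutators_span_def by blast
  \<comment> \<open>The span is the whole space, so it contains \<open>z - y\<close>, which is then
    orthogonal to itself.\<close>
  ultimately have "(z - y) \<bullet> (z - y) = 0" by blast
  then show False using z y by auto
qed

section \<open>The divergence theorem for compact supports\<close>

lemma integrable_continuous_compact_support:
  fixes f :: "'a::euclidean_space \<Rightarrow> real"
  assumes "continuous_on UNIV f" "compact K" "\<And>x. x \<notin> K \<Longrightarrow> f x = 0"
  shows "integrable lborel f"
proof -
  have "(\<lambda>x. indicator K x *\<^sub>R f x) = f" using assms(3) by (auto simp: fun_eq_iff indicator_def)
  then show ?thesis
    using borel_integrable_compact[OF assms(2) continuous_on_subset[OF assms(1) subset_UNIV]] by simp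
qed

text \<open>The fields are smooth on \<open>U\<close> only and arbitrary elsewhere. A product that
  vanishes off a closed subset of \<open>U\<close> is nevertheless regular everywhere, by gluing
  over the open sets \<open>U\<close> and \<open>- K\<close>.\<close>

lemma continuous_on_zero_extension:
  fixes f :: "'a::topological_space \<Rightarrow> real"
  assumes "open U" "continuous_on U f" "closed K" "K \<subseteq> U" "\<And>x. x \<notin> K \<Longrightarrow> f x = 0"
  shows "continuous_on UNIV f"
proof -
  have "continuous_on (- K) f"
    by (rule continuous_on_eq[OF continuous_on_const[of _ 0]]) (simp add: assms)
  then have "continuous_on (U \<union> - K) f" using assms by (intro continuous_on_open_Un) auto
  moreover have "U \<union> - K = UNIV" using assms by blast
  ultimately show ?thesis by simp
qed

lemma Ck_on_Un:
  assumes "open U" "open W" "Ck_on r U f" "Ck_on r W f"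
  shows "Ck_on r (U \<union> W) f"
  using assms(3,4)
proof (induction r arbitrary: f)
  case 0 then show ?case using assms by (auto intro: continuous_on_open_Un)
next
  case (Suc r) then show ?case by (metis Ck_on.simps(2) UnE)
qed

lemma Ck_on_zero_extension:
  assumes "open U" "Ck_on r U f" "closed K" "K \<subseteq> U" "\<And>x. x \<notin> K \<Longrightarrow> f x = 0"
  shows "Ck_on r UNIV f"
proof -
  have "open (- K)" using assms by auto
  then have "Ck_on r (- K) f \<longleftrightarrow> Ck_on r (- K) (\<lambda>x. 0)"
    by (rule Ck_on_cong) (simp add: assms)
  then have "Ck_on r (U \<union> - K) f"
    using assms \<open>open (- K)\<close> by (intro Ck_on_Un) auto
  moreover have "U \<union> - K = UNIV" using assms by blast
  ultimately show ?thesis by simp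
qed

lemma partial_deriv_zero_outside:
  assumes "closed K" "\<And>x. x \<notin> K \<Longrightarrow> f x = 0" "x \<notin> K"
  shows "partial_deriv k f x = 0"
proof -
  have "partial_deriv k f x = partial_deriv k (\<lambda>x. 0) x"
    by (rule partial_deriv_cong[of "- K"]) (use assms in auto)
  then show ?thesis by (simp add: partial_deriv_const)
qed

text \<open>By translation invariance every difference quotient of \<open>F\<close> has integral 0,
  and dominated convergence passes to the derivative.\<close>

lemma integral_partial_deriv_eq_0:
  fixes F :: "real^'n::finite \<Rightarrow> real"
  assumes C1: "Ck_on (Suc 0) UNIV F" and K: "compact K" "\<And>x. x \<notin> K \<Longrightarrow> F x = 0"
  shows "(LINT x|lborel. partial_deriv k F x) = 0"
proof -
  define e :: "real^'n" where "e = axis k 1"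
  define D where "D = partial_deriv k F"
  have ne: "norm e = 1" by (simp add: e_def)
  have cD: "continuous_on UNIV D" using C1 by (simp add: D_def)
  have cF: "continuous_on UNIV F" using Ck_on_SucD[OF C1] by simp
  have D0: "D x = 0" if "x \<notin> K" for x
    using partial_deriv_zero_outside[OF compact_imp_closed[OF K(1)] K(2) that] by (simp add: D_def)
  have iF: "integrable lborel F" using integrable_continuous_compact_support[OF cF K] .
  have "bounded (D ` K)"
    using K(1) cD by (intro compact_imp_bounded compact_continuous_image) (auto intro: continuous_on_subset)
  then obtain B where B: "B > 0" "\<And>x. x \<in> K \<Longrightarrow> norm (D x) \<le> B" unfolding bounded_pos by auto
  have DB: "\<bar>D x\<bar> \<le> B" for x using B D0[of x] by (cases "x \<in> K") auto
  obtain R where R: "\<And>x. x \<in> K \<Longrightarrow> norm x \<le> R"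
    using compact_imp_bounded[OF K(1)] unfolding bounded_pos by auto
  have dl: "((\<lambda>t. F (x + t *\<^sub>R e)) has_real_derivative D (x + t *\<^sub>R e)) (at t)" for x t
  proof -
    have "F differentiable (at (x + t *\<^sub>R e))" using C1 by simp
    note has_derivative_partial_deriv[OF this]
    moreover have "((\<lambda>t. x + t *\<^sub>R e) has_derivative (\<lambda>h. h *\<^sub>R e)) (at t)"
      by (auto intro!: derivative_eq_intros)
    ultimately have "((\<lambda>t. F (x + t *\<^sub>R e)) has_derivative
        (\<lambda>h. \<Sum>l\<in>UNIV. (h *\<^sub>R e) $ l * partial_deriv l F (x + t *\<^sub>R e))) (at t)"
      by (rule has_derivative_compose[rotated])
    moreover have "(\<Sum>l\<in>UNIV. (h *\<^sub>R e) $ l * partial_deriv l F (x + t *\<^sub>R e)) = D (x + t *\<^sub>R e) * h" for h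
      by (simp add: e_def axis_def D_def if_distrib[of "\<lambda>c. h * c * _"] sum.delta' cong: if_cong)
    ultimately show ?thesis by (simp add: has_field_derivative_def)
  qed
  define \<epsilon> where "\<epsilon> j = inverse (real (Suc j))" for j
  define f where "f j x = (F (x + \<epsilon> j *\<^sub>R e) - F x) / \<epsilon> j" for j x
  have \<epsilon>: "\<epsilon> j > 0" "\<epsilon> j \<le> 1" for j by (auto simp: \<epsilon>_def inverse_le_1_iff)
  have tr: "integrable lborel (\<lambda>x. F (x + a))" "(LINT x|lborel. F (x + a)) = (LINT x|lborel. F x)" for a
  proof -
    have "F \<in> borel_measurable borel" using cF by (intro borel_measurable_continuous_onI)
    then have "integrable (distr lborel borel ((+) a)) F = integrable lborel (\<lambda>x. F (a + x))"
      "integral\<^sup>L (distr lborel borel ((+) a)) F = (LINT x|lborel. F (a + x))"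
      by (auto intro!: integrable_distr_eq integral_distr)
    then show "integrable lborel (\<lambda>x. F (x + a))" "(LINT x|lborel. F (x + a)) = (LINT x|lborel. F x)"
      using iF by (simp_all add: lborel_distr_plus add.commute)
  qed
  have f0: "(LINT x|lborel. f j x) = 0" for j
    unfolding f_def using tr iF by simp
  have "(\<lambda>j. LINT x|lborel. f j x) \<longlonglongrightarrow> (LINT x|lborel. D x)"
  \<comment> \<open>The mean value theorem bounds the quotients by \<open>B\<close>. The shifts have
    length at most 1, so outside radius \<open>R + 1\<close> both points lie off \<open>K\<close>
    and the quotient is 0.\<close>
  proof (rule integral_dominated_convergence[where w = "\<lambda>x. B * indicator (cball 0 (R + 1)) x"])
    show "D \<in> borel_measurable lborel"
      using borel_measurable_continuous_onI[OF cD] by simp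
    show "f j \<in> borel_measurable lborel" for j
      unfolding f_def using tr(1) iF by (intro borel_measurable_divide borel_measurable_diff) auto
    show "integrable lborel (\<lambda>x. B * indicator (cball (0::real^'n) (R + 1)) x)"
      by (intro integrable_mult_right integrable_real_indicator emeasure_lborel_cball_finite) simp
    show "AE x in lborel. (\<lambda>j. f j x) \<longlonglongrightarrow> D x"
    proof (intro AE_I2)
      fix x
      have "((\<lambda>h. (F (x + (0 + h) *\<^sub>R e) - F (x + 0 *\<^sub>R e)) / h) \<longlongrightarrow> D (x + 0 *\<^sub>R e)) (at 0)"
        using dl[of x 0] by (simp add: DERIV_def)
      moreover have "filterlim \<epsilon> (at 0) sequentially"
        unfolding \<epsilon>_def using LIMSEQ_inverse_real_of_nat by (intro filterlim_atI) auto
      ultimately have "(\<lambda>j. (F (x + (0 + \<epsilon> j) *\<^sub>R e) - F (x + 0 *\<^sub>R e)) / \<epsilon> j) \<longlonglongrightarrow> D (x + 0 *\<^sub>R e)"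
        by (rule filterlim_compose)
      then show "(\<lambda>j. f j x) \<longlonglongrightarrow> D x" by (simp add: f_def)
    qed
    show "AE x in lborel. norm (f j x) \<le> B * indicator (cball 0 (R + 1)) x" for j
    proof (intro AE_I2)
      fix x
      show "norm (f j x) \<le> B * indicator (cball 0 (R + 1)) x"
      proof (cases "x \<in> cball 0 (R + 1)")
        case True
        have "\<exists>z>0. z < \<epsilon> j \<and> F (x + \<epsilon> j *\<^sub>R e) - F (x + 0 *\<^sub>R e) = (\<epsilon> j - 0) * D (x + z *\<^sub>R e)"
          using dl \<epsilon>(1) by (intro MVT2) auto
        then obtain z where "F (x + \<epsilon> j *\<^sub>R e) - F x = \<epsilon> j * D (x + z *\<^sub>R e)" by auto
        then have "f j x = D (x + z *\<^sub>R e)" using \<epsilon>(1)[of j] by (simp add: f_def)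
        then show ?thesis using DB True by simp
      next
        case False
        then have x: "norm x > R + 1" by simp
        have "norm x \<le> norm (x + \<epsilon> j *\<^sub>R e) + norm (\<epsilon> j *\<^sub>R e)"
          using norm_triangle_ineq4[of "x + \<epsilon> j *\<^sub>R e" "\<epsilon> j *\<^sub>R e"] by simp
        then have "norm (x + \<epsilon> j *\<^sub>R e) > R" using x \<epsilon>[of j] ne by simp
        then have "x + \<epsilon> j *\<^sub>R e \<notin> K" "x \<notin> K" using R x by (auto simp: not_le[symmetric] dest: R)
        then show ?thesis using K(2) False by (simp add: f_def)
      qed
    qed
  qed
  then show ?thesis using f0 by (simp add: LIMSEQ_const_iff D_def)
qed

section \<open>The divergence theorem for vector fields\<close>

definition vf_deriv :: "(real^'n::finite \<Rightarrow> real^'n) \<Rightarrow> (real^'n \<Rightarrow> real) \<Rightarrow> real^'n \<Rightarrow> real" where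
  "vf_deriv V g x = (\<Sum>k\<in>UNIV. V x $ k * partial_deriv k g x)"

definition vf_div :: "(real^'n::finite \<Rightarrow> real^'n) \<Rightarrow> real^'n \<Rightarrow> real" where
  "vf_div V x = (\<Sum>k\<in>UNIV. partial_deriv k (\<lambda>y. V y $ k) x)"

lemma vf_deriv_zero_outside:
  assumes "closed K" "\<And>x. x \<notin> K \<Longrightarrow> g x = 0" "x \<notin> K"
  shows "vf_deriv V g x = 0"
  by (simp add: vf_deriv_def partial_deriv_zero_outside[OF assms])

lemma smooth_vector_field_onD:
  "smooth_vector_field_on U V \<Longrightarrow> Ck_on r U (\<lambda>x. V x $ k)"
  by (simp add: smooth_vector_field_on_def smooth_fun_on_def)

lemma continuous_on_vf_deriv:
  assumes "smooth_vector_field_on U V" "Ck_on (Suc 0) UNIV g"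
  shows "continuous_on U (vf_deriv V g)"
proof -
  have "continuous_on U (\<lambda>x. V x $ k)" for k using smooth_vector_field_onD[OF assms(1), of 0] by simp
  moreover have "continuous_on U (partial_deriv k g)" for k
    using assms(2) by (auto intro: continuous_on_subset)
  ultimately show ?thesis unfolding vf_deriv_def by (intro continuous_on_sum continuous_on_mult)
qed

lemma continuous_on_vf_div:
  assumes "smooth_vector_field_on U V"
  shows "continuous_on U (vf_div V)"
  unfolding vf_div_def
  using smooth_vector_field_onD[OF assms, of "Suc 0"] by (intro continuous_intros) simp

text \<open>The integrand is the divergence of \<open>g V\<close>. Each product \<open>F k\<close>
  is C^1 on the whole space because \<open>g\<close> vanishes off \<open>K\<close>, whatever the
  values of \<open>V\<close> off \<open>U\<close> are, so every summand of the divergence integrates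
  to 0.\<close>

lemma divergence_integral_eq_0:
  fixes V :: "real^'n::finite \<Rightarrow> real^'n"
  assumes U: "open U" "smooth_vector_field_on U V" and g: "Ck_on (Suc 0) UNIV g"
    and K: "compact K" "K \<subseteq> U" "\<And>x. x \<notin> K \<Longrightarrow> g x = 0"
  shows "(LINT x|lborel. vf_deriv V g x + g x * vf_div V x) = 0"
proof -
  have cK: "closed K" using K(1) by (rule compact_imp_closed)
  define F where "F k x = g x * V x $ k" for k x
  have F0: "F k x = 0" if "x \<notin> K" for k x using K(3)[OF that] by (simp add: F_def)
  have CF: "Ck_on (Suc 0) UNIV (F k)" for k
  proof (rule Ck_on_zero_extension[OF U(1) _ cK K(2) F0])
    show "Ck_on (Suc 0) U (F k)"
      unfolding F_def by (rule Ck_on_mult[OF U(1) Ck_on_subset[OF g subset_UNIV] smooth_vector_field_onD[OF U(2)]])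
  qed
  have I: "integrable lborel (partial_deriv k (F k))" for k
    using CF[of k] partial_deriv_zero_outside[OF cK F0]
    by (intro integrable_continuous_compact_support[OF _ K(1)]) auto
  have "vf_deriv V g x + g x * vf_div V x = (\<Sum>k\<in>UNIV. partial_deriv k (F k) x)" for x
  proof (cases "x \<in> K")
    case True
    have "(\<lambda>x. V x $ k) differentiable (at x)" for k
      using smooth_vector_field_onD[OF U(2), of "Suc 0" k] True K(2) by auto
    moreover have "g differentiable (at x)" using g by simp
    ultimately have "partial_deriv k (F k) x = g x * partial_deriv k (\<lambda>x. V x $ k) x + partial_deriv k g x * V x $ k" for k
      unfolding F_def by (intro partial_deriv_mult)
    then show ?thesis
      by (simp add: vf_deriv_def vf_div_def sum.distrib sum_distrib_left mult.commute)
  next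
    case False
    then show ?thesis
      using K(3) by (simp add: vf_deriv_zero_outside[OF cK K(3)] partial_deriv_zero_outside[OF cK F0])
  qed
  then have "(LINT x|lborel. vf_deriv V g x + g x * vf_div V x)
      = (LINT x|lborel. (\<Sum>k\<in>UNIV. partial_deriv k (F k) x))" by simp
  also have "\<dots> = (\<Sum>k\<in>UNIV. LINT x|lborel. partial_deriv k (F k) x)"
    using I by (intro Bochner_Integration.integral_sum)
  also have "\<dots> = 0" using integral_partial_deriv_eq_0[OF CF K(1) F0] by simp
  finally show ?thesis .
qed

section \<open>Propagation of the energy bound\<close>

text \<open>Classical counterpart of \<open>X_grad\<close>: for test functions it avoids the choice
  of a representative hidden in \<open>weak_deriv_along\<close>.\<close>

definition vf_grad :: "('m::finite \<Rightarrow> real^'n::finite \<Rightarrow> real^'n) \<Rightarrow> (real^'n \<Rightarrow> real) \<Rightarrow> real^'n \<Rightarrow> real^'m" where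
  "vf_grad X u x = (\<chi> i. vf_deriv (X i) u x)"

definition vf_energy :: "real \<Rightarrow> ('m::finite \<Rightarrow> real^'n::finite \<Rightarrow> real^'n) \<Rightarrow> (real^'n \<Rightarrow> real) \<Rightarrow> real" where
  "vf_energy p X u = (LINT x|lborel. norm (vf_grad X u x) powr p)"

text \<open>This is what it means for a point to be good. Radius and constant are uniform in
  \<open>u\<close>, and the energy on the right is global, so that bounds at finitely many points
  can be added.\<close>

definition energy_dominated_at ::
    "real \<Rightarrow> (real^'n::finite) set \<Rightarrow> ('m::finite \<Rightarrow> real^'n \<Rightarrow> real^'n) \<Rightarrow> real^'n \<Rightarrow> bool" where
  "energy_dominated_at p \<Omega> X x \<longleftrightarrow> (\<exists>r>0. \<exists>C\<ge>0. \<forall>u\<in>test_functions \<Omega>.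
     (LINT y|lborel. indicator (ball x r) y * \<bar>u y\<bar> powr p) \<le> C * vf_energy p X u)"

lemma energy_dominated_atI:
  assumes "r > 0" "C \<ge> 0" "\<And>u. u \<in> test_functions \<Omega> \<Longrightarrow>
     (LINT y|lborel. indicator (ball x r) y * \<bar>u y\<bar> powr p) \<le> C * vf_energy p X u"
  shows "energy_dominated_at p \<Omega> X x"
  using assms unfolding energy_dominated_at_def by blast

lemma vf_energy_nonneg [simp]: "0 \<le> vf_energy p X u"
  by (simp add: vf_energy_def)

lemma vf_deriv_mult:
  assumes "f differentiable (at x)" "g differentiable (at x)"
  shows "vf_deriv V (\<lambda>x. f x * g x) x = f x * vf_deriv V g x + g x * vf_deriv V f x"
  using assms
  by (simp add: vf_deriv_def partial_deriv_mult sum.distrib distrib_left sum_distrib_left algebra_simps)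

lemma vf_deriv_compose:
  assumes "q differentiable (at x)" "(h has_real_derivative h') (at (q x))"
  shows "vf_deriv V (\<lambda>x. h (q x)) x = h' * vf_deriv V q x"
  by (simp add: vf_deriv_def partial_deriv_compose[OF assms] sum_distrib_left algebra_simps)

text \<open>The left side is \<open>p a\<^sup>p\<^sup>-\<^sup>1 b\<close> with
  \<open>a = \<bar>u\<bar>\<close> and \<open>b = \<bar>V u\<bar>\<close>. Replacing the smaller of
  \<open>a\<close> and \<open>b\<close> by the larger gives a crude Young inequality.\<close>

lemma abs_vf_deriv_abs_powr_le:
  assumes "1 < p" "u differentiable (at x)"
  shows "\<bar>vf_deriv V (\<lambda>x. \<bar>u x\<bar> powr p) x\<bar> \<le> p * (\<bar>u x\<bar> powr p + \<bar>vf_deriv V u x\<bar> powr p)"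
proof -
  let ?a = "\<bar>u x\<bar>" and ?b = "\<bar>vf_deriv V u x\<bar>"
  have "\<bar>vf_deriv V (\<lambda>x. \<bar>u x\<bar> powr p) x\<bar>
      = \<bar>p * (max 0 (u x) powr (p - 1) - max 0 (- u x) powr (p - 1))\<bar> * ?b"
    by (simp add: vf_deriv_compose[OF assms(2) has_real_derivative_abs_powr[OF assms(1)]] abs_mult)
  also have "\<bar>p * (max 0 (u x) powr (p - 1) - max 0 (- u x) powr (p - 1))\<bar> = p * ?a powr (p - 1)"
    using assms(1) by (cases "u x \<ge> 0") (simp_all add: abs_mult max_def)
  also have "p * ?a powr (p - 1) * ?b \<le> p * (?a powr p + ?b powr p)"
  proof -
    have "?a powr (p - 1) * ?b \<le> ?a powr p + ?b powr p"
    proof (cases "?b \<le> ?a")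
      case True
      then have "?a powr (p - 1) * ?b \<le> ?a powr (p - 1) * ?a" by (intro mult_left_mono) auto
      also have "\<dots> = ?a powr p" using powr_mult_base[of ?a "p - 1"] by (simp add: mult.commute)
      finally show ?thesis by (simp add: add_increasing2)
    next
      case False
      then have "?a powr (p - 1) * ?b \<le> ?b powr (p - 1) * ?b"
        using assms(1) by (intro mult_right_mono powr_mono2) auto
      also have "\<dots> = ?b powr p" using powr_mult_base[of ?b "p - 1"] by (simp add: mult.commute)
      finally show ?thesis by (simp add: add_increasing)
    qed
    then show ?thesis using assms(1) by (simp add: mult.assoc)
  qed
  finally show ?thesis .
qed

lemma test_functionsD:
  assumes "u \<in> test_functions \<Omega>"
  shows "Ck_on r UNIV u" "compact (closure {x. u x \<noteq> 0})" "closure {x. u x \<noteq> 0} \<subseteq> \<Omega>"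
    and "x \<notin> closure {x. u x \<noteq> 0} \<Longrightarrow> u x = 0"
  using assms closure_subset[of "{x. u x \<noteq> 0}"]
  by (auto simp: test_functions_def smooth_fun_on_def compactly_inside_def)

lemma norm_powr_continuous:
  assumes "0 < p" "continuous_on S f"
  shows "continuous_on S (\<lambda>x. norm (f x) powr p)"
  using assms by (intro continuous_on_powr' continuous_intros) auto

lemma test_function_abs_powr:
  assumes u: "u \<in> test_functions \<Omega>" and p: "1 < p"
  shows "Ck_on (Suc 0) UNIV (\<lambda>x. \<bar>u x\<bar> powr p)"
    and "x \<notin> closure {x. u x \<noteq> 0} \<Longrightarrow> \<bar>u x\<bar> powr p = 0"
    and "integrable lborel (\<lambda>x. \<bar>u x\<bar> powr p)"
    and "integrable lborel (\<lambda>x. indicator (ball y r) x * \<bar>u x\<bar> powr p)"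
    and "compact K \<Longrightarrow> integrable lborel (\<lambda>x. indicator K x * \<bar>u x\<bar> powr p)"
proof -
  show 1: "Ck_on (Suc 0) UNIV (\<lambda>x. \<bar>u x\<bar> powr p)"
    by (rule Ck_on_1_abs_powr[OF p open_UNIV test_functionsD(1)[OF u]])
  show 2: "\<bar>u x\<bar> powr p = 0" if "x \<notin> closure {x. u x \<noteq> 0}" for x
    by (simp add: test_functionsD(4)[OF u that])
  show 3: "integrable lborel (\<lambda>x. \<bar>u x\<bar> powr p)"
    using Ck_on_SucD[OF 1]
    by (intro integrable_continuous_compact_support[OF _ test_functionsD(2)[OF u] 2]) auto
  show "integrable lborel (\<lambda>x. indicator (ball y r) x * \<bar>u x\<bar> powr p)"
    using integrable_real_mult_indicator[OF _ 3, of "ball y r"] by (simp add: mult.commute)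
  show "compact K \<Longrightarrow> integrable lborel (\<lambda>x. indicator K x * \<bar>u x\<bar> powr p)"
    using integrable_real_mult_indicator[OF _ 3, of K] by (simp add: mult.commute borel_compact)
qed

section \<open>Good points and their propagation\<close>

locale vector_fields_near =
  fixes p :: real and U \<Omega> :: "(real^'n::finite) set"
    and X :: "'m::finite \<Rightarrow> real^'n \<Rightarrow> real^'n"
  assumes p: "1 < p" and open_U: "open U" and smooth_X: "\<And>i. smooth_vector_field_on U (X i)"
    and open_\<Omega>: "open \<Omega>" and inside: "compactly_inside \<Omega> U"
begin

lemma closure_\<Omega>: "compact (closure \<Omega>)" "closure \<Omega> \<subseteq> U"
  using inside by (auto simp: compactly_inside_def)

lemma \<Omega>_subset_U: "\<Omega> \<subseteq> U"
  using closure_\<Omega>(2) closure_subset by blast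

lemma vf_grad_test_function:
  assumes u: "u \<in> test_functions \<Omega>"
  shows "continuous_on UNIV (vf_deriv (X i) u)"
    and "continuous_on UNIV (vf_grad X u)"
    and "x \<notin> closure {x. u x \<noteq> 0} \<Longrightarrow> vf_grad X u x = 0"
    and "integrable lborel (\<lambda>x. norm (vf_grad X u x) powr p)"
proof -
  have z: "vf_deriv (X i) u x = 0" if "x \<notin> closure {x. u x \<noteq> 0}" for i x
    by (rule vf_deriv_zero_outside[OF closed_closure test_functionsD(4)[OF u] that])
  show 1: "continuous_on UNIV (vf_deriv (X i) u)" for i
    by (rule continuous_on_zero_extension[OF open_U continuous_on_vf_deriv[OF smooth_X
          test_functionsD(1)[OF u]] closed_closure order_trans[OF test_functionsD(3)[OF u] \<Omega>_subset_U] z])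
  show 2: "continuous_on UNIV (vf_grad X u)"
    unfolding vf_grad_def by (intro continuous_on_vec_lambda 1)
  show 3: "vf_grad X u x = 0" if "x \<notin> closure {x. u x \<noteq> 0}" for x
    using z[OF that] by (simp add: vf_grad_def vec_eq_iff)
  show "integrable lborel (\<lambda>x. norm (vf_grad X u x) powr p)"
    using p 2
    by (intro integrable_continuous_compact_support[OF _ test_functionsD(2)[OF u]] norm_powr_continuous)
      (simp_all add: 3)
qed

abbreviation "dominated \<equiv> energy_dominated_at p \<Omega> X"

text \<open>A smaller ball inside the given one inherits the constant; this makes the set of bad
  points closed.\<close>

lemma dominated_ball:
  assumes "dominated x"
  obtains r where "r > 0" "\<And>y. y \<in> ball x r \<Longrightarrow> dominated y"
proof -
  obtain r C where r: "r > 0" "C \<ge> 0" and C: "\<And>u. u \<in> test_functions \<Omega> \<Longrightarrow>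
     (LINT y|lborel. indicator (ball x r) y * \<bar>u y\<bar> powr p) \<le> C * vf_energy p X u"
    using assms unfolding energy_dominated_at_def by blast
  have "dominated y" if y: "y \<in> ball x r" for y
  proof (rule energy_dominated_atI[where r = "r - dist x y" and C = C])
    show "0 \<le> C" by (rule r)
    show "0 < r - dist x y" using y by simp
    fix u assume u: "u \<in> test_functions \<Omega>"
    have "ball y (r - dist x y) \<subseteq> ball x r"
    proof
      fix a assume "a \<in> ball y (r - dist x y)"
      then show "a \<in> ball x r" using dist_triangle[of x a y] by simp
    qed
    then have "(LINT z|lborel. indicator (ball y (r - dist x y)) z * \<bar>u z\<bar> powr p)
        \<le> (LINT z|lborel. indicator (ball x r) z * \<bar>u z\<bar> powr p)"
      using test_function_abs_powr(4)[OF u p]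
      by (intro integral_mono mult_right_mono) (auto simp: indicator_def)
    with C[OF u] show "(LINT z|lborel. indicator (ball y (r - dist x y)) z * \<bar>u z\<bar> powr p)
        \<le> C * vf_energy p X u" by simp
  qed
  with r that show thesis by blast
qed

text \<open>Test functions vanish on a whole ball around \<open>x\<close>, so the constant 0 serves.
  Every other bound is propagated from here.\<close>

lemma dominated_outside:
  assumes "x \<notin> closure \<Omega>"
  shows "dominated x"
proof -
  have "open (- closure \<Omega>)" by auto
  then obtain r where r: "r > 0" "ball x r \<subseteq> - closure \<Omega>" using assms openE[of "- closure \<Omega>" x] by auto
  have "(LINT y|lborel. indicator (ball x r) y * \<bar>u y\<bar> powr p) \<le> 0 * vf_energy p X u"
    if u: "u \<in> test_functions \<Omega>" for u
  proof -
    have "indicator (ball x r) y * \<bar>u y\<bar> powr p = 0" for y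
    proof (cases "y \<in> ball x r")
      case True
      then have ny: "y \<notin> closure {x. u x \<noteq> 0}"
        using r test_functionsD(3)[OF u] closure_subset[of \<Omega>] by blast
      show ?thesis by (simp add: test_functionsD(4)[OF u ny])
    qed simp
    then have "(\<lambda>y. indicator (ball x r) y * \<bar>u y\<bar> powr p) = (\<lambda>y. 0)" by (rule ext)
    then show ?thesis by (simp only: Bochner_Integration.integral_zero mult_zero_left order_refl)
  qed
  then show ?thesis by (rule energy_dominated_atI[OF r(1) order_refl])
qed

text \<open>A finite subcover; the local constants add up because all local bounds have the same
  energy on the right.\<close>

lemma dominated_compact:
  assumes K: "compact K" "\<And>x. x \<in> K \<Longrightarrow> dominated x"
  obtains C where "C \<ge> 0" "\<And>u. u \<in> test_functions \<Omega> \<Longrightarrow>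
     (LINT y|lborel. indicator K y * \<bar>u y\<bar> powr p) \<le> C * vf_energy p X u"
proof -
  define P where "P x r C \<longleftrightarrow> r > 0 \<and> C \<ge> 0 \<and> (\<forall>u\<in>test_functions \<Omega>.
     (LINT y|lborel. indicator (ball x r) y * \<bar>u y\<bar> powr p) \<le> C * vf_energy p X u)"
    for x and r C :: real
  have "\<forall>x\<in>K. \<exists>r C. P x r C"
  proof
    fix x assume "x \<in> K"
    then obtain r C where "r > 0" "C \<ge> 0" "\<forall>u\<in>test_functions \<Omega>.
     (LINT y|lborel. indicator (ball x r) y * \<bar>u y\<bar> powr p) \<le> C * vf_energy p X u"
      using K(2)[of x] unfolding energy_dominated_at_def by blast
    then have "P x r C" unfolding P_def by (intro conjI)
    then show "\<exists>r C. P x r C" by blast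
  qed
  then obtain r C where P: "\<And>x. x \<in> K \<Longrightarrow> P x (r x) (C x)" by metis
  have rC: "r x > 0" "C x \<ge> 0" if "x \<in> K" for x
    using P[OF that] unfolding P_def by blast+
  have rC3: "(LINT y|lborel. indicator (ball x (r x)) y * \<bar>u y\<bar> powr p) \<le> C x * vf_energy p X u"
    if "x \<in> K" "u \<in> test_functions \<Omega>" for x u
    using P[OF that(1)] that(2) unfolding P_def by blast
  obtain T where T: "T \<subseteq> K" "finite T" "K \<subseteq> (\<Union>x\<in>T. ball x (r x))"
    using compactE_image[OF K(1), of K "\<lambda>x. ball x (r x)"] rC(1) by force
  show thesis
  proof (rule that[of "\<Sum>x\<in>T. C x"])
    show "0 \<le> (\<Sum>x\<in>T. C x)" using rC(2) T by (intro sum_nonneg) auto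
    fix u assume u: "u \<in> test_functions \<Omega>"
    have "(LINT y|lborel. indicator K y * \<bar>u y\<bar> powr p)
        \<le> (LINT y|lborel. (\<Sum>x\<in>T. indicator (ball x (r x)) y * \<bar>u y\<bar> powr p))"
    proof (rule integral_mono)
      show "integrable lborel (\<lambda>y. indicator K y * \<bar>u y\<bar> powr p)"
        by (rule test_function_abs_powr(5)[OF u p K(1)])
      show "integrable lborel (\<lambda>y. \<Sum>x\<in>T. indicator (ball x (r x)) y * \<bar>u y\<bar> powr p)"
        by (intro Bochner_Integration.integrable_sum test_function_abs_powr(4)[OF u p])
      fix y
      have "indicator K y \<le> (\<Sum>x\<in>T. indicator (ball x (r x)) y :: real)"
      proof (cases "y \<in> K")
        case True
        then obtain x where x: "x \<in> T" "y \<in> ball x (r x)" using T by blast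
        then have "(1::real) = indicator (ball x (r x)) y" by simp
        also have "\<dots> \<le> (\<Sum>x\<in>T. indicator (ball x (r x)) y)"
          using T(2) x(1) by (intro member_le_sum) auto
        finally show ?thesis using True by simp
      qed (simp add: sum_nonneg)
      then show "indicator K y * \<bar>u y\<bar> powr p \<le> (\<Sum>x\<in>T. indicator (ball x (r x)) y * \<bar>u y\<bar> powr p)"
        unfolding sum_distrib_right[symmetric] by (intro mult_right_mono) auto
    qed
    also have "\<dots> = (\<Sum>x\<in>T. LINT y|lborel. indicator (ball x (r x)) y * \<bar>u y\<bar> powr p)"
      by (intro Bochner_Integration.integral_sum test_function_abs_powr(4)[OF u p])
    also have "\<dots> \<le> (\<Sum>x\<in>T. C x * vf_energy p X u)"
      using rC3[OF _ u] T(1) by (intro sum_mono) auto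
    finally show "(LINT y|lborel. indicator K y * \<bar>u y\<bar> powr p) \<le> (\<Sum>x\<in>T. C x) * vf_energy p X u"
      by (simp add: sum_distrib_right)
  qed
qed

text \<open>The divergence of \<open>\<psi> \<bar>u\<bar>\<^sup>p V\<close> has integral 0. Its main part \<open>\<bar>u\<bar>\<^sup>p V \<psi>\<close> has a definite sign near \<open>y\<close>,
  and wherever it may have the other sign the bound is already known.\<close>

lemma dominated_propagation:
  assumes y: "y \<in> U" and near: "\<And>x. \<not> dominated x \<Longrightarrow> dist z y \<le> dist z x"
    and transversal: "X i y \<bullet> (z - y) \<noteq> 0"
  shows "dominated y"
proof -
  define V where "V = X i"
  have V: "smooth_vector_field_on U V" using smooth_X by (simp add: V_def)
  \<comment> \<open>The ball around \<open>z\<close> through \<open>y\<close> may have several bad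
    points on its sphere. The ball around the midpoint \<open>c\<close> through \<open>y\<close>
    lies inside it and touches that sphere at \<open>y\<close> alone.\<close>
  define c where "c = (1/2) *\<^sub>R (y + z)"
  define e where "e = c - y"
  have zc: "z - c = e" "z - y = 2 *\<^sub>R e"
    by (simp_all add: c_def e_def algebra_simps flip: scaleR_left_distrib)
       (simp_all add: vec_eq_iff)
  \<comment> \<open>The sign makes the main term positive at \<open>y\<close>; half of its value
    there is kept as a lower bound on a neighbourhood.\<close>
  define \<sigma> where "\<sigma> = sgn (V y \<bullet> e)"
  define c0 where "c0 = \<bar>V y \<bullet> e\<bar> / 2"
  have Ve: "V y \<bullet> e \<noteq> 0" using transversal by (simp add: V_def zc(2))
  have c0: "c0 > 0" using Ve by (simp add: c0_def)
  have \<sigma>: "\<bar>\<sigma>\<bar> = 1" "\<sigma> * (V y \<bullet> e) = 2 * c0" using Ve by (auto simp: \<sigma>_def c0_def sgn_if)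
  have contV: "continuous_on U V"
  proof -
    have "continuous_on U (\<lambda>x. \<chi> k. V x $ k)"
      using smooth_vector_field_onD[OF V, of 0] by (intro continuous_on_vec_lambda) simp
    then show ?thesis by simp
  qed
  have cont1: "continuous_on U (\<lambda>x. V x \<bullet> (c - x))" by (intro continuous_intros contV)
  have "\<forall>\<^sub>F x in nhds y. c0 < \<sigma> * (V x \<bullet> (c - x))"
  proof -
    have "isCont (\<lambda>x. \<sigma> * (V x \<bullet> (c - x))) y"
      using cont1 y open_U by (intro continuous_mult continuous_const) (simp add: continuous_on_eq_continuous_at)
    then have "((\<lambda>x. \<sigma> * (V x \<bullet> (c - x))) \<longlongrightarrow> \<sigma> * (V y \<bullet> (c - y))) (nhds y)"
      unfolding continuous_at by (rule tendsto_at_iff_tendsto_nhds[THEN iffD1])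
    then show ?thesis by (rule order_tendstoD(1)) (use \<sigma>(2) c0 in \<open>simp add: e_def\<close>)
  qed
  then obtain \<delta>1 where \<delta>1: "\<delta>1 > 0" "\<And>x. dist x y < \<delta>1 \<Longrightarrow> c0 < \<sigma> * (V x \<bullet> (c - x))"
    unfolding eventually_nhds_metric by blast
  obtain M where M: "M > 0" "\<And>x. x \<in> closure \<Omega> \<Longrightarrow> \<bar>vf_div V x\<bar> \<le> M"
    "\<And>x. x \<in> closure \<Omega> \<Longrightarrow> \<bar>V x \<bullet> (c - x)\<bar> \<le> M"
  proof -
    have "bounded (vf_div V ` closure \<Omega>)" "bounded ((\<lambda>x. V x \<bullet> (c - x)) ` closure \<Omega>)"
      using closure_\<Omega> continuous_on_vf_div[OF V] cont1
      by (auto intro!: compact_imp_bounded compact_continuous_image intro: continuous_on_subset)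
    then obtain M1 M2 where "M1 > 0" "\<And>x. x \<in> closure \<Omega> \<Longrightarrow> \<bar>vf_div V x\<bar> \<le> M1"
      "M2 > 0" "\<And>x. x \<in> closure \<Omega> \<Longrightarrow> \<bar>V x \<bullet> (c - x)\<bar> \<le> M2"
      unfolding bounded_pos by auto
    then show thesis by (intro that[of "max M1 M2"]) (auto simp: le_max_iff_disj)
  qed
  define r where "r = norm e"
  \<comment> \<open>The last bound gives \<open>s x * (M + p) \<le> c0\<close> near
    \<open>y\<close>, so that the terms without a derivative of the cut-off, which carry one more
    factor \<open>s x\<close>, are absorbed by the main term. The bound 1 serves for
    \<open>\<eta> \<le> \<delta>\<close>.\<close>
  define \<delta> where "\<delta> = min 1 (min \<delta>1 (c0 / ((1 + 2 * r) * (M + p))))"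
  have Mp: "0 < (1 + 2 * r) * (M + p)" using M p by (intro mult_pos_pos add_pos_nonneg) (auto simp: r_def)
  have \<delta>: "0 < \<delta>" "\<delta> \<le> 1" "\<delta> \<le> \<delta>1" using \<delta>1 c0 Mp by (auto simp: \<delta>_def)
  have \<delta>c: "\<delta> * ((1 + 2 * r) * (M + p)) \<le> c0"
    using Mp by (simp add: \<delta>_def pos_le_divide_eq[symmetric])
  \<comment> \<open>Small enough that bad points in the enlarged ball lie within
    \<open>\<delta>\<close> of \<open>y\<close>: their squared distance to \<open>y\<close> will be
    at most \<open>2 * \<eta>\<close>.\<close>
  define \<eta> where "\<eta> = \<delta>\<^sup>2 / 4"
  have \<eta>: "0 < \<eta>" using \<delta> by (simp add: \<eta>_def)
  define R where "R = r\<^sup>2 + \<eta>"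
  have R: "0 < R" using \<eta> by (simp add: R_def add_nonneg_pos)
  \<comment> \<open>\<open>s\<close> is positive in the ball around \<open>c\<close> of radius \<open>sqrt R\<close>, slightly more than \<open>r\<close>; since \<open>z\<close> is at
    distance \<open>2 r\<close> from the bad points, these enter this ball only near \<open>y\<close>\<close>
  define s where "s x = R - (\<Sum>j\<in>UNIV. (x $ j - c $ j) * (x $ j - c $ j))" for x
  have s_eq: "s x = R - (norm (x - c))\<^sup>2" for x
    by (simp add: s_def power2_norm_eq_inner inner_vec_def)
  have sR: "s x \<le> R" for x by (simp add: s_eq)
  have Cks: "Ck_on k UNIV s" for k
    unfolding s_def by (intro Ck_on_diff Ck_on_sum Ck_on_mult Ck_on_const Ck_on_component open_UNIV)
  have ds: "s differentiable (at x)" for x using Cks[of "Suc 0"] by simp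
  have s_small: "s x \<le> \<delta> * (1 + 2 * r)" if "dist x y < \<delta>" for x
  proof -
    have "r - \<delta> \<le> norm (x - c)"
      using that norm_triangle_ineq2[of e "x - y"] by (simp add: e_def r_def dist_norm norm_minus_commute)
    then have "(norm (x - c))\<^sup>2 \<ge> r\<^sup>2 - 2 * r * \<delta>"
    proof (cases "r - \<delta> \<ge> 0")
      case True
      then have "(r - \<delta>)\<^sup>2 \<le> (norm (x - c))\<^sup>2" using \<open>r - \<delta> \<le> norm (x - c)\<close> by (intro power_mono)
      moreover have "(r - \<delta>)\<^sup>2 = r\<^sup>2 - 2 * r * \<delta> + \<delta>\<^sup>2" by (simp add: power2_diff)
      ultimately show ?thesis using zero_le_power2[of \<delta>] by linarith
    next
      case False
      then have "r * r \<le> r * (2 * \<delta>)" using \<delta> by (intro mult_left_mono) (auto simp: r_def)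
      then have "r\<^sup>2 \<le> 2 * r * \<delta>" by (simp add: power2_eq_square mult.assoc mult.left_commute)
      then show ?thesis using zero_le_power2[of "norm (x - c)"] by linarith
    qed
    moreover have "\<eta> \<le> \<delta>"
      using mult_left_mono[of \<delta> 1 \<delta>] \<delta> by (simp add: \<eta>_def power2_eq_square)
    ultimately show ?thesis by (simp add: s_eq R_def algebra_simps)
  qed
  \<comment> \<open>Squaring makes the cut-off of class C^1, and it vanishes to one order more than
    its gradient: near \<open>y\<close> it is small compared with its derivative along
    \<open>V\<close>.\<close>
  define \<psi> where "\<psi> x = max 0 (s x) powr 2" for x
  have C\<psi>: "Ck_on (Suc 0) UNIV \<psi>"
    unfolding \<psi>_def
    by (rule Ck_on_1_compose[OF open_UNIV Cks has_real_derivative_pos_part_powr])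
      (auto intro!: continuous_intros continuous_on_max_powr)
  have V\<psi>: "vf_deriv V \<psi> x = 4 * max 0 (s x) * (V x \<bullet> (c - x))" for x
  proof -
    have "(s has_derivative (\<lambda>h. 0 - (\<Sum>j\<in>UNIV. (x $ j - c $ j) * (h $ j - 0) + (h $ j - 0) * (x $ j - c $ j)))) (at x)"
      unfolding s_def
      by (intro has_derivative_diff has_derivative_sum has_derivative_mult has_derivative_const
          bounded_linear.has_derivative[OF bounded_linear_vec_nth] has_derivative_ident)
    from partial_deriv_eqI[OF this] have ps: "partial_deriv k s x = 2 * (c $ k - x $ k)" for k
      by (simp add: axis_def if_distrib[of "\<lambda>t. t * _"] if_distrib[of "\<lambda>t. _ * t"] sum.distrib cong: if_cong)
    have "vf_deriv V s x = 2 * (V x \<bullet> (c - x))"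
      unfolding vf_deriv_def inner_vec_def sum_distrib_left ps
      by (intro sum.cong refl) (simp add: algebra_simps)
    then show ?thesis
      unfolding \<psi>_def by (subst vf_deriv_compose[OF ds has_real_derivative_pos_part_powr]) auto
  qed
  have \<psi>_eq: "\<psi> x = (max 0 (s x))\<^sup>2" for x by (simp add: \<psi>_def)
  \<comment> \<open>The part of the enlarged ball where the sign of the main term is unknown. All
    its points turn out to be good, which supplies the bound there.\<close>
  define K where "K = cball c (sqrt R) - ball y \<delta>"
  have K: "compact K" unfolding K_def by (intro compact_diff compact_cball open_ball)
  have "dominated x" if x: "x \<in> K" for x
  proof (rule ccontr)
    assume "\<not> dominated x"
    then have "dist z y \<le> dist z x" by (rule near)
    moreover have "dist z y = 2 * r" by (simp add: dist_norm zc r_def)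
    moreover have xz: "x - z = (x - c) - e" and xy: "x - y = (x - c) + e" using zc by (auto simp: e_def)
    ultimately have 1: "2 * r \<le> norm ((x - c) - e)" "norm (x - y) = norm ((x - c) + e)"
      unfolding xz[symmetric] xy[symmetric] by (simp_all add: dist_norm norm_minus_commute)
    have "norm (x - c) \<le> sqrt R" using x by (simp add: K_def dist_norm norm_minus_commute)
    then have "(norm (x - c))\<^sup>2 \<le> R" using R by (metis norm_ge_zero power_mono real_sqrt_pow2 less_imp_le)
    moreover have "(2 * r)\<^sup>2 \<le> (norm ((x - c) - e))\<^sup>2" using 1 by (intro power_mono) (auto simp: r_def)
    \<comment> \<open>The parallelogram law for \<open>x - z\<close> and \<open>x - y\<close>: a
      point of the enlarged ball at distance at least \<open>2 * r\<close> from \<open>z\<close>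
      must be close to \<open>y\<close>.\<close>
    moreover have "(norm ((x - c) - e))\<^sup>2 + (norm ((x - c) + e))\<^sup>2 = 2 * (norm (x - c))\<^sup>2 + 2 * r\<^sup>2"
      unfolding r_def power2_norm_eq_inner by (simp add: inner_add inner_diff inner_commute)
    ultimately have "(norm (x - y))\<^sup>2 \<le> 2 * \<eta>" by (simp add: 1(2) R_def power_mult_distrib)
    also have "\<dots> < \<delta>\<^sup>2" using \<delta> by (simp add: \<eta>_def)
    finally have "norm (x - y) < \<delta>" by (rule power_less_imp_less_base) (use \<delta>(1) in linarith)
    then show False using x by (simp add: K_def dist_norm norm_minus_commute)
  qed
  then obtain CK where CK: "CK \<ge> 0" "\<And>u. u \<in> test_functions \<Omega> \<Longrightarrow>
     (LINT y|lborel. indicator K y * \<bar>u y\<bar> powr p) \<le> CK * vf_energy p X u"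
    using dominated_compact[OF K] by blast
  obtain r1 where r1: "r1 > 0" "\<And>x. x \<in> ball y r1 \<Longrightarrow> \<eta> / 2 < s x" "ball y r1 \<subseteq> ball y \<delta>"
  proof -
    have "s y = \<eta>" by (simp add: s_eq R_def r_def e_def norm_minus_commute)
    moreover have "isCont s y" using ds differentiable_imp_continuous_within by blast
    ultimately have "(s \<longlongrightarrow> \<eta>) (nhds y)" by (metis continuous_at tendsto_at_iff_tendsto_nhds)
    then have "\<forall>\<^sub>F x in nhds y. \<eta> / 2 < s x" by (rule order_tendstoD(1)) (use \<eta> in simp)
    then obtain \<delta>2 where "\<delta>2 > 0" "\<And>x. dist x y < \<delta>2 \<Longrightarrow> \<eta> / 2 < s x"
      unfolding eventually_nhds_metric by blast
    then show thesis using \<delta> by (intro that[of "min \<delta>2 \<delta>"]) (auto simp: dist_commute)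
  qed
  \<comment> \<open>\<open>C1\<close> bounds the terms with \<open>\<bar>u\<bar>\<^sup>p\<close> on
    \<open>K\<close>, and \<open>C2\<close> the coefficient of the gradient term; both use that the
    positive part of \<open>s\<close> is at most \<open>R\<close>.\<close>
  define C1 where "C1 = R * (4 * M) + R\<^sup>2 * (M + p)"
  define C2 where "C2 = R\<^sup>2 * p"
  have C12: "C1 \<ge> 0" "C2 \<ge> 0" using M p R by (auto simp: C1_def C2_def)
  show ?thesis
  proof (rule energy_dominated_atI[where r = r1 and C = "(C1 * CK + C2) / (c0 * \<eta>)", OF r1(1)])
    show "0 \<le> (C1 * CK + C2) / (c0 * \<eta>)" using C12 CK c0 \<eta> by simp
    fix u assume u: "u \<in> test_functions \<Omega>"
    define w where "w x = \<bar>u x\<bar> powr p" for x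
    define G where "G x = norm (vf_grad X u x) powr p" for x
    define g where "g x = \<psi> x * w x" for x
    define I where "I x = vf_deriv V g x + g x * vf_div V x" for x
    let ?S = "closure {x. u x \<noteq> 0}"
    note S = test_functionsD(2,3)[OF u]
    have SU: "?S \<subseteq> U" using S \<Omega>_subset_U by blast
    have wC: "Ck_on (Suc 0) UNIV w"
      using test_function_abs_powr(1)[OF u p] by (simp add: w_def[abs_def])
    have w0: "w x = 0" if "x \<notin> ?S" for x
      unfolding w_def by (rule test_function_abs_powr(2)[OF u p that])
    have wn: "w x \<ge> 0" for x by (simp add: w_def)
    note w = wC w0 wn
    have gC: "Ck_on (Suc 0) UNIV g"
      unfolding g_def[abs_def] by (rule Ck_on_mult[OF open_UNIV C\<psi> wC])
    have g0: "g x = 0" if "x \<notin> ?S" for x by (simp add: g_def w0[OF that])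
    note g = gC g0
    have I0: "I x = 0" if "x \<notin> ?S" for x
      using vf_deriv_zero_outside[OF closed_closure g0 that] by (simp add: I_def g0[OF that])
    have "continuous_on U I"
      unfolding I_def using continuous_on_vf_deriv[OF V g(1)] continuous_on_vf_div[OF V]
        Ck_on_SucD[OF g(1)]
      by (intro continuous_on_add continuous_on_mult) (auto intro: continuous_on_subset)
    then have "continuous_on UNIV I"
      by (rule continuous_on_zero_extension[OF open_U _ closed_closure SU I0])
    then have iI: "integrable lborel I"
      by (rule integrable_continuous_compact_support[OF _ S(1) I0])
    have int0: "(LINT x|lborel. I x) = 0"
      unfolding I_def by (rule divergence_integral_eq_0[OF open_U V g(1) S(1) SU g(2)])
    have iG: "integrable lborel G" unfolding G_def by (rule vf_grad_test_function(4)[OF u])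
    \<comment> \<open>On the support of \<open>u\<close> there are three regions: near
      \<open>y\<close> the main term wins, on \<open>K\<close> everything is bounded by
      \<open>C1\<close>, and elsewhere the cut-off and its derivative along \<open>V\<close>
      vanish.\<close>
    have pointwise: "c0 * \<eta> * (indicator (ball y r1) x * w x)
        \<le> \<sigma> * I x + C1 * (indicator K x * w x) + C2 * G x" for x
    proof (cases "x \<in> ?S")
      case False
      show ?thesis using w0[OF False] I0[OF False] C12 by (simp add: G_def)
    next
      case True
      then have x\<Omega>: "x \<in> closure \<Omega>" using S closure_subset by blast
      define t where "t = max 0 (s x)"
      have t: "0 \<le> t" "t \<le> R" using sR R by (auto simp: t_def less_imp_le)
      have du: "u differentiable (at x)" using test_functionsD(1)[OF u, of "Suc 0"] by simp
      have "\<psi> differentiable (at x)" "w differentiable (at x)" using C\<psi> w by auto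
      then have "vf_deriv V g x = \<psi> x * vf_deriv V w x + w x * vf_deriv V \<psi> x"
        unfolding g_def[abs_def] by (rule vf_deriv_mult)
      moreover have "\<psi> x = t\<^sup>2" "vf_deriv V \<psi> x = 4 * t * (V x \<bullet> (c - x))"
        by (simp_all add: \<psi>_eq V\<psi> t_def)
      ultimately have Ix: "I x = t\<^sup>2 * vf_deriv V w x + w x * (4 * t * (V x \<bullet> (c - x)) + t\<^sup>2 * vf_div V x)"
        unfolding I_def by (simp add: g_def distrib_left mult.commute mult.left_commute)
      have vu: "\<bar>vf_deriv V u x\<bar> powr p \<le> G x"
      proof -
        have "\<bar>vf_deriv V u x\<bar> \<le> norm (vf_grad X u x)"
          using component_le_norm_cart[of "vf_grad X u x" i] by (simp add: vf_grad_def V_def)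
        then show ?thesis unfolding G_def using p by (intro powr_mono2) auto
      qed
      have "\<bar>vf_deriv V w x\<bar> \<le> p * (w x + \<bar>vf_deriv V u x\<bar> powr p)"
        unfolding w_def by (rule abs_vf_deriv_abs_powr_le[OF p du])
      also have "\<dots> \<le> p * (w x + G x)" using vu p by (intro mult_left_mono) auto
      finally have "\<bar>\<sigma> * vf_deriv V w x\<bar> \<le> p * (w x + G x)" by (simp add: abs_mult \<sigma>)
      then have b1: "t\<^sup>2 * (\<sigma> * vf_deriv V w x) \<ge> t\<^sup>2 * - (p * (w x + G x))"
        by (intro mult_left_mono) auto
      have "\<bar>\<sigma> * vf_div V x\<bar> \<le> M" using M(2)[OF x\<Omega>] by (simp add: abs_mult \<sigma>)
      then have b2: "(w x * t\<^sup>2) * (\<sigma> * vf_div V x) \<ge> (w x * t\<^sup>2) * - M"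
        using w(3) by (intro mult_left_mono) auto
      have G0: "G x \<ge> 0" by (simp add: G_def)
      have eq: "\<sigma> * I x = t\<^sup>2 * (\<sigma> * vf_deriv V w x) + (w x * t\<^sup>2) * (\<sigma> * vf_div V x)
          + (4 * t * w x) * (\<sigma> * (V x \<bullet> (c - x)))"
        unfolding Ix by (simp add: algebra_simps)
      have t2: "t\<^sup>2 \<le> R\<^sup>2" using t by (intro power_mono)
      have "t\<^sup>2 * (p * G x) \<le> R\<^sup>2 * (p * G x)" using t2 p G0 by (intro mult_right_mono) auto
      then have b3: "t\<^sup>2 * (p * G x) \<le> C2 * G x" by (simp add: C2_def)
      show ?thesis
      proof (cases "x \<in> ball y \<delta>")
        case True
        then have dx: "dist x y < \<delta>" by (simp add: dist_commute)
        have "c0 \<le> \<sigma> * (V x \<bullet> (c - x))" using \<delta>1(2)[of x] dx \<delta> by simp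
        then have b4: "(4 * t * w x) * (\<sigma> * (V x \<bullet> (c - x))) \<ge> (4 * t * w x) * c0"
          using t w(3) by (intro mult_left_mono) auto
        have "t \<le> \<delta> * (1 + 2 * r)" using s_small[OF dx] \<delta> by (simp add: t_def r_def)
        then have "t * (M + p) \<le> \<delta> * (1 + 2 * r) * (M + p)" using M p by (intro mult_right_mono) auto
        also have "\<dots> \<le> c0" using \<delta>c by (simp add: mult.assoc)
        finally have "(t * w x) * (t * (M + p)) \<le> (t * w x) * c0" using t w(3) by (intro mult_left_mono) auto
        then have b5: "w x * t\<^sup>2 * M + t\<^sup>2 * (p * w x) \<le> t * w x * c0"
          by (simp add: power2_eq_square algebra_simps)
        \<comment> \<open>One quarter of the main term \<open>4 * t * w x * c0\<close> absorbs the
          terms in \<open>b5\<close>; the other three quarters suffice here because \<open>t\<close>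
          exceeds \<open>\<eta> / 2\<close> on the small ball.\<close>
        have b6: "c0 * \<eta> * (indicator (ball y r1) x * w x) \<le> 3 * (t * w x * c0)"
        proof (cases "x \<in> ball y r1")
          case True
          then have "\<eta> \<le> 2 * t" using r1(2)[of x] by (simp add: t_def)
          then have "\<eta> * (c0 * w x) \<le> 3 * t * (c0 * w x)" using t c0 w(3) by (intro mult_right_mono) auto
          then show ?thesis using True by (simp add: algebra_simps)
        next
          case False
          then show ?thesis using t c0 w(3) by simp
        qed
        have "0 \<le> C1 * (indicator K x * w x)" using C12 w(3) by simp
        then show ?thesis unfolding eq using b1 b2 b3 b4 b5 b6 by (simp add: algebra_simps)
      next
        case False
        then have nb: "x \<notin> ball y r1" using r1(3) by blast
        show ?thesis
        proof (cases "x \<in> K")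
          case True
          have "\<bar>\<sigma> * (V x \<bullet> (c - x))\<bar> \<le> M" using M(3)[OF x\<Omega>] by (simp add: abs_mult \<sigma>)
          then have b4: "(4 * t * w x) * (\<sigma> * (V x \<bullet> (c - x))) \<ge> (4 * t * w x) * - M"
            using t w(3) by (intro mult_left_mono) auto
          have "t * (4 * M) \<le> R * (4 * M)" "t\<^sup>2 * (M + p) \<le> R\<^sup>2 * (M + p)"
            using t t2 M p by (auto intro!: mult_right_mono)
          then have "(t * (4 * M) + t\<^sup>2 * (M + p)) * w x \<le> C1 * w x"
            unfolding C1_def by (intro mult_right_mono[OF add_mono wn])
          then show ?thesis unfolding eq using b1 b2 b3 b4 True nb by (simp add: algebra_simps)
        next
          case nK: False
          then have "sqrt R < norm (x - c)" using False by (simp add: K_def dist_norm norm_minus_commute)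
          then have "s x \<le> 0" using R by (simp add: s_eq real_less_lsqrt less_imp_le real_sqrt_less_iff sqrt_le_D)
          then have "t = 0" by (simp add: t_def)
          then show ?thesis using nb nK C12 G0 by (simp add: Ix)
        qed
      qed
    qed
    have iw: "integrable lborel (\<lambda>x. indicator (ball y r1) x * w x)" "integrable lborel (\<lambda>x. indicator K x * w x)"
      unfolding w_def by (rule test_function_abs_powr(4,5)[OF u p] K)+
    have "c0 * \<eta> * (LINT x|lborel. indicator (ball y r1) x * w x)
        = (LINT x|lborel. c0 * \<eta> * (indicator (ball y r1) x * w x))" by simp
    also have "\<dots> \<le> (LINT x|lborel. \<sigma> * I x + C1 * (indicator K x * w x) + C2 * G x)"
      using iw iI iG by (intro integral_mono pointwise Bochner_Integration.integrable_add integrable_mult_right) auto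
    also have "\<dots> = \<sigma> * 0 + C1 * (LINT x|lborel. indicator K x * w x) + C2 * (LINT x|lborel. G x)"
      using iw iI iG by (simp add: int0)
    also have "\<dots> \<le> C1 * (CK * vf_energy p X u) + C2 * vf_energy p X u"
      using CK(2)[OF u] C12 by (simp add: G_def[abs_def] vf_energy_def w_def mult_left_mono)
    finally have "(LINT x|lborel. indicator (ball y r1) x * w x) * (c0 * \<eta>) \<le> (C1 * CK + C2) * vf_energy p X u"
      by (simp add: algebra_simps)
    then show "(LINT x|lborel. indicator (ball y r1) x * \<bar>u x\<bar> powr p)
        \<le> (C1 * CK + C2) / (c0 * \<eta>) * vf_energy p X u"
      using c0 \<eta> by (simp add: w_def pos_le_divide_eq)
  qed
qed

lemma poincare_test_functions:
  assumes span: "commutators_span X U s"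
  obtains C where "C > 0" "\<And>u. u \<in> test_functions \<Omega> \<Longrightarrow>
    (LINT x|lborel. \<bar>u x\<bar> powr p) \<le> C * vf_energy p X u"
proof -
  define S where "S = {x. \<not> dominated x}"
  have S\<Omega>: "S \<subseteq> closure \<Omega>" using dominated_outside by (auto simp: S_def)
  have "open (- S)"
    unfolding open_contains_ball
  proof
    fix x assume "x \<in> - S"
    then have "dominated x" by (simp add: S_def)
    then obtain r where "r > 0" "\<And>y. y \<in> ball x r \<Longrightarrow> dominated y" by (rule dominated_ball) blast
    then show "\<exists>e>0. ball x e \<subseteq> - S" by (auto simp: S_def)
  qed
  then have "compact S" using S\<Omega> closure_\<Omega>(1) by (metis closed_def compact_Int_closed inf.absorb2)
  moreover have "S \<subseteq> U" using S\<Omega> closure_\<Omega>(2) by blast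
  moreover have "proximally_tangent S (X i)" for i
    unfolding proximally_tangent_def
  proof (intro ballI allI impI)
    fix y z assume "y \<in> S" "\<forall>x\<in>S. dist z y \<le> dist z x"
    then show "X i y \<bullet> (z - y) = 0"
      using dominated_propagation[of y z i] \<open>S \<subseteq> U\<close> by (auto simp: S_def)
  qed
  ultimately have "S = {}" using hormander_no_tangent_compact[OF open_U _ _ smooth_X _ span] by blast
  then have "dominated x" for x by (auto simp: S_def)
  then obtain C where C: "C \<ge> 0" "\<And>u. u \<in> test_functions \<Omega> \<Longrightarrow>
     (LINT y|lborel. indicator (closure \<Omega>) y * \<bar>u y\<bar> powr p) \<le> C * vf_energy p X u"
    using dominated_compact[OF closure_\<Omega>(1)] by blast
  show thesis
  \<comment> \<open>The constant from the covering may be 0; adding 1 makes it strictly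
    positive.\<close>
  proof (rule that[of "C + 1"])
    fix u assume u: "u \<in> test_functions \<Omega>"
    have "indicator (closure \<Omega>) y * \<bar>u y\<bar> powr p = \<bar>u y\<bar> powr p" for y
    proof (cases "y \<in> closure \<Omega>")
      case False
      then have ny: "y \<notin> closure {x. u x \<noteq> 0}"
        using test_functionsD(3)[OF u] closure_subset[of \<Omega>] by blast
      show ?thesis by (simp add: test_functionsD(4)[OF u ny])
    qed simp
    then have "(\<lambda>y. indicator (closure \<Omega>) y * \<bar>u y\<bar> powr p) = (\<lambda>y. \<bar>u y\<bar> powr p)" by (rule ext)
    then have "(LINT x|lborel. \<bar>u x\<bar> powr p) \<le> C * vf_energy p X u" using C(2)[OF u] by (simp only:)
    also have "\<dots> \<le> (C + 1) * vf_energy p X u" by (intro mult_right_mono) auto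
    finally show "(LINT x|lborel. \<bar>u x\<bar> powr p) \<le> (C + 1) * vf_energy p X u" .
  qed (use C in simp)
qed

end

section \<open>Weak derivatives and Sobolev functions\<close>

text \<open>Boxes form an intersection-stable generator of the Borel sets, so Dynkin's argument
  makes the integral of \<open>f\<close> over every Borel set vanish. The support in
  \<open>box a b\<close> is used twice: it reduces an arbitrary box to one inside
  \<open>box a b\<close>, and it makes the total integral 0, as complements require.\<close>

lemma AE_zero_if_box_integrals_zero:
  fixes f :: "'a::euclidean_space \<Rightarrow> real"
  assumes f: "integrable lborel f" and supp: "\<And>x. x \<notin> box a b \<Longrightarrow> f x = 0"
    and zero: "\<And>u v. box u v \<subseteq> box a b \<Longrightarrow> (LINT x:box u v|lborel. f x) = 0"
  shows "AE x in lborel. f x = 0"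
proof -
  have total: "(LINT x|lborel. f x) = 0"
  proof -
    have "(\<lambda>x. indicator (box a b) x *\<^sub>R f x) = f"
      using supp by (auto simp: fun_eq_iff indicator_def)
    then show ?thesis using zero[of a b] by (simp add: set_lebesgue_integral_def)
  qed
  have si: "set_integrable lborel A f" if "A \<in> sets borel" for A
    unfolding set_integrable_def using f that by (intro integrable_mult_indicator) auto
  have "(LINT x:A|lborel. f x) = 0" if "A \<in> sets borel" for A
  proof -
    define G where "G = range (\<lambda>(u, v). box u v :: 'a set)"
    have bG: "sets (borel :: 'a measure) = sigma_sets UNIV G"
      unfolding G_def by (subst borel_eq_box) simp
    have A: "A \<in> sigma_sets UNIV G" using that bG by simp
    have stable: "Int_stable G"
    proof (rule Int_stableI)
      fix B C assume "B \<in> G" "C \<in> G"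
      then obtain u v u' v' where "B = box u v" "C = box u' v'" unfolding G_def by force
      then obtain p q where "B \<inter> C = box p q" using box_Int_box by blast
      then show "B \<inter> C \<in> G" unfolding G_def by (intro range_eqI[where x = "(p, q)"]) simp
    qed
    have sets: "B \<in> sets borel" if "B \<in> sigma_sets UNIV G" for B
      using that bG by simp
    have "G \<subseteq> Pow UNIV" by simp
    with stable show ?thesis using A
    proof (induction A rule: sigma_sets_induct_disjoint)
      case (basic A)
      then obtain u v where A: "A = box u v" by (auto simp: G_def)
      obtain u' v' where uv: "box u v \<inter> box a b = box u' v'" using box_Int_box by blast
      have "indicator (box u v) x *\<^sub>R f x = indicator (box u' v') x *\<^sub>R f x" for x
        using supp[of x] uv by (auto simp: indicator_def)
      then have "(LINT x:A|lborel. f x) = (LINT x:box u' v'|lborel. f x)"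
        unfolding A set_lebesgue_integral_def by (rule Bochner_Integration.integral_cong[OF refl])
      then show ?case using zero[of u' v'] uv by auto
    next
      case empty
      then show ?case by (simp add: set_lebesgue_integral_def)
    next
      case (compl A)
      have "A \<in> sets borel" using sets compl.hyps by simp
      have "(LINT x:UNIV - A|lborel. f x) = (LINT x|lborel. f x - indicator A x *\<^sub>R f x)"
        unfolding set_lebesgue_integral_def
        by (intro Bochner_Integration.integral_cong) (auto simp: indicator_def)
      also have "\<dots> = (LINT x|lborel. f x) - (LINT x:A|lborel. f x)"
        using f si[OF \<open>A \<in> sets borel\<close>] by (simp add: set_lebesgue_integral_def set_integrable_def)
      finally show ?case using total compl by simp
    next
      case (union A)
      have "(LINT x:(\<Union>i. A i)|lborel. f x) = (\<Sum>i. LINT x:A i|lborel. f x)"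
        using union sets by (intro lebesgue_integral_countable_add si)
          (auto simp: disjoint_family_on_def image_subset_iff)
      then show ?case using union by simp
    qed
  qed
  then have "AE x in lborel. f x = (\<lambda>x. 0) x"
    using f by (intro density_unique_real) auto
  then show ?thesis by simp
qed

text \<open>As \<open>c\<close> tends to 0 these test functions converge to the indicator of the box, so no mollifiers
  are needed.\<close>

definition box_bump :: "real \<Rightarrow> real^'n::finite \<Rightarrow> real^'n \<Rightarrow> real^'n \<Rightarrow> real" where
  "box_bump c u v x = (\<Prod>k\<in>UNIV. flat_exp c 0 (x $ k - u $ k) * flat_exp c 0 (v $ k - x $ k))"

lemma flat_exp_0_bounds: "c > 0 \<Longrightarrow> 0 \<le> flat_exp c 0 t" "c > 0 \<Longrightarrow> flat_exp c 0 t \<le> 1"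
  by (auto simp: flat_exp_def)

lemma flat_exp_eq_0_iff: "flat_exp c 0 t = 0 \<longleftrightarrow> t \<le> 0"
  by (auto simp: flat_exp_def)

lemma box_bump_bounds:
  assumes "c > 0"
  shows "0 \<le> box_bump c u v x" "box_bump c u v x \<le> 1" "box_bump c u v x = 0 \<longleftrightarrow> x \<notin> box u v"
proof -
  show "0 \<le> box_bump c u v x"
    unfolding box_bump_def using flat_exp_0_bounds[OF assms] by (intro prod_nonneg mult_nonneg_nonneg) auto
  show "box_bump c u v x \<le> 1"
    unfolding box_bump_def using flat_exp_0_bounds[OF assms]
    by (intro prod_le_1 conjI mult_nonneg_nonneg mult_le_one) auto
  show "box_bump c u v x = 0 \<longleftrightarrow> x \<notin> box u v"
    by (auto simp: box_bump_def flat_exp_eq_0_iff mem_box_cart not_less)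
qed

lemma box_bump_test_function:
  assumes "c > 0" "cbox u v \<subseteq> \<Omega>"
  shows "box_bump c u v \<in> test_functions \<Omega>"
proof -
  have "Ck_on r UNIV (box_bump c u v)" for r
    unfolding box_bump_def[abs_def]
    by (intro Ck_on_prod Ck_on_mult Ck_on_flat_exp Ck_on_diff Ck_on_component Ck_on_const assms open_UNIV)
  moreover have sub: "{x. box_bump c u v x \<noteq> 0} \<subseteq> cbox u v"
    using box_bump_bounds(3)[OF assms(1)] box_subset_cbox by blast
  moreover have "closure {x. box_bump c u v x \<noteq> 0} \<subseteq> cbox u v"
    by (rule closure_minimal[OF sub closed_cbox])
  ultimately show ?thesis
    using assms(2) bounded_subset[OF bounded_cbox sub]
    by (auto simp: test_functions_def smooth_fun_on_def compactly_inside_def compact_closure)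
qed

lemma box_bump_tendsto_indicator:
  "(\<lambda>j. box_bump (inverse (real (Suc j))) u v x) \<longlonglongrightarrow> indicator (box u v) x"
proof (cases "x \<in> box u v")
  case False
  then have "box_bump (inverse (real (Suc j))) u v x = 0" for j
    by (subst box_bump_bounds(3)) auto
  then show ?thesis using False by simp
next
  case True
  have "(\<lambda>j. flat_exp (inverse (real (Suc j))) 0 t) \<longlonglongrightarrow> 1" if "t > 0" for t
  proof -
    have "(\<lambda>j. exp (- (inverse (real (Suc j)) / t))) \<longlonglongrightarrow> exp (- (0 / t))"
      using that by (intro tendsto_intros LIMSEQ_inverse_real_of_nat) auto
    then show ?thesis using that by (simp add: flat_exp_def)
  qed
  then have "(\<lambda>j. box_bump (inverse (real (Suc j))) u v x) \<longlonglongrightarrow> (\<Prod>k\<in>(UNIV :: 'a set). 1 * 1)"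
    unfolding box_bump_def using True by (intro tendsto_prod tendsto_mult) (auto simp: mem_box_cart)
  then show ?thesis using True by simp
qed

section \<open>The fundamental lemma of the calculus of variations\<close>

lemma L1_loc_integrable_indicator:
  assumes "L1_loc \<Omega> f" "compact K" "K \<subseteq> \<Omega>"
  shows "integrable lebesgue (\<lambda>x. indicator K x * f x)"
proof -
  have "integrable (lebesgue_on K) f" using assms by (auto simp: L1_loc_def)
  moreover have "K \<in> sets lebesgue" using assms(2) by (simp add: borel_compact)
  ultimately show ?thesis by (simp add: integrable_restrict_space)
qed

lemma L1_loc_mult_integrable:
  assumes \<Omega>: "open \<Omega>" and f: "L1_loc \<Omega> f" and h: "continuous_on UNIV h"
    and K: "compact K" "K \<subseteq> \<Omega>" "\<And>x. x \<notin> K \<Longrightarrow> h x = 0"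
  shows "integrable (lebesgue_on \<Omega>) (\<lambda>x. f x * h x)"
proof -
  have "bounded (h ` K)"
    using K(1) h by (intro compact_imp_bounded compact_continuous_image) (auto intro: continuous_on_subset)
  then obtain B where B: "\<And>x. x \<in> K \<Longrightarrow> \<bar>h x\<bar> \<le> B" "B > 0" unfolding bounded_pos by auto
  have hB: "\<bar>h x\<bar> \<le> B" for x
  proof (cases "x \<in> K")
    case False
    then show ?thesis using B(2) K(3)[OF False] by simp
  qed (rule B)
  have i: "integrable lebesgue (\<lambda>x. indicator K x * f x)" by (rule L1_loc_integrable_indicator[OF f K(1,2)])
  have "h \<in> borel_measurable lebesgue"
    using borel_measurable_continuous_onI[OF h] by (simp add: measurable_completion)
  then have "integrable lebesgue (\<lambda>x. h x * (indicator K x * f x))"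
    using hB borel_measurable_times[OF _ borel_measurable_integrable[OF i], of h]
    by (intro Bochner_Integration.integrable_bound[OF integrable_mult_right[OF i, of B]])
      (auto simp: abs_mult intro!: mult_right_mono order_trans[OF hB] abs_ge_self)
  moreover have "h x * (indicator K x * f x) = indicator \<Omega> x *\<^sub>R (f x * h x)" for x
    using K(2) K(3)[of x] by (auto simp: indicator_def)
  ultimately show ?thesis using \<Omega> by (simp add: integrable_restrict_space)
qed

text \<open>Bumps converging to the indicator of a box turn the hypothesis into vanishing integrals
  over boxes, which determine the function locally; countably many boxes then exhaust
  \<open>\<Omega>\<close>.\<close>

lemma AE_zero_if_test_integrals_zero:
  fixes \<Omega> :: "(real^'n::finite) set"
  assumes \<Omega>: "open \<Omega>" and d: "L1_loc \<Omega> d"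
    and zero: "\<And>\<theta>. \<theta> \<in> test_functions \<Omega> \<Longrightarrow> (LINT x|lebesgue_on \<Omega>. d x * \<theta> x) = 0"
  shows "AE x in lebesgue_on \<Omega>. d x = 0"
proof -
  have sO: "\<Omega> \<in> sets lebesgue" using \<Omega> by simp
  have ib: "indicator (box u v) \<in> borel_measurable lebesgue" for u v :: "real^'n"
    by (intro borel_measurable_indicator fmeasurableD lmeasurable_box)
  have step: "(LINT x|lebesgue. indicator (box u v) x * d x) = 0" if uv: "cbox u v \<subseteq> \<Omega>" for u v
  proof -
    have i: "integrable lebesgue (\<lambda>x. indicator (cbox u v) x * d x)"
      by (rule L1_loc_integrable_indicator[OF d compact_cbox uv])
    let ?\<theta> = "\<lambda>j. box_bump (inverse (real (Suc j))) u v"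
    have t: "?\<theta> j \<in> test_functions \<Omega>" for j using uv by (intro box_bump_test_function) auto
    have eq: "?\<theta> j x * (indicator (cbox u v) x * d x) = indicator \<Omega> x *\<^sub>R (d x * ?\<theta> j x)" for j x
      using uv box_bump_bounds(3)[of "inverse (real (Suc j))" u v x] box_subset_cbox[of u v]
      by (auto simp: indicator_def)
    have m: "?\<theta> j \<in> borel_measurable lebesgue" for j
      using test_functionsD(1)[OF t, of 0 j]
      by (intro measurable_completion) (simp add: borel_measurable_continuous_onI)
    have "(\<lambda>j. LINT x|lebesgue. ?\<theta> j x * (indicator (cbox u v) x * d x))
        \<longlonglongrightarrow> (LINT x|lebesgue. indicator (box u v) x * (indicator (cbox u v) x * d x))"
    proof (rule integral_dominated_convergence[where w = "\<lambda>x. norm (indicator (cbox u v) x * d x)"])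
      show "(\<lambda>x. indicator (box u v) x * (indicator (cbox u v) x * d x)) \<in> borel_measurable lebesgue"
        by (rule borel_measurable_times[OF ib borel_measurable_integrable[OF i]])
      show "(\<lambda>x. ?\<theta> j x * (indicator (cbox u v) x * d x)) \<in> borel_measurable lebesgue" for j
        by (rule borel_measurable_times[OF m borel_measurable_integrable[OF i]])
      show "integrable lebesgue (\<lambda>x. norm (indicator (cbox u v) x * d x))" using i by (rule integrable_norm)
      show "AE x in lebesgue. (\<lambda>j. ?\<theta> j x * (indicator (cbox u v) x * d x))
          \<longlonglongrightarrow> indicator (box u v) x * (indicator (cbox u v) x * d x)"
        by (intro AE_I2 tendsto_mult box_bump_tendsto_indicator tendsto_const)
      show "AE x in lebesgue. norm (?\<theta> j x * (indicator (cbox u v) x * d x))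
          \<le> norm (indicator (cbox u v) x * d x)" for j
        using box_bump_bounds(1,2)[of "inverse (real (Suc j))" u v]
        by (intro AE_I2) (auto simp: norm_mult abs_mult intro!: mult_left_le_one_le)
    qed
    moreover have "(LINT x|lebesgue. ?\<theta> j x * (indicator (cbox u v) x * d x)) = 0" for j
      unfolding eq using zero[OF t[of j]] sO by (simp add: integral_restrict_space)
    moreover have "indicator (box u v) x * (indicator (cbox u v) x * d x) = indicator (box u v) x * d x" for x
      using box_subset_cbox[of u v] by (auto simp: indicator_def)
    ultimately show ?thesis by (simp add: LIMSEQ_const_iff)
  qed
  have on_box: "AE x in lebesgue. x \<in> box a b \<longrightarrow> d x = 0" if ab: "cbox a b \<subseteq> \<Omega>" for a b
  proof -
    define d0 where "d0 x = indicator (box a b) x * d x" for x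
    have d0: "d0 = (\<lambda>x. indicator (box a b) x *\<^sub>R (indicator (cbox a b) x * d x))"
      using box_subset_cbox[of a b] by (auto simp: d0_def fun_eq_iff indicator_def)
    have i0: "integrable lebesgue d0"
      unfolding d0 by (intro integrable_mult_indicator fmeasurableD lmeasurable_box
          L1_loc_integrable_indicator[OF d compact_cbox ab])
    \<comment> \<open>The Dynkin argument lives on Borel sets, so \<open>d0\<close> is replaced by a
      Borel function equal to it almost everywhere, which is then cut off again to vanish off the
      box.\<close>
    then obtain d1 where d1: "d1 \<in> borel_measurable lborel" "AE x in lborel. d0 x = d1 x"
      using completion_ex_borel_measurable_real[of d0 lborel] by auto
    define f where "f x = indicator (box a b) x * d1 x" for x
    have mf: "f \<in> borel_measurable lborel" unfolding f_def using d1(1) by simp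
    have "AE x in lborel. d0 x = f x"
      using d1(2) by eventually_elim (auto simp: f_def d0_def indicator_def)
    then have f0: "AE x in lebesgue. d0 x = f x" by (rule AE_completion)
    have mf': "f \<in> borel_measurable lebesgue" using mf by (rule measurable_completion)
    have "integrable lebesgue f"
      using integrable_cong_AE_imp[OF i0 mf'] f0 by (auto elim: eventually_mono)
    then have fi: "integrable lborel f" using mf by (simp add: integrable_completion)
    have "AE x in lborel. f x = 0"
    proof (rule AE_zero_if_box_integrals_zero[OF fi])
      show "f x = 0" if "x \<notin> box a b" for x using that by (simp add: f_def)
      fix u v assume sub: "box u v \<subseteq> box a b"
      show "(LINT x:box u v|lborel. f x) = 0"
      proof (cases "box u v = {}")
        case False
        then have "closure (box u v) = cbox u v" "closure (box a b) = cbox a b"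
          using sub by (intro closure_box; blast)+
        then have "cbox u v \<subseteq> \<Omega>" using closure_mono[OF sub] ab by simp
        have "(LINT x:box u v|lborel. f x) = (LINT x|lebesgue. indicator (box u v) x * f x)"
          unfolding set_lebesgue_integral_def using mf by (subst integral_completion) auto
        also have "\<dots> = (LINT x|lebesgue. indicator (box u v) x * d x)"
        proof (rule integral_cong_AE)
          show "(\<lambda>x. indicator (box u v) x * f x) \<in> borel_measurable lebesgue"
            by (rule borel_measurable_times[OF ib mf'])
          have "(\<lambda>x. indicator (box u v) x * d0 x) \<in> borel_measurable lebesgue"
            by (rule borel_measurable_times[OF ib borel_measurable_integrable[OF i0]])
          moreover have "(\<lambda>x. indicator (box u v) x * d0 x) = (\<lambda>x. indicator (box u v) x * d x)"
            using sub by (auto simp: d0_def fun_eq_iff indicator_def)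
          ultimately show "(\<lambda>x. indicator (box u v) x * d x) \<in> borel_measurable lebesgue" by simp
          show "AE x in lebesgue. indicator (box u v) x * f x = indicator (box u v) x * d x"
            using f0 by eventually_elim (use sub in \<open>auto simp: d0_def indicator_def split: if_splits\<close>)
        qed
        also have "\<dots> = 0" by (rule step[OF \<open>cbox u v \<subseteq> \<Omega>\<close>])
        finally show ?thesis .
      qed (simp add: set_lebesgue_integral_def)
    qed
    then have "AE x in lebesgue. f x = 0" by (rule AE_completion)
    with f0 show ?thesis by eventually_elim (auto simp: d0_def)
  qed
  obtain \<D> where \<D>: "countable \<D>" "\<D> \<subseteq> Pow \<Omega>" "\<And>B. B \<in> \<D> \<Longrightarrow> \<exists>a b. B = cbox a b" "\<Union>\<D> = \<Omega>"
    using open_countable_Union_open_cbox[OF \<Omega>] by metis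
  have "AE x in lebesgue. x \<in> B \<longrightarrow> d x = 0" if BD: "B \<in> \<D>" for B
  proof -
    obtain a b where B: "B = cbox a b" using \<D>(3)[OF BD] by blast
    have "AE x in lebesgue. x \<in> box a b \<longrightarrow> d x = 0" using \<D>(2) BD B by (intro on_box) auto
    \<comment> \<open>The covering consists of closed boxes, whereas \<open>on_box\<close> speaks of
      open ones; the faces are a null set.\<close>
    moreover have "AE x in lebesgue. x \<notin> cbox a b - box a b"
      using negligible_frontier_interval[of a b] by (intro AE_not_in) (simp add: negligible_iff_null_sets)
    ultimately show ?thesis by eventually_elim (auto simp: B)
  qed
  then have "AE x in lebesgue. \<forall>B\<in>\<D>. x \<in> B \<longrightarrow> d x = 0"
    using \<D>(1) by (intro AE_ball_countable')
  then have "AE x in lebesgue. x \<in> \<Omega> \<longrightarrow> d x = 0"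
    by eventually_elim (use \<D>(4) in blast)
  then show ?thesis using sO by (simp add: AE_restrict_space_iff)
qed

section \<open>Elementary L^p inequalities and comparison of measures\<close>

lemma powr_add_le:
  fixes a b :: real
  assumes "0 \<le> a" "0 \<le> b" "0 < p"
  shows "(a + b) powr p \<le> 2 powr p * (a powr p + b powr p)"
proof -
  have "(a + b) powr p \<le> (2 * max a b) powr p" using assms by (intro powr_mono2) auto
  also have "\<dots> = 2 powr p * max a b powr p" using assms by (simp add: powr_mult)
  also have "max a b powr p \<le> a powr p + b powr p" by (simp add: max_def)
  finally show ?thesis by simp
qed

lemma powr_sum_le:
  fixes a :: "'i \<Rightarrow> real"
  assumes "finite I" "\<And>i. i \<in> I \<Longrightarrow> 0 \<le> a i" "0 < p"
  shows "(\<Sum>i\<in>I. a i) powr p \<le> real (card I) powr p * (\<Sum>i\<in>I. a i powr p)"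
proof -
  \<comment> \<open>The l^p norm of the family: it dominates each entry, so the sum is at most
    \<open>M\<close> times the number of entries.\<close>
  define M where "M = (\<Sum>i\<in>I. a i powr p) powr (1 / p)"
  have "a i \<le> M" if "i \<in> I" for i
  proof -
    have "a i = (a i powr p) powr (1 / p)" using assms that by (simp add: powr_powr)
    also have "\<dots> \<le> M" unfolding M_def
      using assms that by (intro powr_mono2 member_le_sum) auto
    finally show ?thesis .
  qed
  then have "(\<Sum>i\<in>I. a i) \<le> real (card I) * M" using sum_bounded_above[of I a M] by simp
  then have "(\<Sum>i\<in>I. a i) powr p \<le> (real (card I) * M) powr p"
    using assms by (intro powr_mono2 sum_nonneg) auto
  also have "\<dots> = real (card I) powr p * M powr p" by (simp add: powr_mult M_def)
  also have "M powr p = (\<Sum>i\<in>I. a i powr p)"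
    using assms by (simp add: M_def powr_powr sum_nonneg)
  finally show ?thesis .
qed

lemma Lp_fun_diff:
  assumes "f \<in> Lp_fun p \<Omega>" "g \<in> Lp_fun p \<Omega>" "0 < p"
  shows "(\<lambda>x. f x - g x) \<in> Lp_fun p \<Omega>"
proof -
  have m: "f \<in> borel_measurable (lebesgue_on \<Omega>)" "g \<in> borel_measurable (lebesgue_on \<Omega>)"
    and i: "integrable (lebesgue_on \<Omega>) (\<lambda>x. \<bar>f x\<bar> powr p)" "integrable (lebesgue_on \<Omega>) (\<lambda>x. \<bar>g x\<bar> powr p)"
    using assms by (auto simp: Lp_fun_def)
  have "\<bar>f x - g x\<bar> powr p \<le> 2 powr p * (\<bar>f x\<bar> powr p + \<bar>g x\<bar> powr p)" for x
  proof -
    have "\<bar>f x - g x\<bar> powr p \<le> (\<bar>f x\<bar> + \<bar>g x\<bar>) powr p" using assms by (intro powr_mono2) auto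
    also have "\<dots> \<le> 2 powr p * (\<bar>f x\<bar> powr p + \<bar>g x\<bar> powr p)" using assms by (intro powr_add_le) auto
    finally show ?thesis .
  qed
  then have b: "norm (\<bar>f x - g x\<bar> powr p) \<le> norm (2 powr p * (\<bar>f x\<bar> powr p + \<bar>g x\<bar> powr p))" for x
    by (metis abs_of_nonneg norm_ge_zero powr_ge_zero real_norm_def order_trans abs_ge_self)
  have md: "(\<lambda>x. f x - g x) \<in> borel_measurable (lebesgue_on \<Omega>)" using m by (rule borel_measurable_diff)
  then have "(\<lambda>x. \<bar>f x - g x\<bar> powr p) \<in> borel_measurable (lebesgue_on \<Omega>)"
    by (intro powr_real_measurable borel_measurable_abs) auto
  then have "integrable (lebesgue_on \<Omega>) (\<lambda>x. \<bar>f x - g x\<bar> powr p)"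
    using b by (intro Bochner_Integration.integrable_bound[OF integrable_mult_right[OF
          Bochner_Integration.integrable_add[OF i], of "2 powr p"]]) auto
  with md show ?thesis by (simp add: Lp_fun_def)
qed

lemma Lp_fun_cong_AE:
  assumes "f \<in> Lp_fun p \<Omega>" "g \<in> borel_measurable (lebesgue_on \<Omega>)"
    and "AE x in lebesgue_on \<Omega>. f x = g x"
  shows "g \<in> Lp_fun p \<Omega>"
proof -
  have i: "integrable (lebesgue_on \<Omega>) (\<lambda>x. \<bar>f x\<bar> powr p)" using assms by (simp add: Lp_fun_def)
  have "(\<lambda>x. \<bar>g x\<bar> powr p) \<in> borel_measurable (lebesgue_on \<Omega>)"
    using assms(2) by (intro powr_real_measurable borel_measurable_abs) auto
  moreover have "AE x in lebesgue_on \<Omega>. \<bar>f x\<bar> powr p = \<bar>g x\<bar> powr p"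
    using assms(3) by eventually_elim simp
  ultimately have "integrable (lebesgue_on \<Omega>) (\<lambda>x. \<bar>g x\<bar> powr p)"
    using i by (rule integrable_cong_AE_imp[rotated])
  with assms(2) show ?thesis by (simp add: Lp_fun_def)
qed

lemma L1_loc_diff:
  assumes "L1_loc \<Omega> f" "L1_loc \<Omega> g"
  shows "L1_loc \<Omega> (\<lambda>x. f x - g x)"
  using assms unfolding L1_loc_def by (auto intro: borel_measurable_diff Bochner_Integration.integrable_diff)

lemma continuous_borel_measurable_lebesgue_on:
  fixes f :: "'a::euclidean_space \<Rightarrow> real"
  assumes "continuous_on UNIV f"
  shows "f \<in> borel_measurable (lebesgue_on \<Omega>)"
  using borel_measurable_continuous_onI[OF assms]
  by (intro measurable_restrict_space1 measurable_completion) simp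

lemma L1_loc_continuous:
  assumes "continuous_on UNIV f"
  shows "L1_loc \<Omega> f"
  unfolding L1_loc_def
proof (intro conjI allI impI)
  show "f \<in> borel_measurable (lebesgue_on \<Omega>)" by (rule continuous_borel_measurable_lebesgue_on[OF assms])
  fix K assume K: "compact K \<and> K \<subseteq> \<Omega>"
  then have "integrable lborel (\<lambda>x. indicator K x *\<^sub>R f x)"
    using assms by (intro borel_integrable_compact) (auto intro: continuous_on_subset)
  then have "integrable lebesgue (\<lambda>x. indicator K x *\<^sub>R f x)"
    by (subst integrable_completion) auto
  then show "integrable (lebesgue_on K) f"
    using K by (subst integrable_restrict_space) (auto simp: borel_compact)
qed

text \<open>A bridge between two settings: the function spaces are defined with
  \<open>lebesgue_on\<close>, while the divergence theorem is stated for
  \<open>lborel\<close>.\<close>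

lemma integral_lebesgue_on_lborel:
  fixes f :: "'a::euclidean_space \<Rightarrow> real"
  assumes "open \<Omega>" "f \<in> borel_measurable borel" "\<And>x. x \<notin> \<Omega> \<Longrightarrow> f x = 0"
  shows "(LINT x|lebesgue_on \<Omega>. f x) = (LINT x|lborel. f x)"
    and "integrable (lebesgue_on \<Omega>) f \<longleftrightarrow> integrable lborel f"
proof -
  have e: "(\<lambda>x. indicator \<Omega> x *\<^sub>R f x) = f"
    using assms(3) by (auto simp: fun_eq_iff indicator_def)
  have s: "\<Omega> \<inter> space lebesgue \<in> sets lebesgue" using assms(1) by simp
  show "(LINT x|lebesgue_on \<Omega>. f x) = (LINT x|lborel. f x)"
    unfolding integral_restrict_space[OF s] e using assms(2) by (intro integral_completion) simp
  show "integrable (lebesgue_on \<Omega>) f \<longleftrightarrow> integrable lborel f"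
    unfolding integrable_restrict_space[OF s] e using assms(2) by (intro integrable_completion) simp
qed

text \<open>The fundamental lemma applied to the difference. It makes the choice in
  \<open>weak_deriv_along\<close> harmless: the chosen function agrees almost everywhere with every
  other weak derivative.\<close>

lemma has_weak_deriv_along_unique:
  assumes \<Omega>: "open \<Omega>" and g: "has_weak_deriv_along \<Omega> V f g" "has_weak_deriv_along \<Omega> V f g'"
  shows "AE x in lebesgue_on \<Omega>. g x = g' x"
proof -
  have L: "L1_loc \<Omega> g" "L1_loc \<Omega> g'" using g by (auto simp: has_weak_deriv_along_def)
  have "AE x in lebesgue_on \<Omega>. g x - g' x = 0"
  proof (rule AE_zero_if_test_integrals_zero[OF \<Omega> L1_loc_diff[OF L]])
    fix \<theta> assume \<theta>: "\<theta> \<in> test_functions \<Omega>"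
    have c: "continuous_on UNIV \<theta>" using test_functionsD(1)[OF \<theta>, of 0] by simp
    note i = L1_loc_mult_integrable[OF \<Omega> _ c test_functionsD(2,3,4)[OF \<theta>]]
    have "(LINT x|lebesgue_on \<Omega>. (g x - g' x) * \<theta> x)
        = (LINT x|lebesgue_on \<Omega>. g x * \<theta> x) - (LINT x|lebesgue_on \<Omega>. g' x * \<theta> x)"
      unfolding left_diff_distrib by (rule Bochner_Integration.integral_diff[OF i[OF L(1)] i[OF L(2)]])
    also have "\<dots> = 0" using g \<theta> by (simp add: has_weak_deriv_along_def)
    finally show "(LINT x|lebesgue_on \<Omega>. (g x - g' x) * \<theta> x) = 0" .
  qed
  then show ?thesis by eventually_elim simp
qed

lemma weak_deriv_along_works:
  "has_weak_deriv_along \<Omega> V f g \<Longrightarrow> has_weak_deriv_along \<Omega> V f (weak_deriv_along \<Omega> V f)"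
  unfolding weak_deriv_along_def by (rule someI[of "has_weak_deriv_along \<Omega> V f"])

section \<open>Sobolev functions along the fields\<close>

context vector_fields_near
begin

lemma formal_adjoint_test_function:
  assumes \<theta>: "\<theta> \<in> test_functions \<Omega>"
  shows "x \<in> U \<Longrightarrow> formal_adjoint (X i) \<theta> x = - (vf_deriv (X i) \<theta> x + \<theta> x * vf_div (X i) x)"
    and "x \<notin> closure {x. \<theta> x \<noteq> 0} \<Longrightarrow> formal_adjoint (X i) \<theta> x = 0"
    and "continuous_on UNIV (formal_adjoint (X i) \<theta>)"
proof -
  show 1: "formal_adjoint (X i) \<theta> x = - (vf_deriv (X i) \<theta> x + \<theta> x * vf_div (X i) x)" if "x \<in> U" for x
  proof -
    have "(\<lambda>y. X i y $ k) differentiable (at x)" for k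
      using smooth_vector_field_onD[OF smooth_X[of i], of "Suc 0" k] that by simp
    moreover have "\<theta> differentiable (at x)" using test_functionsD(1)[OF \<theta>, of "Suc 0"] by simp
    ultimately have "partial_deriv k (\<lambda>y. X i y $ k * \<theta> y) x
        = X i x $ k * partial_deriv k \<theta> x + partial_deriv k (\<lambda>y. X i y $ k) x * \<theta> x" for k
      by (rule partial_deriv_mult)
    then show ?thesis
      by (simp add: formal_adjoint_def vf_deriv_def vf_div_def sum.distrib sum_distrib_left mult.commute)
  qed
  show 2: "formal_adjoint (X i) \<theta> x = 0" if "x \<notin> closure {x. \<theta> x \<noteq> 0}" for x
  proof -
    have "partial_deriv k (\<lambda>y. X i y $ k * \<theta> y) x = 0" for k
    proof (rule partial_deriv_zero_outside[OF closed_closure _ that])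
      fix y assume "y \<notin> closure {x. \<theta> x \<noteq> 0}"
      from test_functionsD(4)[OF \<theta> this] show "X i y $ k * \<theta> y = 0" by simp
    qed
    then show ?thesis by (simp add: formal_adjoint_def)
  qed
  have "continuous_on U (\<lambda>x. - (vf_deriv (X i) \<theta> x + \<theta> x * vf_div (X i) x))"
    using continuous_on_vf_deriv[OF smooth_X test_functionsD(1)[OF \<theta>]] continuous_on_vf_div[OF smooth_X]
      test_functionsD(1)[OF \<theta>, of 0]
    by (intro continuous_on_minus continuous_on_add continuous_on_mult) (auto intro: continuous_on_subset)
  then have "continuous_on U (formal_adjoint (X i) \<theta>)"
    by (rule continuous_on_eq) (simp add: 1)
  then show "continuous_on UNIV (formal_adjoint (X i) \<theta>)"
    by (rule continuous_on_zero_extension[OF open_U _ closed_closure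
          order_trans[OF test_functionsD(3)[OF \<theta>] \<Omega>_subset_U] 2])
qed

lemma has_weak_deriv_along_diff:
  assumes g: "has_weak_deriv_along \<Omega> (X i) f g" "has_weak_deriv_along \<Omega> (X i) f' g'"
  shows "has_weak_deriv_along \<Omega> (X i) (\<lambda>x. f x - f' x) (\<lambda>x. g x - g' x)"
proof -
  have L: "L1_loc \<Omega> f" "L1_loc \<Omega> f'" "L1_loc \<Omega> g" "L1_loc \<Omega> g'"
    using g by (auto simp: has_weak_deriv_along_def)
  have "(LINT x|lebesgue_on \<Omega>. (g x - g' x) * \<theta> x)
      = (LINT x|lebesgue_on \<Omega>. (f x - f' x) * formal_adjoint (X i) \<theta> x)"
    if \<theta>: "\<theta> \<in> test_functions \<Omega>" for \<theta>
  proof -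
    have c: "continuous_on UNIV \<theta>" using test_functionsD(1)[OF \<theta>, of 0] by simp
    note i = L1_loc_mult_integrable[OF open_\<Omega> _ c test_functionsD(2,3,4)[OF \<theta>]]
    note j = L1_loc_mult_integrable[OF open_\<Omega> _ formal_adjoint_test_function(3)[OF \<theta>]
        test_functionsD(2,3)[OF \<theta>] formal_adjoint_test_function(2)[OF \<theta>]]
    have "(LINT x|lebesgue_on \<Omega>. (g x - g' x) * \<theta> x)
        = (LINT x|lebesgue_on \<Omega>. g x * \<theta> x) - (LINT x|lebesgue_on \<Omega>. g' x * \<theta> x)"
      unfolding left_diff_distrib by (rule Bochner_Integration.integral_diff[OF i[OF L(3)] i[OF L(4)]])
    also have "\<dots> = (LINT x|lebesgue_on \<Omega>. f x * formal_adjoint (X i) \<theta> x)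
        - (LINT x|lebesgue_on \<Omega>. f' x * formal_adjoint (X i) \<theta> x)"
      using g \<theta> by (simp add: has_weak_deriv_along_def)
    also have "\<dots> = (LINT x|lebesgue_on \<Omega>. (f x - f' x) * formal_adjoint (X i) \<theta> x)"
      unfolding left_diff_distrib
      by (rule Bochner_Integration.integral_diff[OF j[OF L(1)] j[OF L(2)], symmetric])
    finally show ?thesis .
  qed
  then show ?thesis using L1_loc_diff[OF L(1,2)] L1_loc_diff[OF L(3,4)]
    by (simp add: has_weak_deriv_along_def)
qed

text \<open>Integration by parts: the divergence of \<open>\<phi> \<theta> X\<^sub>i\<close> is
  \<open>\<theta> X\<^sub>i \<phi>\<close> minus \<open>\<phi>\<close> times the formal adjoint
  applied to \<open>\<theta>\<close>.\<close>

lemma has_weak_deriv_along_test_function: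
  assumes \<phi>: "\<phi> \<in> test_functions \<Omega>"
  shows "has_weak_deriv_along \<Omega> (X i) \<phi> (vf_deriv (X i) \<phi>)"
proof -
  have c: "continuous_on UNIV \<phi>" using test_functionsD(1)[OF \<phi>, of 0] by simp
  note cv = vf_grad_test_function(1)[OF \<phi>]
  have "(LINT x|lebesgue_on \<Omega>. vf_deriv (X i) \<phi> x * \<theta> x)
      = (LINT x|lebesgue_on \<Omega>. \<phi> x * formal_adjoint (X i) \<theta> x)"
    if \<theta>: "\<theta> \<in> test_functions \<Omega>" for \<theta>
  proof -
    let ?S = "closure {x. \<theta> x \<noteq> 0}"
    note S = test_functionsD(2,3,4)[OF \<theta>]
    have SU: "?S \<subseteq> U" using S(2) \<Omega>_subset_U by blast
    have c\<theta>: "continuous_on UNIV \<theta>" using test_functionsD(1)[OF \<theta>, of 0] by simp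
    let ?l = "\<lambda>x. vf_deriv (X i) \<phi> x * \<theta> x" and ?r = "\<lambda>x. \<phi> x * formal_adjoint (X i) \<theta> x"
    have cl: "continuous_on UNIV ?l" by (intro continuous_on_mult cv c\<theta>)
    have cr: "continuous_on UNIV ?r" by (intro continuous_on_mult c formal_adjoint_test_function(3)[OF \<theta>])
    have l0: "?l x = 0" if "x \<notin> ?S" for x using S(3)[OF that] by simp
    have r0: "?r x = 0" if "x \<notin> ?S" for x using formal_adjoint_test_function(2)[OF \<theta> that] by simp
    have gC: "Ck_on (Suc 0) UNIV (\<lambda>x. \<phi> x * \<theta> x)"
      by (intro Ck_on_mult open_UNIV test_functionsD(1)[OF \<phi>] test_functionsD(1)[OF \<theta>])
    have g0: "\<phi> x * \<theta> x = 0" if "x \<notin> ?S" for x using S(3)[OF that] by simp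
    have "vf_deriv (X i) (\<lambda>x. \<phi> x * \<theta> x) x + \<phi> x * \<theta> x * vf_div (X i) x = ?l x - ?r x" for x
    proof (cases "x \<in> U")
      case True
      have "\<phi> differentiable (at x)" "\<theta> differentiable (at x)"
        using test_functionsD(1)[OF \<phi>, of "Suc 0"] test_functionsD(1)[OF \<theta>, of "Suc 0"] by simp_all
      then show ?thesis
        unfolding vf_deriv_mult[OF \<open>\<phi> differentiable (at x)\<close> \<open>\<theta> differentiable (at x)\<close>]
          formal_adjoint_test_function(1)[OF \<theta> True] by (simp add: algebra_simps)
    next
      case False
      then have "x \<notin> ?S" using SU by blast
      have "vf_deriv (X i) (\<lambda>x. \<phi> x * \<theta> x) x = 0"
        by (rule vf_deriv_zero_outside[OF closed_closure _ \<open>x \<notin> ?S\<close>]) (rule g0)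
      then show ?thesis
        using l0[OF \<open>x \<notin> ?S\<close>] r0[OF \<open>x \<notin> ?S\<close>] g0[OF \<open>x \<notin> ?S\<close>] by (simp only: mult_zero_left add_0_left diff_self)
    qed
    then have "(LINT x|lborel. ?l x - ?r x) = 0"
      using divergence_integral_eq_0[OF open_U smooth_X gC S(1) SU g0, of i] by simp
    moreover have "integrable lborel ?l"
      by (rule integrable_continuous_compact_support[OF cl S(1) l0])
    moreover have "integrable lborel ?r"
      by (rule integrable_continuous_compact_support[OF cr S(1) r0])
    ultimately have "(LINT x|lborel. ?l x) = (LINT x|lborel. ?r x)" by simp
    moreover have "(LINT x|lebesgue_on \<Omega>. ?l x) = (LINT x|lborel. ?l x)"
      using borel_measurable_continuous_onI[OF cl] l0 S(2)
      by (intro integral_lebesgue_on_lborel(1)[OF open_\<Omega>]) auto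
    moreover have "(LINT x|lebesgue_on \<Omega>. ?r x) = (LINT x|lborel. ?r x)"
      using borel_measurable_continuous_onI[OF cr] r0 S(2)
      by (intro integral_lebesgue_on_lborel(1)[OF open_\<Omega>]) auto
    ultimately show ?thesis by simp
  qed
  then show ?thesis using L1_loc_continuous[OF c] L1_loc_continuous[OF cv]
    by (simp add: has_weak_deriv_along_def)
qed

lemma test_function_Lp:
  assumes \<phi>: "\<phi> \<in> test_functions \<Omega>"
  shows "\<phi> \<in> Lp_fun p \<Omega>" "vf_deriv (X i) \<phi> \<in> Lp_fun p \<Omega>"
proof -
  let ?S = "closure {x. \<phi> x \<noteq> 0}"
  note S = test_functionsD(2,3)[OF \<phi>]
  have Lp: "f \<in> Lp_fun p \<Omega>" if c: "continuous_on UNIV f" and z: "\<And>x. x \<notin> ?S \<Longrightarrow> f x = 0" for f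
  proof -
    have c': "continuous_on UNIV (\<lambda>x. \<bar>f x\<bar> powr p)" using norm_powr_continuous[OF _ c] p by simp
    have z': "\<bar>f x\<bar> powr p = 0" if "x \<notin> ?S" for x using z[OF that] by simp
    have "integrable (lebesgue_on \<Omega>) (\<lambda>x. \<bar>f x\<bar> powr p)"
      using integrable_continuous_compact_support[OF c' S(1) z'] z' S(2)
        borel_measurable_continuous_onI[OF c']
      by (subst integral_lebesgue_on_lborel(2)[OF open_\<Omega>]) blast+
    then show ?thesis using continuous_borel_measurable_lebesgue_on[OF c] by (simp add: Lp_fun_def)
  qed
  show "\<phi> \<in> Lp_fun p \<Omega>"
    using test_functionsD(1)[OF \<phi>, of 0] by (intro Lp test_functionsD(4)[OF \<phi>]) auto
  show "vf_deriv (X i) \<phi> \<in> Lp_fun p \<Omega>"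
    by (intro Lp vf_grad_test_function(1)[OF \<phi>]
        vf_deriv_zero_outside[OF closed_closure test_functionsD(4)[OF \<phi>]])
qed

lemma test_function_W1p:
  "\<phi> \<in> test_functions \<Omega> \<Longrightarrow> \<phi> \<in> W1p p \<Omega> X"
  using test_function_Lp has_weak_deriv_along_test_function unfolding W1p_def by blast

text \<open>Membership provides some p-integrable weak derivative; the chosen one inherits
  integrability through uniqueness almost everywhere.\<close>

lemma W1p_weak_deriv:
  assumes "v \<in> W1p p \<Omega> X"
  shows "has_weak_deriv_along \<Omega> (X i) v (weak_deriv_along \<Omega> (X i) v)"
    and "weak_deriv_along \<Omega> (X i) v \<in> Lp_fun p \<Omega>"
proof -
  obtain g where g: "g \<in> Lp_fun p \<Omega>" "has_weak_deriv_along \<Omega> (X i) v g"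
    using assms by (auto simp: W1p_def)
  show w: "has_weak_deriv_along \<Omega> (X i) v (weak_deriv_along \<Omega> (X i) v)"
    by (rule weak_deriv_along_works[OF g(2)])
  have "weak_deriv_along \<Omega> (X i) v \<in> borel_measurable (lebesgue_on \<Omega>)"
    using w by (simp add: has_weak_deriv_along_def L1_loc_def)
  then show "weak_deriv_along \<Omega> (X i) v \<in> Lp_fun p \<Omega>"
    by (rule Lp_fun_cong_AE[OF g(1) _ has_weak_deriv_along_unique[OF open_\<Omega> g(2) w]])
qed

text \<open>The integral of a non-integrable function is 0 by convention, so this is what gives the
  norm, the energy and the quotients their intended meaning.\<close>

lemma W1p_integrable:
  assumes "v \<in> W1p p \<Omega> X"
  shows "integrable (lebesgue_on \<Omega>) (\<lambda>x. \<bar>v x\<bar> powr p)"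
    and "integrable (lebesgue_on \<Omega>) (\<lambda>x. norm (X_grad \<Omega> X v x) powr p)"
proof -
  show "integrable (lebesgue_on \<Omega>) (\<lambda>x. \<bar>v x\<bar> powr p)" using assms by (simp add: W1p_def Lp_fun_def)
  let ?g = "\<lambda>i. weak_deriv_along \<Omega> (X i) v"
  have m: "?g i \<in> borel_measurable (lebesgue_on \<Omega>)" "integrable (lebesgue_on \<Omega>) (\<lambda>x. \<bar>?g i x\<bar> powr p)" for i
    using W1p_weak_deriv(2)[OF assms, of i] by (auto simp: Lp_fun_def)
  have "norm (X_grad \<Omega> X v x) = sqrt (\<Sum>i\<in>UNIV. (?g i x)\<^sup>2)" for x
    by (simp add: norm_vec_def L2_set_def X_grad_def)
  then have "(\<lambda>x. norm (X_grad \<Omega> X v x)) \<in> borel_measurable (lebesgue_on \<Omega>)"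
    using m(1) by (simp add: borel_measurable_sqrt borel_measurable_sum borel_measurable_power)
  then have mp: "(\<lambda>x. norm (X_grad \<Omega> X v x) powr p) \<in> borel_measurable (lebesgue_on \<Omega>)"
    by (intro powr_real_measurable) auto
  have b: "norm (X_grad \<Omega> X v x) powr p \<le> real CARD('m) powr p * (\<Sum>i\<in>UNIV. \<bar>?g i x\<bar> powr p)" for x
  proof -
    have "norm (X_grad \<Omega> X v x) powr p \<le> (\<Sum>i\<in>UNIV. \<bar>?g i x\<bar>) powr p"
      using norm_le_l1_cart[of "X_grad \<Omega> X v x"] p by (intro powr_mono2) (auto simp: X_grad_def)
    also have "\<dots> \<le> real CARD('m) powr p * (\<Sum>i\<in>UNIV. \<bar>?g i x\<bar> powr p)"
      using p by (intro powr_sum_le) auto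
    finally show ?thesis .
  qed
  have "integrable (lebesgue_on \<Omega>) (\<lambda>x. real CARD('m) powr p * (\<Sum>i\<in>UNIV. \<bar>?g i x\<bar> powr p))"
    by (intro integrable_mult_right Bochner_Integration.integrable_sum m(2))
  then show "integrable (lebesgue_on \<Omega>) (\<lambda>x. norm (X_grad \<Omega> X v x) powr p)"
    by (rule Bochner_Integration.integrable_bound[OF _ mp])
      (use b in \<open>auto intro!: AE_I2 order_trans[OF _ abs_ge_self]\<close>)
qed

text \<open>The gradient of the difference is identified only almost everywhere, since
  \<open>X_grad\<close> chooses a representative anew for each function.\<close>

lemma X_grad_diff_test_function:
  assumes v: "v \<in> W1p p \<Omega> X" and \<phi>: "\<phi> \<in> test_functions \<Omega>"
  shows "(\<lambda>x. v x - \<phi> x) \<in> W1p p \<Omega> X"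
    and "AE x in lebesgue_on \<Omega>. X_grad \<Omega> X (\<lambda>x. v x - \<phi> x) x = X_grad \<Omega> X v x - vf_grad X \<phi> x"
proof -
  have w: "has_weak_deriv_along \<Omega> (X i) (\<lambda>x. v x - \<phi> x) (\<lambda>x. weak_deriv_along \<Omega> (X i) v x - vf_deriv (X i) \<phi> x)" for i
    by (rule has_weak_deriv_along_diff[OF W1p_weak_deriv(1)[OF v] has_weak_deriv_along_test_function[OF \<phi>]])
  have p0: "0 < p" using p by simp
  have "v \<in> Lp_fun p \<Omega>" using v by (simp add: W1p_def)
  then have "(\<lambda>x. v x - \<phi> x) \<in> Lp_fun p \<Omega>" by (rule Lp_fun_diff[OF _ test_function_Lp(1)[OF \<phi>] p0])
  moreover have "(\<lambda>x. weak_deriv_along \<Omega> (X i) v x - vf_deriv (X i) \<phi> x) \<in> Lp_fun p \<Omega>" for i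
    by (rule Lp_fun_diff[OF W1p_weak_deriv(2)[OF v] test_function_Lp(2)[OF \<phi>] p0])
  ultimately show "(\<lambda>x. v x - \<phi> x) \<in> W1p p \<Omega> X" using w unfolding W1p_def by blast
  have "AE x in lebesgue_on \<Omega>. weak_deriv_along \<Omega> (X i) (\<lambda>x. v x - \<phi> x) x
      = weak_deriv_along \<Omega> (X i) v x - vf_deriv (X i) \<phi> x" for i
    by (rule has_weak_deriv_along_unique[OF open_\<Omega> weak_deriv_along_works[OF w] w])
  then have "AE x in lebesgue_on \<Omega>. \<forall>i. weak_deriv_along \<Omega> (X i) (\<lambda>x. v x - \<phi> x) x
      = weak_deriv_along \<Omega> (X i) v x - vf_deriv (X i) \<phi> x"
    by (rule eventually_all_finite)
  then show "AE x in lebesgue_on \<Omega>. X_grad \<Omega> X (\<lambda>x. v x - \<phi> x) x = X_grad \<Omega> X v x - vf_grad X \<phi> x"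
    by eventually_elim (simp add: X_grad_def vf_grad_def vec_eq_iff)
qed

text \<open>\<open>\<phi>\<close> approximates itself, but the chosen gradient of the zero function
  is only known to vanish almost everywhere, so the norm still has to be computed.\<close>

lemma test_function_W1p_zero:
  assumes \<phi>: "\<phi> \<in> test_functions \<Omega>"
  shows "\<phi> \<in> W1p_zero p \<Omega> X"
proof -
  have wd: "has_weak_deriv_along \<Omega> (X i) \<phi> (weak_deriv_along \<Omega> (X i) \<phi>)" for i
    by (rule W1p_weak_deriv(1)[OF test_function_W1p[OF \<phi>]])
  have "AE x in lebesgue_on \<Omega>. \<forall>i. weak_deriv_along \<Omega> (X i) \<phi> x = vf_deriv (X i) \<phi> x"
    by (rule eventually_all_finite, rule has_weak_deriv_along_unique[OF open_\<Omega> wd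
          has_weak_deriv_along_test_function[OF \<phi>]])
  then have "AE x in lebesgue_on \<Omega>. X_grad \<Omega> X \<phi> x = vf_grad X \<phi> x"
    by eventually_elim (simp add: X_grad_def vf_grad_def)
  with X_grad_diff_test_function(2)[OF test_function_W1p[OF \<phi>] \<phi>]
  have "AE x in lebesgue_on \<Omega>. \<bar>\<phi> x - \<phi> x\<bar> powr p + norm (X_grad \<Omega> X (\<lambda>x. \<phi> x - \<phi> x) x) powr p = 0"
    by eventually_elim simp
  then have "(LINT x|lebesgue_on \<Omega>. \<bar>\<phi> x - \<phi> x\<bar> powr p + norm (X_grad \<Omega> X (\<lambda>x. \<phi> x - \<phi> x) x) powr p) = 0"
    by (rule integral_eq_zero_AE)
  then have "W1p_norm p \<Omega> X (\<lambda>x. \<phi> x - \<phi> x) = 0" by (simp only: W1p_norm_def powr_0)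
  then show ?thesis using test_function_W1p[OF \<phi>] \<phi> unfolding W1p_zero_def by force
qed

text \<open>The bound passes to the closure by splitting \<open>v\<close> into a test function and a
  small remainder, once for the functions and once for the gradients. Each crude splitting costs a
  factor \<open>P\<close>, which is harmless because only the finiteness of the constant is used
  later.\<close>

lemma poincare_W1p_zero:
  assumes span: "commutators_span X U s"
  obtains C where "C > 0" "\<And>v. v \<in> W1p_zero p \<Omega> X \<Longrightarrow>
    (LINT x|lebesgue_on \<Omega>. \<bar>v x\<bar> powr p) \<le> C * (LINT x|lebesgue_on \<Omega>. norm (X_grad \<Omega> X v x) powr p)"
proof -
  obtain C where C: "C > 0" "\<And>u. u \<in> test_functions \<Omega> \<Longrightarrow>
    (LINT x|lborel. \<bar>u x\<bar> powr p) \<le> C * vf_energy p X u"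
    using poincare_test_functions[OF span] by blast
  define P where "P = (2::real) powr p"
  have P: "P > 0" by (simp add: P_def)
  have p0: "0 < p" using p by simp
  have main: "(LINT x|lebesgue_on \<Omega>. \<bar>v x\<bar> powr p)
      \<le> P * C * P * (LINT x|lebesgue_on \<Omega>. norm (X_grad \<Omega> X v x) powr p) + (P * C * P + P) * \<delta>"
    if v0: "v \<in> W1p_zero p \<Omega> X" and \<delta>: "\<delta> > 0" for v \<delta>
  proof -
    have v: "v \<in> W1p p \<Omega> X" using v0 by (simp add: W1p_zero_def)
    \<comment> \<open>The norm is a p-th root; with this tolerance the integrals \<open>Nh\<close>
      and \<open>Eh\<close> of the remainder have sum below \<open>\<delta>\<close>.\<close>
    have "\<delta> powr (1 / p) > 0" using \<delta> by simp
    then obtain \<phi> where \<phi>: "\<phi> \<in> test_functions \<Omega>" "W1p_norm p \<Omega> X (\<lambda>x. v x - \<phi> x) < \<delta> powr (1 / p)"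
      using v0 unfolding W1p_zero_def by blast
    define h where "h x = v x - \<phi> x" for x
    have h: "h \<in> W1p p \<Omega> X" unfolding h_def by (rule X_grad_diff_test_function(1)[OF v \<phi>(1)])
    note iv = W1p_integrable[OF v] and ih = W1p_integrable[OF h]
    define Nh where "Nh = (LINT x|lebesgue_on \<Omega>. \<bar>h x\<bar> powr p)"
    define Eh where "Eh = (LINT x|lebesgue_on \<Omega>. norm (X_grad \<Omega> X h x) powr p)"
    define Ev where "Ev = (LINT x|lebesgue_on \<Omega>. norm (X_grad \<Omega> X v x) powr p)"
    have nn: "Nh \<ge> 0" "Eh \<ge> 0" by (simp_all add: Nh_def Eh_def)
    have "(Nh + Eh) powr (1 / p) < \<delta> powr (1 / p)"
      using \<phi>(2) ih by (simp add: W1p_norm_def Nh_def Eh_def h_def[abs_def])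
    then have sm: "Nh + Eh < \<delta>"
      using nn \<delta> p0 by (metis add_nonneg_nonneg less_imp_le not_le powr_mono2 zero_less_divide_1_iff)
    have out: "x \<notin> closure {x. \<phi> x \<noteq> 0}" if "x \<notin> \<Omega>" for x
      using test_functionsD(3)[OF \<phi>(1)] that by blast
    have \<phi>0: "\<bar>\<phi> x\<bar> powr p = 0" if "x \<notin> \<Omega>" for x
      by (rule test_function_abs_powr(2)[OF \<phi>(1) p out[OF that]])
    have E0: "norm (vf_grad X \<phi> x) powr p = 0" if "x \<notin> \<Omega>" for x
      by (simp add: vf_grad_test_function(3)[OF \<phi>(1) out[OF that]])
    have c1: "(\<lambda>x. \<bar>\<phi> x\<bar> powr p) \<in> borel_measurable borel"
      using Ck_on_SucD[OF test_function_abs_powr(1)[OF \<phi>(1) p]] by (simp add: borel_measurable_continuous_onI)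
    have c2: "(\<lambda>x. norm (vf_grad X \<phi> x) powr p) \<in> borel_measurable borel"
      by (intro borel_measurable_continuous_onI norm_powr_continuous p0 vf_grad_test_function(2)[OF \<phi>(1)])
    have i1: "integrable (lebesgue_on \<Omega>) (\<lambda>x. \<bar>\<phi> x\<bar> powr p)"
      using test_function_Lp(1)[OF \<phi>(1)] by (simp add: Lp_fun_def)
    have i2: "integrable (lebesgue_on \<Omega>) (\<lambda>x. norm (vf_grad X \<phi> x) powr p)"
      using integral_lebesgue_on_lborel(2)[OF open_\<Omega> c2 E0] vf_grad_test_function(4)[OF \<phi>(1)] by simp
    have "(LINT x|lebesgue_on \<Omega>. \<bar>v x\<bar> powr p) \<le> (LINT x|lebesgue_on \<Omega>. P * (\<bar>\<phi> x\<bar> powr p + \<bar>h x\<bar> powr p))"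
    proof (rule integral_mono)
      show "integrable (lebesgue_on \<Omega>) (\<lambda>x. P * (\<bar>\<phi> x\<bar> powr p + \<bar>h x\<bar> powr p))"
        by (intro integrable_mult_right Bochner_Integration.integrable_add i1 ih)
      fix x
      have "\<bar>v x\<bar> powr p \<le> (\<bar>\<phi> x\<bar> + \<bar>h x\<bar>) powr p" using p0 by (intro powr_mono2) (auto simp: h_def)
      also have "\<dots> \<le> P * (\<bar>\<phi> x\<bar> powr p + \<bar>h x\<bar> powr p)" unfolding P_def using p0 by (intro powr_add_le) auto
      finally show "\<bar>v x\<bar> powr p \<le> P * (\<bar>\<phi> x\<bar> powr p + \<bar>h x\<bar> powr p)" .
    qed (rule iv)
    also have "\<dots> = P * ((LINT x|lebesgue_on \<Omega>. \<bar>\<phi> x\<bar> powr p) + Nh)"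
      using i1 ih by (simp add: Nh_def)
    also have "(LINT x|lebesgue_on \<Omega>. \<bar>\<phi> x\<bar> powr p) = (LINT x|lborel. \<bar>\<phi> x\<bar> powr p)"
      by (rule integral_lebesgue_on_lborel(1)[OF open_\<Omega> c1 \<phi>0])
    also have "\<dots> \<le> C * vf_energy p X \<phi>" by (rule C(2)[OF \<phi>(1)])
    also have "vf_energy p X \<phi> = (LINT x|lebesgue_on \<Omega>. norm (vf_grad X \<phi> x) powr p)"
      unfolding vf_energy_def by (rule integral_lebesgue_on_lborel(1)[OF open_\<Omega> c2 E0, symmetric])
    also have "\<dots> \<le> (LINT x|lebesgue_on \<Omega>. P * (norm (X_grad \<Omega> X v x) powr p + norm (X_grad \<Omega> X h x) powr p))"
    proof (rule integral_mono_AE[OF i2])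
      show "integrable (lebesgue_on \<Omega>) (\<lambda>x. P * (norm (X_grad \<Omega> X v x) powr p + norm (X_grad \<Omega> X h x) powr p))"
        by (intro integrable_mult_right Bochner_Integration.integrable_add iv ih)
      have "AE x in lebesgue_on \<Omega>. X_grad \<Omega> X h x = X_grad \<Omega> X v x - vf_grad X \<phi> x"
        unfolding h_def by (rule X_grad_diff_test_function(2)[OF v \<phi>(1)])
      then show "AE x in lebesgue_on \<Omega>. norm (vf_grad X \<phi> x) powr p
          \<le> P * (norm (X_grad \<Omega> X v x) powr p + norm (X_grad \<Omega> X h x) powr p)"
      proof eventually_elim
        case (elim x)
        then have "vf_grad X \<phi> x = X_grad \<Omega> X v x - X_grad \<Omega> X h x" by simp
        then have "norm (vf_grad X \<phi> x) powr p \<le> (norm (X_grad \<Omega> X v x) + norm (X_grad \<Omega> X h x)) powr p"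
          using p0 norm_triangle_ineq4[of "X_grad \<Omega> X v x" "X_grad \<Omega> X h x"] by (intro powr_mono2) auto
        also have "\<dots> \<le> P * (norm (X_grad \<Omega> X v x) powr p + norm (X_grad \<Omega> X h x) powr p)"
          unfolding P_def using p0 by (intro powr_add_le) auto
        finally show ?case .
      qed
    qed
    also have "\<dots> = P * (Ev + Eh)" using iv ih by (simp add: Ev_def Eh_def)
    finally have "(LINT x|lebesgue_on \<Omega>. \<bar>v x\<bar> powr p) \<le> P * (C * (P * (Ev + Eh)) + Nh)"
      using P C(1) by (simp add: mult_left_mono)
    also have "\<dots> = P * C * P * Ev + (P * C * P * Eh + P * Nh)" by (simp add: algebra_simps)
    also have "P * C * P * Eh + P * Nh \<le> P * C * P * \<delta> + P * \<delta>"
      using sm nn P C(1) by (intro add_mono mult_left_mono) auto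
    finally show ?thesis by (simp add: Ev_def algebra_simps)
  qed
  show thesis
  proof (rule that[of "P * C * P"])
    show "0 < P * C * P" using P C(1) by simp
    fix v assume v: "v \<in> W1p_zero p \<Omega> X"
    show "(LINT x|lebesgue_on \<Omega>. \<bar>v x\<bar> powr p)
        \<le> P * C * P * (LINT x|lebesgue_on \<Omega>. norm (X_grad \<Omega> X v x) powr p)"
    proof (rule field_le_epsilon)
      fix e :: real assume e: "e > 0"
      have K: "P * C * P + P > 0" using P C(1) by (simp add: add_pos_pos)
      show "(LINT x|lebesgue_on \<Omega>. \<bar>v x\<bar> powr p)
          \<le> P * C * P * (LINT x|lebesgue_on \<Omega>. norm (X_grad \<Omega> X v x) powr p) + e"
        using main[OF v, of "e / (P * C * P + P)"] e K by simp
    qed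
  qed
qed

section \<open>The first eigenvalue as the inverse of the best constant\<close>

lemma nonzero_test_function:
  assumes "\<Omega> \<noteq> {}"
  obtains \<phi> where "\<phi> \<in> test_functions \<Omega>" "\<not> (AE x in lebesgue_on \<Omega>. \<phi> x = 0)"
proof -
  obtain x where "x \<in> \<Omega>" using assms by blast
  then obtain a b where ab: "cbox a b \<subseteq> \<Omega>" "x \<in> box a b"
    using open_contains_cbox[OF open_\<Omega>] by metis
  show thesis
  proof (rule that)
    show "box_bump 1 a b \<in> test_functions \<Omega>" using ab by (intro box_bump_test_function) auto
    show "\<not> (AE x in lebesgue_on \<Omega>. box_bump 1 a b x = 0)"
    proof
      assume "AE x in lebesgue_on \<Omega>. box_bump 1 a b x = 0"
      then have "AE x in lebesgue. x \<in> \<Omega> \<longrightarrow> box_bump 1 a b x = 0"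
        using open_\<Omega> by (simp add: AE_restrict_space_iff)
      then have "AE x in lebesgue. x \<notin> box a b"
        by eventually_elim (use ab box_subset_cbox[of a b] box_bump_bounds(3)[of 1 a b] in auto)
      then have "box a b \<in> null_sets lebesgue"
        by (subst AE_iff_null_sets) (auto intro: fmeasurableD)
      then show False using open_not_negligible[OF open_box, of a b] ab(2)
        by (auto simp: negligible_iff_null_sets)
    qed
  qed
qed

text \<open>For \<open>K > 0\<close>, the inequality with constant \<open>K\<close> holds precisely
  if \<open>inverse K\<close> is a lower bound of the quotients. The least admissible constant is
  thus the inverse of their infimum, provided that this infimum is positive.\<close>

lemma poincare_friedrichs_sharp:
  assumes span: "commutators_span X U s" and ne: "\<Omega> \<noteq> {}"
  defines "N \<equiv> \<lambda>u. LINT x|lebesgue_on \<Omega>. \<bar>u x\<bar> powr p"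
    and "E \<equiv> \<lambda>u. LINT x|lebesgue_on \<Omega>. norm (X_grad \<Omega> X u x) powr p"
    and "l \<equiv> first_eigenvalue p \<Omega> X"
  shows "(\<forall>u\<in>W1p_zero p \<Omega> X. N u \<le> inverse l * E u)
       \<and> (\<forall>C<inverse l. \<not> (\<forall>u\<in>W1p_zero p \<Omega> X. N u \<le> C * E u))"
proof -
  define A where "A = {E v / N v | v. v \<in> W1p_zero p \<Omega> X \<and> \<not> (AE x in lebesgue_on \<Omega>. v x = 0)}"
  have l: "l = Inf A" by (simp add: l_def first_eigenvalue_def A_def N_def E_def)
  have nn: "N u \<ge> 0" "E u \<ge> 0" for u by (simp_all add: N_def E_def)
  have N0: "N u = 0 \<longleftrightarrow> (AE x in lebesgue_on \<Omega>. u x = 0)" if "u \<in> W1p_zero p \<Omega> X" for u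
  proof -
    have "integrable (lebesgue_on \<Omega>) (\<lambda>x. \<bar>u x\<bar> powr p)"
      using that by (intro W1p_integrable) (simp add: W1p_zero_def)
    then have "N u = 0 \<longleftrightarrow> (AE x in lebesgue_on \<Omega>. \<bar>u x\<bar> powr p = 0)"
      unfolding N_def by (intro integral_nonneg_eq_0_iff_AE) auto
    then show ?thesis by simp
  qed
  obtain C where C: "C > 0" "\<And>v. v \<in> W1p_zero p \<Omega> X \<Longrightarrow> N v \<le> C * E v"
    using poincare_W1p_zero[OF span] unfolding N_def E_def by blast
  \<comment> \<open>A nonzero competitor: it makes the set of quotients nonempty, so that its
    infimum is meaningful, and later forces admissible constants to be positive.\<close>
  obtain \<phi> where \<phi>: "\<phi> \<in> W1p_zero p \<Omega> X" "\<not> (AE x in lebesgue_on \<Omega>. \<phi> x = 0)"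
    using nonzero_test_function[OF ne] test_function_W1p_zero by metis
  have ratio: "inverse K \<le> r" if K: "K > 0" "\<And>v. v \<in> W1p_zero p \<Omega> X \<Longrightarrow> N v \<le> K * E v" and "r \<in> A" for K r
  proof -
    obtain v where v: "r = E v / N v" "v \<in> W1p_zero p \<Omega> X" "\<not> (AE x in lebesgue_on \<Omega>. v x = 0)"
      using \<open>r \<in> A\<close> by (auto simp: A_def)
    then have "N v > 0" using N0[OF v(2)] nn(1)[of v] by linarith
    then show ?thesis using K(1) K(2)[OF v(2)] by (simp add: v(1) field_simps)
  qed
  have Ane: "A \<noteq> {}" using \<phi> by (auto simp: A_def)
  have lower: "inverse K \<le> l" if "K > 0" "\<And>v. v \<in> W1p_zero p \<Omega> X \<Longrightarrow> N v \<le> K * E v" for K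
    unfolding l by (rule cInf_greatest[OF Ane ratio[OF that]])
  \<comment> \<open>This is what the inequality with the non-explicit constant \<open>C\<close> is
    for: if the infimum were 0, \<open>inverse l\<close> would be 0 by convention.\<close>
  have l0: "l > 0" using lower[OF C] C(1) by (meson less_le_trans positive_imp_inverse_positive)
  have "bdd_below A" using ratio[OF C] by (rule bdd_belowI)
  have ineq: "N u \<le> inverse l * E u" if u: "u \<in> W1p_zero p \<Omega> X" for u
  proof (cases "AE x in lebesgue_on \<Omega>. u x = 0")
    case True
    then show ?thesis using N0[OF u] nn(2)[of u] l0 by simp
  next
    case False
    then have "N u > 0" using N0[OF u] nn(1)[of u] by linarith
    moreover have "l \<le> E u / N u"
      unfolding l using False u by (intro cInf_lower[OF _ \<open>bdd_below A\<close>]) (auto simp: A_def)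
    ultimately show ?thesis using l0 by (simp add: field_simps)
  qed
  moreover have "\<not> (\<forall>u\<in>W1p_zero p \<Omega> X. N u \<le> K * E u)" if K: "K < inverse l" for K
  proof
    assume all: "\<forall>u\<in>W1p_zero p \<Omega> X. N u \<le> K * E u"
    have "0 < N \<phi>" using N0[OF \<phi>(1)] \<phi>(2) nn(1)[of \<phi>] by linarith
    also have "N \<phi> \<le> K * E \<phi>" using all \<phi>(1) by blast
    \<comment> \<open>A constant \<open>K \<le> 0\<close> is refuted by \<open>\<phi>\<close>; only
      for positive \<open>K\<close> do inverses reverse the order.\<close>
    finally have "K > 0" using nn(2)[of \<phi>] by (simp add: zero_less_mult_iff)
    then have "inverse K \<le> l" using all by (intro lower) auto
    then have "inverse l \<le> K" using \<open>K > 0\<close> by (metis inverse_inverse_eq le_imp_inverse_le positive_imp_inverse_positive)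
    then show False using K by simp
  qed
  ultimately show ?thesis by blast
qed

end

theorem corollary3p8:
  fixes p :: real and s :: nat
    and U \<Omega> :: "(real^'n::finite) set"
    and X :: "'m::finite \<Rightarrow> real^'n \<Rightarrow> real^'n"
  assumes "1 < p"
    and "CARD('n) \<ge> 2" and "CARD('m) \<le> CARD('n)"
    and "open U" and "connected U" and "U \<noteq> {}" and "bounded U"
    and "\<And>i. smooth_vector_field_on U (X i)"
    and "hormander_at_step X U s"
    and "open \<Omega>" and "connected \<Omega>" and "\<Omega> \<noteq> {}" and "compactly_inside \<Omega> U"
  shows "(\<forall>u\<in>W1p_zero p \<Omega> X.
            (LINT x|lebesgue_on \<Omega>. \<bar>u x\<bar> powr p)
              \<le> inverse (first_eigenvalue p \<Omega> X)
                 * (LINT x|lebesgue_on \<Omega>. norm (X_grad \<Omega> X u x) powr p))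
       \<and> (\<forall>C < inverse (first_eigenvalue p \<Omega> X).
            \<not> (\<forall>u\<in>W1p_zero p \<Omega> X.
                 (LINT x|lebesgue_on \<Omega>. \<bar>u x\<bar> powr p)
                   \<le> C * (LINT x|lebesgue_on \<Omega>. norm (X_grad \<Omega> X u x) powr p)))"
proof -
  interpret vector_fields_near p U \<Omega> X
    using assms by unfold_locales auto
  have "commutators_span X U s" using assms by (simp add: hormander_at_step_def)
  then show ?thesis by (rule poincare_friedrichs_sharp) (use assms in simp)
qed

end
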